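(* Let $\{\eta(t):t\ge0\}$ be a configuration process with dual process $\{\xi(t):t\ge0\}$ and duality function $D$ satisfying the standing assumptions listed in the context. Let $\mathcal{I}$ be the set of invariant probability measures of $\{\eta(t)\}$, $\mathcal{I}_e$ its set of extreme points, $\mathcal{T}$ the set of tempered probability measures on $\Omega$, and $$K=\Big\{\int D(\delta_x,\eta)\,d\mu(\eta):\ \mu\text{ is an invariant tempered product probability measure}\Big\}.$$ 1. If $\mu$ is an invariant tempered product probability measure, then it is ergodic. 2. If there exists a successful coupling for the dual process, then the only tempered invariant probability measures which are ergodic are the product probability measures $\mu_\theta$ for which $\widehat{\mu}_\theta(\xi)=\theta^{|\xi|}$ with $\theta\in K$. 3. If there exists a successful coupling for the dual process, then $$(\mathcal{T}\cap\mathcal{I})_e=\mathcal{T}\cap\mathcal{I}_e=\{\mu_\theta:\theta\in K\},$$ where $(\mathcal{T}\cap\mathcal{I})_e$ is the set of extreme points of $\mathcal{T}\cap\mathcal{I}$.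
   Context: **Configurations.** $G$ is an infinite countable set, $\mathbb{N}=\{0,1,2,\dots\}$, and $\{\eta(t):t\ge0\}$ is a Markov process on (a subset of) $\Omega=\mathbb{N}^G$ with semigroup $S(t)f(\eta)=\mathbb{E}_\eta f(\eta(t))$. For $\xi\in\Omega$ let $|\xi|=\sum_{x\in G}\xi_x$; $\Omega_f=\{\xi\in\Omega:|\xi|<\infty\}$ and $\Omega_n=\{\xi\in\Omega:|\xi|=n\}$; $\delta_x$ is the configuration with a single particle at $x\in G$. **Duality (standing assumptions).** There is a Markov process $\{\xi(t):t\ge0\}$ on $\Omega_f$ (the dual process, with path space measure $\widehat{\mathbb{P}}_\xi$ and expectation $\widehat{\mathbb{E}}_\xi$ when started from $\xi$) and a function $D:\Omega_f\times\Omega\to[0,\infty)$ with $\mathbb{E}_\eta D(\xi,\eta(t))=\widehat{\mathbb{E}}_\xi D(\xi(t),\eta)$ and $D(\emptyset,\eta)=1$ ($\emptyset$ the empty configuration). Moreover $D$ is of homogeneous factorized form $D(\xi,\eta)=\prod_{x\in G}d(\xi_x,\eta_x)$, with $d(0,n)=1$, $d(k,\cdot)$ a non-negative polynomial of degree $k$, and every polynomial $p(n)$ of degree $k$ is a linear combination of the polynomials $d(r,n)$, $0\le r\le k$. The number of particles is conserved both in $\{\eta(t)\}$ and in $\{\xi(t)\}$. **Dual process (standing assumptions).** The dual process is irreducible on each $\Omega_n$, and for all $\xi,\xi'\in\Omega_f$, $\lim_{t\to\infty}\widehat{\mathbb{P}}_\xi(\xi(t)\perp\xi')=1$, where $\xi\perp\xi'$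 means that the supports of $\xi$ and $\xi'$ are disjoint. **$D$-transform and tempered measures.** For a probability measure $\mu$ on $\Omega$, $\widehat\mu(\xi)=\int D(\xi,\eta)\,d\mu(\eta)$, $\xi\in\Omega_f$ (integrability is implicitly assumed). $\mu$ is tempered if (1) for all $n\in\mathbb{N}$, $\sup_{|\xi|\le n}\int D(\xi,\eta)\,d\mu(\eta)<\infty$; (2) $\mu$ is determined by its $D$-transform, i.e. $\widehat\mu=\widehat\nu$ if and only if $\mu=\nu$; (3) the vector space spanned by $\{D(\xi,\cdot):\xi\in\Omega_f\}$ is dense in $L^2(\mu)$. **Ergodic.** $\mu\in\mathcal{I}$ is ergodic if for any $f\in L^2(\mu)$, $S(t)f=f$ for all $t\ge0$ implies $f=\int f\,d\mu$ almost surely. The set of ergodic probability measures coincides with $\mathcal{I}_e$. **Successful coupling.** The dual process admits a successful coupling if for all $n\in\mathbb{N}$ and $\xi,\xi'\in\Omega_n$ there is a coupling $\{(\xi^{(1)}(t),\xi^{(2)}(t)):t\ge0\}$ of the dual processes started from $\xi$ and $\xi'$ such that $\tau_{\xi,\xi'}=\inf\{T>0:\xi^{(1)}(t)=\xi^{(2)}(t)\text{ for all }t\ge T\}$ is almost surely finite. *)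

theory Defs
  imports "HOL-Probability.Probability" "HOL-Computational_Algebra.Polynomial"
begin

section \<open>Configurations\<close>

type_synonym 'g config = "'g \<Rightarrow> nat"

definition config_space :: "'g config measure" where
  "config_space = (\<Pi>\<^sub>M x\<in>UNIV. count_space UNIV)"

text \<open>The total number of particles, with value \<open>\<infinity>\<close> for infinite configurations.\<close>

definition particles :: "'g config \<Rightarrow> ennreal" where
  "particles \<xi> = (\<Sum>\<^sub>\<infinity>x\<in>UNIV. of_nat (\<xi> x))"

definition fin_configs :: "'g config set" where
  "fin_configs = {\<xi>. particles \<xi> < \<infinity>}"

definition n_configs :: "nat \<Rightarrow> 'g config set" where
  "n_configs n = {\<xi>. particles \<xi> = of_nat n}"

definition single :: "'g \<Rightarrow> 'g config" where
  "single x = (\<lambda>y. if y = x then 1 else 0)"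

definition supp :: "'g config \<Rightarrow> 'g set" where
  "supp \<xi> = {x. \<xi> x \<noteq> 0}"

definition perp :: "'g config \<Rightarrow> 'g config \<Rightarrow> bool" where
  "perp \<xi> \<xi>' \<longleftrightarrow> supp \<xi> \<inter> supp \<xi>' = {}"

lemma fin_configs_iff: "\<xi> \<in> fin_configs \<longleftrightarrow> finite (supp \<xi>)"
proof
  assume "finite (supp \<xi>)"
  then have "(\<Sum>\<^sub>\<infinity>x\<in>UNIV. of_nat (\<xi> x)) = (\<Sum>x\<in>supp \<xi>. of_nat (\<xi> x) :: ennreal)"
    by (subst infsum_cong_neutral[where T = "supp \<xi>" and g = "\<lambda>x. of_nat (\<xi> x)"])
       (auto simp: supp_def)
  then show "\<xi> \<in> fin_configs"
    unfolding fin_configs_def particles_def mem_Collect_eq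
    by (metis infinity_ennreal_def of_nat_less_top of_nat_sum)
next
  assume fin: "\<xi> \<in> fin_configs"
  have le: "of_nat (card F) \<le> particles \<xi>" if "finite F" "F \<subseteq> supp \<xi>" for F
  proof -
    have "of_nat (card F) = (\<Sum>x\<in>F. 1 :: ennreal)" by simp
    also have "\<dots> \<le> (\<Sum>x\<in>F. of_nat (\<xi> x))"
    proof (rule sum_mono)
      fix x assume "x \<in> F"
      then have "1 \<le> \<xi> x" using that by (auto simp: supp_def)
      then have "(of_nat 1 :: ennreal) \<le> of_nat (\<xi> x)" by (rule of_nat_mono)
      then show "(1 :: ennreal) \<le> of_nat (\<xi> x)" by simp
    qed
    also have "\<dots> \<le> particles \<xi>"
      unfolding particles_def
      using that by (subst nonneg_infsum_complete) (auto intro!: SUP_upper)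
    finally show ?thesis .
  qed
  show "finite (supp \<xi>)"
  proof (rule ccontr)
    assume inf: "infinite (supp \<xi>)"
    obtain n :: nat where n: "particles \<xi> < of_nat n"
      using fin unfolding fin_configs_def
      by (metis ennreal_Ex_less_of_nat infinity_ennreal_def mem_Collect_eq)
    obtain F where "finite F" "card F = n" "F \<subseteq> supp \<xi>"
      using infinite_arbitrarily_large[OF inf] by blast
    with le[of F] n show False by simp
  qed
qed


section \<open>Markov processes\<close>

text \<open>
  A process with state space \<open>S\<close> is given by its path space measures \<open>P x\<close> (the law of the
  process started from \<open>x\<close>) on the product sigma-algebra over the times \<open>[0,\<infinity>)\<close>. No path
  regularity is required. Since that sigma-algebra only sees countably many times at once, almost
  sure statements about the paths have to be made for each fixed time.
\<close>

definition path_space :: "'s measure \<Rightarrow> (real \<Rightarrow> 's) measure" where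
  "path_space S = (\<Pi>\<^sub>M t\<in>{0..}. S)"

definition past :: "'s measure \<Rightarrow> real \<Rightarrow> (real \<Rightarrow> 's) measure" where
  "past S s = vimage_algebra (space (path_space S)) (\<lambda>\<omega>. restrict \<omega> {0..s}) (\<Pi>\<^sub>M t\<in>{0..s}. S)"

definition markov_process :: "'s measure \<Rightarrow> ('s \<Rightarrow> (real \<Rightarrow> 's) measure) \<Rightarrow> bool" where
  "markov_process S P \<longleftrightarrow>
     P \<in> S \<rightarrow>\<^sub>M prob_algebra (path_space S) \<and>
     (\<forall>x\<in>space S. AE \<omega> in P x. \<omega> 0 = x) \<and>
     (\<forall>x\<in>space S. \<forall>s\<ge>0. \<forall>t\<ge>0. \<forall>A\<in>sets S.
        AE \<omega> in P x.
          real_cond_exp (P x) (past S s) (\<lambda>\<omega>'. indicator A (\<omega>' (s + t))) \<omega>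
            = measure (P (\<omega> s)) {\<omega>' \<in> space (path_space S). \<omega>' t \<in> A})"

definition transition_semigroup ::
    "('s \<Rightarrow> (real \<Rightarrow> 's) measure) \<Rightarrow> real \<Rightarrow> ('s \<Rightarrow> real) \<Rightarrow> 's \<Rightarrow> real" where
  "transition_semigroup P t f x = (\<integral>\<omega>. f (\<omega> t) \<partial>P x)"

definition conserves_particles ::
    "'g config set \<Rightarrow> ('g config \<Rightarrow> (real \<Rightarrow> 'g config) measure) \<Rightarrow> bool" where
  "conserves_particles E P \<longleftrightarrow>
     (\<forall>\<eta>\<in>E. \<forall>t\<ge>0. AE \<omega> in P \<eta>. particles (\<omega> t) = particles \<eta>)"

definition irreducible_on ::
    "'g config set \<Rightarrow> ('g config \<Rightarrow> (real \<Rightarrow> 'g config) measure) \<Rightarrow> bool" where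
  "irreducible_on E P \<longleftrightarrow>
     (\<forall>\<xi>\<in>E. \<forall>\<xi>'\<in>E. \<exists>t\<ge>0. measure (P \<xi>) {\<omega> \<in> space (P \<xi>). \<omega> t = \<xi>'} > 0)"


section \<open>Invariant, ergodic, extreme and product measures\<close>

definition prob_measures :: "'g config measure set" where
  "prob_measures = {\<mu>. prob_space \<mu> \<and> sets \<mu> = sets config_space}"

text \<open>
  The process \<open>P\<close> lives on the measurable subset \<open>E\<close> of all configurations. An invariant measure
  is a probability measure on all configurations that is concentrated on \<open>E\<close>; the semigroup is
  meaningful on \<open>E\<close> only, hence the set integral.
\<close>

definition invariant_measures ::
    "'g config set \<Rightarrow> ('g config \<Rightarrow> (real \<Rightarrow> 'g config) measure) \<Rightarrow> 'g config measure set" where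
  "invariant_measures E P =
     {\<mu> \<in> prob_measures.
        (AE \<eta> in \<mu>. \<eta> \<in> E) \<and>
        (\<forall>t\<ge>0. \<forall>f\<in>borel_measurable config_space. bounded (range f) \<longrightarrow>
           (LINT \<eta>:E|\<mu>. transition_semigroup P t f \<eta>) = (\<integral>\<eta>. f \<eta> \<partial>\<mu>))}"

definition L2 :: "'a measure \<Rightarrow> ('a \<Rightarrow> real) set" where
  "L2 \<mu> = {f \<in> borel_measurable \<mu>. integrable \<mu> (\<lambda>\<eta>. (f \<eta>)\<^sup>2)}"

definition ergodic_measures ::
    "'g config set \<Rightarrow> ('g config \<Rightarrow> (real \<Rightarrow> 'g config) measure) \<Rightarrow> 'g config measure set" where
  "ergodic_measures E P =
     {\<mu> \<in> invariant_measures E P.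
        \<forall>f\<in>L2 \<mu>. (\<forall>t\<ge>0. AE \<eta> in \<mu>. transition_semigroup P t f \<eta> = f \<eta>) \<longrightarrow>
          (AE \<eta> in \<mu>. f \<eta> = (\<integral>\<eta>'. f \<eta>' \<partial>\<mu>))}"

text \<open>The library's \<open>extreme_point_of\<close> needs a real vector space, which measures do not form.\<close>

definition extreme_measures :: "'a measure set \<Rightarrow> 'a measure set" where
  "extreme_measures \<M> =
     {\<mu> \<in> \<M>. \<not> (\<exists>\<mu>\<^sub>1\<in>\<M>. \<exists>\<mu>\<^sub>2\<in>\<M>. \<exists>a::real.
        0 < a \<and> a < 1 \<and> \<mu>\<^sub>1 \<noteq> \<mu>\<^sub>2 \<and>
        (\<forall>A\<in>sets \<mu>. measure \<mu> A = a * measure \<mu>\<^sub>1 A + (1 - a) * measure \<mu>\<^sub>2 A))}"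

text \<open>The marginals of a product measure need not be identical.\<close>

definition product_measures :: "'g config measure set" where
  "product_measures =
     {\<mu>. \<exists>m. (\<forall>x. prob_space (m x) \<and> sets (m x) = sets (count_space (UNIV :: nat set))) \<and>
        \<mu> = (\<Pi>\<^sub>M x\<in>UNIV. m x)}"


section \<open>Duality\<close>

text \<open>
  Since \<open>d 0 n = 1\<close>, all factors outside the (finite) support of \<open>\<xi>\<close> in the product over all
  sites are 1. Polynomials are functions on the natural numbers, and nonnegativity is required at
  natural numbers only.
\<close>

definition factorized_duality_function ::
    "(nat \<Rightarrow> nat \<Rightarrow> real) \<Rightarrow> ('g config \<Rightarrow> 'g config \<Rightarrow> real) \<Rightarrow> bool" where
  "factorized_duality_function d D \<longleftrightarrow>
     (\<forall>\<xi>\<in>fin_configs. \<forall>\<eta>. D \<xi> \<eta> = (\<Prod>x\<in>supp \<xi>. d (\<xi> x) (\<eta> x))) \<and>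
     (\<forall>n. d 0 n = 1) \<and>
     (\<forall>k n. d k n \<ge> 0) \<and>
     (\<forall>k. \<exists>p :: real poly. degree p = k \<and> (\<forall>n. d k n = poly p (real n))) \<and>
     (\<forall>p :: real poly. \<exists>c :: nat \<Rightarrow> real.
        \<forall>n. poly p (real n) = (\<Sum>r\<le>degree p. c r * d r n))"

text \<open>Both expectations are of nonnegative functions and are taken in \<open>[0,\<infinity>]\<close>.\<close>

definition dual_processes ::
    "'g config set \<Rightarrow> ('g config \<Rightarrow> (real \<Rightarrow> 'g config) measure) \<Rightarrow>
     ('g config \<Rightarrow> (real \<Rightarrow> 'g config) measure) \<Rightarrow> ('g config \<Rightarrow> 'g config \<Rightarrow> real) \<Rightarrow> bool" where
  "dual_processes E P Q D \<longleftrightarrow>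
     (\<forall>\<xi>\<in>fin_configs. \<forall>\<eta>\<in>E. \<forall>t\<ge>0.
        (\<integral>\<^sup>+\<omega>. ennreal (D \<xi> (\<omega> t)) \<partial>P \<eta>) = (\<integral>\<^sup>+\<omega>. ennreal (D (\<omega> t) \<eta>) \<partial>Q \<xi>))"

definition D_integrable ::
    "('g config \<Rightarrow> 'g config \<Rightarrow> real) \<Rightarrow> 'g config measure \<Rightarrow> bool" where
  "D_integrable D \<mu> \<longleftrightarrow> (\<forall>\<xi>\<in>fin_configs. integrable \<mu> (D \<xi>))"

definition D_transform ::
    "('g config \<Rightarrow> 'g config \<Rightarrow> real) \<Rightarrow> 'g config measure \<Rightarrow> 'g config \<Rightarrow> real" where
  "D_transform D \<mu> \<xi> = (\<integral>\<eta>. D \<xi> \<eta> \<partial>\<mu>)"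

definition tempered_measures ::
    "('g config \<Rightarrow> 'g config \<Rightarrow> real) \<Rightarrow> 'g config measure set" where
  "tempered_measures D =
     {\<mu> \<in> prob_measures.
        D_integrable D \<mu> \<and>
        (\<forall>n::nat. bdd_above (D_transform D \<mu> ` {\<xi>. particles \<xi> \<le> of_nat n})) \<and>
        (\<forall>\<nu>\<in>prob_measures. D_integrable D \<nu> \<longrightarrow>
           ((\<forall>\<xi>\<in>fin_configs. D_transform D \<mu> \<xi> = D_transform D \<nu> \<xi>) \<longleftrightarrow> \<mu> = \<nu>)) \<and>
        (\<forall>\<xi>\<in>fin_configs. D \<xi> \<in> L2 \<mu>) \<and>
        (\<forall>f\<in>L2 \<mu>. \<forall>\<epsilon>>0. \<exists>F c. finite F \<and> F \<subseteq> fin_configs \<and>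
           (\<integral>\<eta>. (f \<eta> - (\<Sum>\<xi>\<in>F. c \<xi> * D \<xi> \<eta>))\<^sup>2 \<partial>\<mu>) < \<epsilon>)}"

text \<open>
  The site \<open>x\<close> is arbitrary: under a successful coupling of the dual process the value does not
  depend on it.
\<close>

definition density_set ::
    "'g config set \<Rightarrow> ('g config \<Rightarrow> (real \<Rightarrow> 'g config) measure) \<Rightarrow>
     ('g config \<Rightarrow> 'g config \<Rightarrow> real) \<Rightarrow> real set" where
  "density_set E P D =
     {D_transform D \<mu> (single x) | x \<mu>.
        \<mu> \<in> invariant_measures E P \<inter> tempered_measures D \<inter> product_measures}"

text \<open>
  The predicate that defines the product measure \<open>\<mu>\<^sub>\<theta>\<close>, whose transform at \<open>\<xi>\<close> is \<open>\<theta>\<close> to the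
  power \<open>|\<xi>|\<close>.
\<close>

definition is_mu ::
    "('g config \<Rightarrow> 'g config \<Rightarrow> real) \<Rightarrow> real \<Rightarrow> 'g config measure \<Rightarrow> bool" where
  "is_mu D \<theta> \<mu> \<longleftrightarrow>
     \<mu> \<in> product_measures \<and> D_integrable D \<mu> \<and>
     (\<forall>n. \<forall>\<xi>\<in>n_configs n. D_transform D \<mu> \<xi> = \<theta> ^ n)"


section \<open>Successful couplings\<close>

definition has_path_law ::
    "'w measure \<Rightarrow> 's measure \<Rightarrow> (real \<Rightarrow> 'w \<Rightarrow> 's) \<Rightarrow> (real \<Rightarrow> 's) measure \<Rightarrow> bool" where
  "has_path_law M S X L \<longleftrightarrow>
     (\<forall>t\<ge>0. X t \<in> M \<rightarrow>\<^sub>M S) \<and>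
     distr M (path_space S) (\<lambda>w. \<lambda>t\<in>{0..}. X t w) = L"

definition coupling_time ::
    "(real \<Rightarrow> 'w \<Rightarrow> 's) \<Rightarrow> (real \<Rightarrow> 'w \<Rightarrow> 's) \<Rightarrow> 'w \<Rightarrow> ereal" where
  "coupling_time X Y w = Inf {ereal T | T. T > 0 \<and> (\<forall>t\<ge>T. X t w = Y t w)}"

text \<open>
  The coupled process may live on an arbitrary probability space; \<open>'w\<close> is the type of its sample
  points.
\<close>

definition successful_coupling ::
    "'w itself \<Rightarrow> ('g config \<Rightarrow> (real \<Rightarrow> 'g config) measure) \<Rightarrow> bool" where
  "successful_coupling _ Q \<longleftrightarrow>
     (\<forall>n. \<forall>\<xi>\<in>n_configs n. \<forall>\<xi>'\<in>n_configs n. \<exists>(M :: 'w measure) X Y.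
        prob_space M \<and>
        has_path_law M (count_space fin_configs) X (Q \<xi>) \<and>
        has_path_law M (count_space fin_configs) Y (Q \<xi>') \<and>
        (AE w in M. coupling_time X Y w < \<infinity>))"

end

theory Submission
  imports Defs
begin

text \<open>
  Everything is read off from the joint law \<open>W\<^sub>t\<close> of \<open>(\<eta>(0), \<eta>(t))\<close>
  when \<open>\<eta>(0)\<close> has law \<open>\<mu>\<close>, the \<^emph>\<open>two-time law\<close>. If
  \<open>\<mu>\<close> is invariant, then both marginals of \<open>W\<^sub>t\<close> are \<open>\<mu>\<close>,
  and a square-integrable \<open>f\<close> satisfies \<open>S(t)f = f\<close> almost surely iff
  \<open>f(\<eta>(0)) = f(\<eta>(t))\<close> almost surely under \<open>W\<^sub>t\<close>, because the mean
  square of the increment is \<open>2\<parallel>f\<parallel>\<^sup>2 - 2\<langle>f, S(t)f\<rangle>\<close>. It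
  follows, for every Markov process, that an invariant measure is extreme iff it is ergodic
  (\<open>extreme_invariant_eq_ergodic\<close>), since level sets of fixed functions split \<open>\<mu>\<close>
  into invariant pieces and bounded densities of invariant measures are fixed functions.

  Every component of a tempered mixture is itself tempered (\<open>tempered_mixture_component\<close>), i.e. the
  tempered measures form a face. Hence passing to tempered measures commutes with taking extreme points, and the first
  equality of the third claim holds. What remains is to identify the tempered ergodic measures.

  Duality turns correlations in time into correlations in space: the integral of \<open>D \<xi> (\<eta>(0)) * D
  \<zeta> (\<eta>(t))\<close> is the average of \<open>\<integral> D \<xi> * D \<kappa>
  \<partial>\<mu>\<close> over the position \<open>\<kappa>\<close> at time \<open>t\<close> of the dual process
  started from \<open>\<zeta>\<close> (\<open>integral_two_time_product\<close>).

  For a product measure, that average tends to the product of the two transforms, since the dual process leaves the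
  support of \<open>\<xi>\<close>. As the functions \<open>D \<xi>\<close> span a dense subspace, functions of
  \<open>\<eta>(0)\<close> and \<open>\<eta>(t)\<close> decorrelate and only constants are fixed
  (\<open>product_imp_ergodic\<close>).

  Conversely, a successful coupling makes the transform of a tempered invariant measure, bounded and harmonic for the
  dual process on configurations of a given size, depend on the number of particles only. Then the averages of \<open>D
  (single x)\<close> over more and more sites converge in \<open>L\<^sup>2(\<mu>)\<close>, because distinct sites
  are equally correlated. The limit, an empirical particle density, is preserved by the dynamics: a single dual
  particle, wherever it moved, is correlated in the same way with all sites but one. If \<open>\<mu>\<close> is
  ergodic, then the density is constant, so that one more particle multiplies the transform by a fixed
  \<open>\<theta>\<close> (\<open>ergodic_D_transform_step\<close>). The transform is \<open>\<theta>\<close> to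
  the number of particles, which is also the transform of the product of the marginals of \<open>\<mu>\<close>, and
  \<open>\<mu>\<close> is determined by its transform.
\<close>

section \<open>The law of the process at two times\<close>

lemma space_config_space [simp]: "space config_space = UNIV"
  by (simp add: config_space_def space_PiM)

abbreviation config_pairs :: "('g config \<times> 'g config) measure" where
  "config_pairs \<equiv> config_space \<Otimes>\<^sub>M config_space"

lemma measurable_config_component [measurable]:
  "(\<lambda>\<eta>. \<eta> x) \<in> config_space \<rightarrow>\<^sub>M count_space UNIV"
  unfolding config_space_def by measurable

locale config_process =
  fixes E :: "'g config set" and P :: "'g config \<Rightarrow> (real \<Rightarrow> 'g config) measure"
  assumes E_sets [measurable]: "E \<in> sets config_space"
    and markov: "markov_process (restrict_space config_space E) P"
begin

abbreviation state_space :: "'g config measure" where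
  "state_space \<equiv> restrict_space config_space E"

text \<open>
  The pair of the starting point and the position at time \<open>t\<close>, for a fixed starting point. It is a
  kernel on \<open>E\<close> only, so that \<open>\<mu>\<close> has to be restricted to \<open>E\<close> before it is composed with it.
\<close>

definition two_time_kernel :: "real \<Rightarrow> 'g config \<Rightarrow> ('g config \<times> 'g config) measure" where
  "two_time_kernel t \<eta> =
     distr (P \<eta>) config_pairs (\<lambda>\<omega>. (\<eta>, \<omega> t))"

definition two_time_law :: "'g config measure \<Rightarrow> real \<Rightarrow> ('g config \<times> 'g config) measure" where
  "two_time_law \<mu> t = restrict_space \<mu> E \<bind> two_time_kernel t"

definition laws_on_E :: "'g config measure set" where
  "laws_on_E = {\<mu> \<in> prob_measures. AE \<eta> in \<mu>. \<eta> \<in> E}"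

lemma P_kernel: "P \<in> state_space \<rightarrow>\<^sub>M prob_algebra (path_space state_space)"
  using markov by (simp add: markov_process_def)

lemma prob_space_P: "\<eta> \<in> E \<Longrightarrow> prob_space (P \<eta>)"
  and sets_P: "\<eta> \<in> E \<Longrightarrow> sets (P \<eta>) = sets (path_space state_space)"
  using measurable_space[OF P_kernel, of \<eta>]
  by (auto simp: space_prob_algebra space_restrict_space)

lemma eval_state [measurable]:
  assumes "t \<ge> 0" shows "(\<lambda>\<omega>. \<omega> t) \<in> path_space state_space \<rightarrow>\<^sub>M state_space"
  using assms unfolding path_space_def by (intro measurable_component_singleton) auto

lemma eval_config:
  assumes "t \<ge> 0" shows "(\<lambda>\<omega>. \<omega> t) \<in> path_space state_space \<rightarrow>\<^sub>M config_space"
  using measurable_compose[OF eval_state[OF assms] measurable_restrict_space1[OF measurable_ident]]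
  by (simp add: comp_def)

lemma eval_P:
  assumes "t \<ge> 0" "\<eta> \<in> E" shows "(\<lambda>\<omega>. \<omega> t) \<in> P \<eta> \<rightarrow>\<^sub>M config_space"
  using eval_config[OF assms(1)] measurable_cong_sets[OF sets_P[OF assms(2)] refl] by blast

lemma measurable_two_time_kernel:
  assumes "t \<ge> 0"
  shows "two_time_kernel t \<in> state_space \<rightarrow>\<^sub>M prob_algebra config_pairs"
  unfolding two_time_kernel_def[abs_def]
proof (rule measurable_distr_prob_space2[OF P_kernel])
  have 1: "(\<lambda>x. fst x) \<in> state_space \<Otimes>\<^sub>M path_space state_space \<rightarrow>\<^sub>M config_space"
    by (rule measurable_compose[OF measurable_fst measurable_restrict_space1[OF measurable_ident_sets[OF refl]]])
  have 2: "(\<lambda>x. snd x t) \<in> state_space \<Otimes>\<^sub>M path_space state_space \<rightarrow>\<^sub>M config_space"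
    by (rule measurable_compose[OF measurable_snd eval_config[OF assms]])
  show "(\<lambda>(\<eta>, \<omega>). (\<eta>, \<omega> t)) \<in> state_space \<Otimes>\<^sub>M path_space state_space
          \<rightarrow>\<^sub>M config_pairs"
    using measurable_Pair[OF 1 2] by (simp add: case_prod_beta')
qed

text \<open>
  Integrating over the kernel instead of over the path measure makes measurability in the starting
  point a fact about the Giry monad.
\<close>

lemma measurable_P_integral:
  assumes t: "t \<ge> 0" and F [measurable]: "F \<in> borel_measurable config_pairs"
  shows "(\<lambda>\<eta>. \<integral>\<^sup>+\<omega>. (F (\<eta>, \<omega> t) :: ennreal) \<partial>P \<eta>) \<in> borel_measurable state_space"
proof -
  have "(\<lambda>\<eta>. \<integral>\<^sup>+z. F z \<partial>two_time_kernel t \<eta>) \<in> borel_measurable state_space"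
    using measurable_compose[OF measurable_prob_algebraD[OF measurable_two_time_kernel[OF t]]
        nn_integral_measurable_subprob_algebra[OF F]] .
  also have "?this \<longleftrightarrow> ?thesis"
  proof (rule measurable_cong)
    fix \<eta> assume "\<eta> \<in> space state_space"
    then have "\<eta> \<in> E" by (simp add: space_restrict_space)
    note [measurable] = eval_P[OF t this]
    show "(\<integral>\<^sup>+z. F z \<partial>two_time_kernel t \<eta>) = (\<integral>\<^sup>+\<omega>. F (\<eta>, \<omega> t) \<partial>P \<eta>)"
      unfolding two_time_kernel_def by (subst nn_integral_distr) auto
  qed
  finally show ?thesis .
qed

lemma invariant_imp_laws: "\<mu> \<in> invariant_measures E P \<Longrightarrow> \<mu> \<in> laws_on_E"
  by (auto simp: invariant_measures_def laws_on_E_def)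

context
  fixes \<mu> :: "'g config measure"
  assumes mu: "\<mu> \<in> laws_on_E"
begin

lemma law_prob: "prob_space \<mu>"
  and law_sets [measurable_cong]: "sets \<mu> = sets config_space"
  and law_E: "AE \<eta> in \<mu>. \<eta> \<in> E"
  using mu by (auto simp: laws_on_E_def prob_measures_def)

lemma law_space: "space \<mu> = UNIV"
  using sets_eq_imp_space_eq[OF law_sets] by simp

lemma measurable_law: "measurable \<mu> N = measurable config_space N"
  by (rule measurable_cong_sets[OF law_sets refl])

lemma E_sets_law: "E \<in> sets \<mu>" using E_sets by (simp add: law_sets)

lemma sets_restrict_law: "sets (restrict_space \<mu> E) = sets state_space"
  by (rule sets_restrict_space_cong[OF law_sets])

lemma prob_restrict_law: "prob_space (restrict_space \<mu> E)"
proof (rule prob_space_restrict_space)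
  show "E \<in> sets \<mu>" by (rule E_sets_law)
  show "emeasure \<mu> E = 1"
    using prob_space.emeasure_eq_1_AE[OF law_prob E_sets_law law_E] .
qed

lemma restrict_law_in_prob_algebra: "restrict_space \<mu> E \<in> space (prob_algebra state_space)"
  using prob_restrict_law sets_restrict_law by (simp add: space_prob_algebra)

context
  fixes t :: real
  assumes t: "t \<ge> 0"
begin

lemma kernel_law: "two_time_kernel t \<in> restrict_space \<mu> E \<rightarrow>\<^sub>M prob_algebra config_pairs"
  using measurable_two_time_kernel[OF t] measurable_cong_sets[OF sets_restrict_law refl] by blast

lemma two_time_law_in_prob_algebra:
  "two_time_law \<mu> t \<in> space (prob_algebra config_pairs)"
proof -
  have "prob_space (two_time_law \<mu> t)"
    unfolding two_time_law_def
    by (rule prob_space_bind'[OF restrict_law_in_prob_algebra measurable_two_time_kernel[OF t]])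
  moreover have "sets (two_time_law \<mu> t) = sets config_pairs"
    unfolding two_time_law_def
    by (rule sets_bind'[OF restrict_law_in_prob_algebra measurable_two_time_kernel[OF t]])
  ultimately show ?thesis by (simp add: space_prob_algebra)
qed

lemma prob_space_two_time_law: "prob_space (two_time_law \<mu> t)"
  and sets_two_time_law [measurable_cong]: "sets (two_time_law \<mu> t) = sets config_pairs"
  using two_time_law_in_prob_algebra by (auto simp: space_prob_algebra)

lemma measurable_two_time_law:
  "measurable (two_time_law \<mu> t) N = measurable config_pairs N"
  by (rule measurable_cong_sets[OF sets_two_time_law refl])

lemma nn_integral_two_time_law_restrict:
  assumes [measurable]: "F \<in> borel_measurable config_pairs"
  shows "(\<integral>\<^sup>+z. F z \<partial>two_time_law \<mu> t) =
     (\<integral>\<^sup>+\<eta>. (\<integral>\<^sup>+\<omega>. F (\<eta>, \<omega> t) \<partial>P \<eta>) \<partial>restrict_space \<mu> E)"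
proof -
  have "(\<integral>\<^sup>+z. F z \<partial>two_time_law \<mu> t) = (\<integral>\<^sup>+\<eta>. (\<integral>\<^sup>+z. F z \<partial>two_time_kernel t \<eta>) \<partial>restrict_space \<mu> E)"
    unfolding two_time_law_def
    by (rule nn_integral_bind[OF assms measurable_prob_algebraD[OF kernel_law]])
  also have "\<dots> = (\<integral>\<^sup>+\<eta>. (\<integral>\<^sup>+\<omega>. F (\<eta>, \<omega> t) \<partial>P \<eta>) \<partial>restrict_space \<mu> E)"
  proof (rule nn_integral_cong)
    fix \<eta> assume "\<eta> \<in> space (restrict_space \<mu> E)"
    then have "\<eta> \<in> E" by (simp add: space_restrict_space)
    note [measurable] = eval_P[OF t this]
    show "(\<integral>\<^sup>+z. F z \<partial>two_time_kernel t \<eta>) = (\<integral>\<^sup>+\<omega>. F (\<eta>, \<omega> t) \<partial>P \<eta>)"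
      unfolding two_time_kernel_def by (subst nn_integral_distr) auto
  qed
  finally show ?thesis .
qed

lemma nn_integral_two_time_law:
  assumes [measurable]: "F \<in> borel_measurable config_pairs"
  shows "(\<integral>\<^sup>+z. F z \<partial>two_time_law \<mu> t) =
     (\<integral>\<^sup>+\<eta>\<in>E. (\<integral>\<^sup>+\<omega>. F (\<eta>, \<omega> t) \<partial>P \<eta>) \<partial>\<mu>)"
  unfolding nn_integral_two_time_law_restrict[OF assms]
  using E_sets_law by (subst nn_integral_restrict_space) auto

lemma AE_two_time_law:
  assumes [measurable]: "Measurable.pred config_pairs R"
  shows "(AE z in two_time_law \<mu> t. R z) \<longleftrightarrow> (AE \<eta> in \<mu>. \<eta> \<in> E \<longrightarrow> (AE \<omega> in P \<eta>. R (\<eta>, \<omega> t)))"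
proof -
  have "(AE z in two_time_law \<mu> t. R z) \<longleftrightarrow>
      (AE \<eta> in restrict_space \<mu> E. AE z in two_time_kernel t \<eta>. R z)"
    unfolding two_time_law_def
    by (rule AE_bind[OF measurable_prob_algebraD[OF kernel_law] assms])
  also have "\<dots> \<longleftrightarrow> (AE \<eta> in restrict_space \<mu> E. AE \<omega> in P \<eta>. R (\<eta>, \<omega> t))"
  proof (rule AE_cong)
    fix \<eta> assume "\<eta> \<in> space (restrict_space \<mu> E)"
    then have "\<eta> \<in> E" by (simp add: space_restrict_space)
    note [measurable] = eval_P[OF t this]
    show "(AE z in two_time_kernel t \<eta>. R z) \<longleftrightarrow> (AE \<omega> in P \<eta>. R (\<eta>, \<omega> t))"
      unfolding two_time_kernel_def using assms
      by (subst AE_distr_iff) (auto simp: space_pair_measure pred_def)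
  qed
  also have "\<dots> \<longleftrightarrow> (AE \<eta> in \<mu>. \<eta> \<in> E \<longrightarrow> (AE \<omega> in P \<eta>. R (\<eta>, \<omega> t)))"
    using E_sets_law by (subst AE_restrict_space_iff) auto
  finally show ?thesis .
qed

lemma distr_fst_two_time_law: "distr (two_time_law \<mu> t) config_space fst = \<mu>"
proof (rule measure_eqI)
  fix A assume "A \<in> sets (distr (two_time_law \<mu> t) config_space fst)"
  then have A [measurable]: "A \<in> sets config_space" by simp
  have "emeasure (distr (two_time_law \<mu> t) config_space fst) A
      = (\<integral>\<^sup>+z. indicator A (fst z) \<partial>two_time_law \<mu> t)"
    by (subst nn_integral_distr[symmetric, of fst _ config_space]) auto
  also have "\<dots> = (\<integral>\<^sup>+\<eta>\<in>E. (\<integral>\<^sup>+\<omega>. indicator A \<eta> \<partial>P \<eta>) \<partial>\<mu>)"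
    by (subst nn_integral_two_time_law) auto
  also have "\<dots> = (\<integral>\<^sup>+\<eta>. indicator A \<eta> \<partial>\<mu>)"
  proof (rule nn_integral_cong_AE)
    show "AE \<eta> in \<mu>. (\<integral>\<^sup>+\<omega>. indicator A \<eta> \<partial>P \<eta>) * indicator E \<eta> = (indicator A \<eta> :: ennreal)"
      using law_E
      by eventually_elim (simp add: prob_space.emeasure_space_1[OF prob_space_P])
  qed
  also have "\<dots> = emeasure \<mu> A" using A by (simp add: law_sets)
  finally show "emeasure (distr (two_time_law \<mu> t) config_space fst) A = emeasure \<mu> A" .
qed (simp add: law_sets)

text \<open>
  The set integrals in the definition of invariance are integrals against the second marginal of the
  two-time law.
\<close>

lemma LINT_semigroup_bounded:
  assumes [measurable]: "f \<in> borel_measurable config_space" and bdd: "bounded (range f)"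
  shows "(LINT \<eta>:E|\<mu>. transition_semigroup P t f \<eta>) = (\<integral>z. f (snd z) \<partial>two_time_law \<mu> t)"
proof -
  interpret mE: prob_space "restrict_space \<mu> E" by (rule prob_restrict_law)
  obtain B where B: "\<And>x. \<bar>f x\<bar> \<le> B" using bdd by (auto simp: bounded_iff)
  have "(\<integral>z. f (snd z) \<partial>two_time_law \<mu> t) =
     (\<integral>\<eta>. (\<integral>z. f (snd z) \<partial>two_time_kernel t \<eta>) \<partial>restrict_space \<mu> E)"
    unfolding two_time_law_def
  proof (rule integral_bind[where K=config_pairs and B'=1])
    show "two_time_kernel t \<in> restrict_space \<mu> E \<rightarrow>\<^sub>M subprob_algebra config_pairs"
      by (rule measurable_prob_algebraD[OF kernel_law])
    show "\<bar>f (snd x)\<bar> \<le> B" for x :: "'g config \<times> 'g config" using B by simp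
    show "AE x in restrict_space \<mu> E. emeasure (two_time_kernel t x) (space (two_time_kernel t x)) \<le> ennreal 1"
    proof (rule AE_I2)
      fix x assume "x \<in> space (restrict_space \<mu> E)"
      from measurable_space[OF kernel_law this]
      show "emeasure (two_time_kernel t x) (space (two_time_kernel t x)) \<le> ennreal 1"
        by (simp add: space_prob_algebra prob_space.emeasure_space_1)
    qed
    show "finite_measure (restrict_space \<mu> E)" by (rule mE.finite_measure_axioms)
  qed (measurable)
  also have "\<dots> = (\<integral>\<eta>. transition_semigroup P t f \<eta> \<partial>restrict_space \<mu> E)"
  proof (rule Bochner_Integration.integral_cong[OF refl])
    fix \<eta> assume "\<eta> \<in> space (restrict_space \<mu> E)"
    then have "\<eta> \<in> E" by (simp add: space_restrict_space)
    note [measurable] = eval_P[OF t this]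
    show "(\<integral>z. f (snd z) \<partial>two_time_kernel t \<eta>) = transition_semigroup P t f \<eta>"
      unfolding two_time_kernel_def transition_semigroup_def by (subst integral_distr) auto
  qed
  also have "\<dots> = (LINT \<eta>:E|\<mu>. transition_semigroup P t f \<eta>)"
    using E_sets_law by (subst integral_restrict_space) (auto simp: set_lebesgue_integral_def)
  finally show ?thesis ..
qed

end

end

text \<open>
  Indicators are bounded test functions, and they already determine the second marginal.
\<close>

theorem invariant_iff_two_time_law:
  assumes mu: "\<mu> \<in> laws_on_E"
  shows "\<mu> \<in> invariant_measures E P \<longleftrightarrow>
           (\<forall>t\<ge>0. distr (two_time_law \<mu> t) config_space snd = \<mu>)"
proof -
  note [measurable_cong] = law_sets[OF mu]
  interpret prob_space \<mu> by (rule law_prob[OF mu])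
  have eq: "(LINT \<eta>:E|\<mu>. transition_semigroup P t f \<eta>) = (\<integral>\<eta>. f \<eta> \<partial>distr (two_time_law \<mu> t) config_space snd)"
    if "t \<ge> 0" and [measurable]: "f \<in> borel_measurable config_space" and "bounded (range f)" for t f
    using LINT_semigroup_bounded[OF mu that]
    by (subst integral_distr) (auto simp: measurable_two_time_law[OF mu that(1)])
  show ?thesis
  proof
    assume inv: "\<mu> \<in> invariant_measures E P"
    show "\<forall>t\<ge>0. distr (two_time_law \<mu> t) config_space snd = \<mu>"
    proof (intro allI impI measure_eqI)
      fix t :: real and A assume t: "t \<ge> 0" and "A \<in> sets (distr (two_time_law \<mu> t) config_space snd)"
      then have A [measurable]: "A \<in> sets config_space" by simp
      note [measurable_cong] = sets_two_time_law[OF mu t]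
      interpret W: prob_space "distr (two_time_law \<mu> t) config_space snd"
        by (rule prob_space.prob_space_distr[OF prob_space_two_time_law[OF mu t]])
          (simp add: measurable_two_time_law[OF mu t])
      have bdd: "bounded (range (indicator A :: _ \<Rightarrow> real))"
        by (rule boundedI[of _ 1]) (auto simp: indicator_def)
      have "W.prob A = (\<integral>\<eta>. indicator A \<eta> \<partial>distr (two_time_law \<mu> t) config_space snd)" by simp
      also have "\<dots> = (LINT \<eta>:E|\<mu>. transition_semigroup P t (indicator A) \<eta>)"
        using eq[OF t _ bdd] by simp
      also have "\<dots> = (\<integral>\<eta>. indicator A \<eta> \<partial>\<mu>)"
        using inv t bdd unfolding invariant_measures_def by auto
      also have "\<dots> = prob A" by (simp add: law_sets[OF mu])
      finally show "emeasure (distr (two_time_law \<mu> t) config_space snd) A = emeasure \<mu> A"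
        by (simp add: W.emeasure_eq_measure emeasure_eq_measure)
    qed (simp add: law_sets[OF mu])
  next
    assume *: "\<forall>t\<ge>0. distr (two_time_law \<mu> t) config_space snd = \<mu>"
    show "\<mu> \<in> invariant_measures E P"
      unfolding invariant_measures_def using mu eq * by (auto simp: laws_on_E_def)
  qed
qed


context
  fixes \<mu> :: "'g config measure" and t :: real
  assumes inv: "\<mu> \<in> invariant_measures E P" and t: "t \<ge> 0"
begin

lemmas mu_law = invariant_imp_laws[OF inv]
lemmas measurable_inv = measurable_law[OF mu_law] measurable_two_time_law[OF mu_law t]

lemma distr_snd_two_time_law: "distr (two_time_law \<mu> t) config_space snd = \<mu>"
  using invariant_iff_two_time_law[OF mu_law] inv t by blast

lemma nn_integral_snd:
  assumes [measurable]: "f \<in> borel_measurable config_space"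
  shows "(\<integral>\<^sup>+z. f (snd z) \<partial>two_time_law \<mu> t) = (\<integral>\<^sup>+\<eta>. f \<eta> \<partial>\<mu>)"
  by (subst (2) distr_snd_two_time_law[symmetric], subst nn_integral_distr) (auto simp: measurable_inv)

lemma integrable_fst:
  fixes f :: "'g config \<Rightarrow> real"
  assumes "integrable \<mu> f" shows "integrable (two_time_law \<mu> t) (\<lambda>z. f (fst z))"
  using assms by (subst (asm) distr_fst_two_time_law[OF mu_law t, symmetric])
    (rule integrable_distr[of fst _ config_space f], auto simp: measurable_inv)

lemma integrable_snd:
  fixes f :: "'g config \<Rightarrow> real"
  assumes "integrable \<mu> f" shows "integrable (two_time_law \<mu> t) (\<lambda>z. f (snd z))"
  using assms by (subst (asm) distr_snd_two_time_law[symmetric])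
    (rule integrable_distr[of snd _ config_space f], auto simp: measurable_inv)

lemma integral_fst:
  fixes f :: "'g config \<Rightarrow> real"
  assumes [measurable]: "f \<in> borel_measurable config_space"
  shows "(\<integral>z. f (fst z) \<partial>two_time_law \<mu> t) = (\<integral>\<eta>. f \<eta> \<partial>\<mu>)"
  by (subst (2) distr_fst_two_time_law[OF mu_law t, symmetric], subst integral_distr) (auto simp: measurable_inv)

lemma integral_snd:
  fixes f :: "'g config \<Rightarrow> real"
  assumes [measurable]: "f \<in> borel_measurable config_space"
  shows "(\<integral>z. f (snd z) \<partial>two_time_law \<mu> t) = (\<integral>\<eta>. f \<eta> \<partial>\<mu>)"
  by (subst (2) distr_snd_two_time_law[symmetric], subst integral_distr) (auto simp: measurable_inv)

lemma AE_fst: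
  assumes "AE \<eta> in \<mu>. R \<eta>" shows "AE z in two_time_law \<mu> t. R (fst z)"
  using assms by (subst (asm) distr_fst_two_time_law[OF mu_law t, symmetric])
    (rule AE_distrD[of fst _ config_space], auto simp: measurable_inv)

lemma AE_snd:
  assumes "AE \<eta> in \<mu>. R \<eta>" shows "AE z in two_time_law \<mu> t. R (snd z)"
  using assms by (subst (asm) distr_snd_two_time_law[symmetric])
    (rule AE_distrD[of snd _ config_space], auto simp: measurable_inv)

text \<open>
  If \<open>S(t)f = f\<close>, then \<open>f \<eta>\<close> is the mean of \<open>f (\<omega> t)\<close> under \<open>P \<eta>\<close>, so that the second moment of
  \<open>f (\<omega> t)\<close> is its variance plus \<open>(f \<eta>)\<^sup>2\<close>. After integration over \<open>\<mu>\<close>, invariance makes both second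
  moments equal, hence the variance vanishes for almost every \<open>\<eta>\<close>.
\<close>

lemma semigroup_fixes_iff:
  assumes f: "f \<in> L2 \<mu>"
  shows "(AE \<eta> in \<mu>. transition_semigroup P t f \<eta> = f \<eta>) \<longleftrightarrow>
         (AE z in two_time_law \<mu> t. f (snd z) = f (fst z))"
proof -
  let ?W = "two_time_law \<mu>"
  have [measurable]: "f \<in> borel_measurable config_space"
    and sq: "integrable \<mu> (\<lambda>\<eta>. (f \<eta>)\<^sup>2)"
    using f by (auto simp: L2_def measurable_inv)
  have sq_finite: "(\<integral>\<^sup>+\<eta>. ennreal ((f \<eta>)\<^sup>2) \<partial>\<mu>) < \<infinity>"
    using sq by (simp add: integrable_iff_bounded)
  let ?R = "restrict_space \<mu> E"
  note sR = sets_restrict_law[OF mu_law]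
  have AE_R: "(AE \<eta> in \<mu>. R \<eta>) \<longleftrightarrow> (AE \<eta> in ?R. R \<eta>)" for R
  proof -
    have "(AE \<eta> in ?R. R \<eta>) \<longleftrightarrow> (AE \<eta> in \<mu>. \<eta> \<in> E \<longrightarrow> R \<eta>)"
      using E_sets_law[OF mu_law] by (subst AE_restrict_space_iff) auto
    also have "\<dots> \<longleftrightarrow> (AE \<eta> in \<mu>. R \<eta>)" using law_E[OF mu_law] by auto
    finally show ?thesis ..
  qed
  have AE_W: "(AE z in ?W t. f (snd z) = f (fst z)) \<longleftrightarrow>
      (AE \<eta> in \<mu>. \<eta> \<in> E \<longrightarrow> (AE \<omega> in P \<eta>. f (\<omega> t) = f \<eta>))"
    by (subst AE_two_time_law[OF mu_law t]) auto
  show ?thesis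
  proof
    assume "AE z in ?W t. f (snd z) = f (fst z)"
    then have "AE \<eta> in \<mu>. \<eta> \<in> E \<longrightarrow> (AE \<omega> in P \<eta>. f (\<omega> t) = f \<eta>)" by (simp add: AE_W)
    with law_E[OF mu_law] show "AE \<eta> in \<mu>. transition_semigroup P t f \<eta> = f \<eta>"
    proof eventually_elim
      fix \<eta> assume E: "\<eta> \<in> E" and "\<eta> \<in> E \<longrightarrow> (AE \<omega> in P \<eta>. f (\<omega> t) = f \<eta>)"
      then have AE: "AE \<omega> in P \<eta>. f (\<omega> t) = f \<eta>" by simp
      interpret prob_space "P \<eta>" by (rule prob_space_P[OF E])
      note [measurable] = eval_P[OF t E]
      have "(\<integral>\<omega>. f (\<omega> t) \<partial>P \<eta>) = (\<integral>\<omega>. f \<eta> \<partial>P \<eta>)"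
        using AE by (intro integral_cong_AE) auto
      then show "transition_semigroup P t f \<eta> = f \<eta>"
        by (simp add: transition_semigroup_def prob_space)
    qed
  next
    assume fx: "AE \<eta> in \<mu>. transition_semigroup P t f \<eta> = f \<eta>"
    define V where "V \<eta> = (\<integral>\<^sup>+\<omega>. ennreal ((f (\<omega> t) - f \<eta>)\<^sup>2) \<partial>P \<eta>)" for \<eta>
    define S2 where "S2 \<eta> = (\<integral>\<^sup>+\<omega>. ennreal ((f (\<omega> t))\<^sup>2) \<partial>P \<eta>)" for \<eta>
    have int_S2: "(\<integral>\<^sup>+\<eta>. S2 \<eta> \<partial>?R) = (\<integral>\<^sup>+\<eta>. ennreal ((f \<eta>)\<^sup>2) \<partial>\<mu>)"
      unfolding S2_def
      using nn_integral_two_time_law_restrict[OF mu_law t, of "\<lambda>z. ennreal ((f (snd z))\<^sup>2)"]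
        nn_integral_snd[of "\<lambda>\<eta>. ennreal ((f \<eta>)\<^sup>2)"] by simp
    note meas = measurable_P_integral[OF t, folded measurable_cong_sets[OF sR refl]]
    have [measurable]: "S2 \<in> borel_measurable ?R"
      unfolding S2_def using meas[of "\<lambda>z. ennreal ((f (snd z))\<^sup>2)"] by simp
    have [measurable]: "V \<in> borel_measurable ?R"
      unfolding V_def using meas[of "\<lambda>z. ennreal ((f (snd z) - f (fst z))\<^sup>2)"] by simp
    have [measurable]: "f \<in> borel_measurable ?R"
      by (rule measurable_restrict_space1) (simp add: measurable_inv)
    have "AE \<eta> in ?R. S2 \<eta> \<noteq> \<infinity>"
      by (rule nn_integral_PInf_AE) (use int_S2 sq_finite in auto)
    moreover have "AE \<eta> in ?R. transition_semigroup P t f \<eta> = f \<eta>"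
      using fx AE_R by simp
    moreover have "AE \<eta> in ?R. \<eta> \<in> E" by (rule AE_I2) (simp add: space_restrict_space)
    ultimately have split: "AE \<eta> in ?R. S2 \<eta> = V \<eta> + ennreal ((f \<eta>)\<^sup>2)"
    proof eventually_elim
      fix \<eta> assume fin: "S2 \<eta> \<noteq> \<infinity>" and fx: "transition_semigroup P t f \<eta> = f \<eta>" and E: "\<eta> \<in> E"
      interpret prob_space "P \<eta>" by (rule prob_space_P[OF E])
      note [measurable] = eval_P[OF t E]
      have i2: "integrable (P \<eta>) (\<lambda>\<omega>. (f (\<omega> t))\<^sup>2)"
        using fin by (auto simp: integrable_iff_bounded S2_def top.not_eq_extremum)
      have i1: "integrable (P \<eta>) (\<lambda>\<omega>. f (\<omega> t))"
        by (rule square_integrable_imp_integrable[OF _ i2]) measurable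
      have mean: "(\<integral>\<omega>. f (\<omega> t) \<partial>P \<eta>) = f \<eta>" using fx by (simp add: transition_semigroup_def)
      have eq: "(f (\<omega> t) - f \<eta>)\<^sup>2 = (f (\<omega> t))\<^sup>2 - 2 * f \<eta> * f (\<omega> t) + (f \<eta>)\<^sup>2" for \<omega>
        by (simp add: power2_diff)
      have iV: "integrable (P \<eta>) (\<lambda>\<omega>. (f (\<omega> t) - f \<eta>)\<^sup>2)"
        unfolding eq using i1 i2 by auto
      have "(\<integral>\<omega>. (f (\<omega> t) - f \<eta>)\<^sup>2 \<partial>P \<eta>) = (\<integral>\<omega>. (f (\<omega> t))\<^sup>2 \<partial>P \<eta>) - (f \<eta>)\<^sup>2"
        unfolding eq using i1 i2 mean by (simp add: prob_space power2_eq_square)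
      then have *: "(\<integral>\<omega>. (f (\<omega> t))\<^sup>2 \<partial>P \<eta>) = (\<integral>\<omega>. (f (\<omega> t) - f \<eta>)\<^sup>2 \<partial>P \<eta>) + (f \<eta>)\<^sup>2" by simp
      show "S2 \<eta> = V \<eta> + ennreal ((f \<eta>)\<^sup>2)"
        unfolding S2_def V_def using i2 iV
        by (simp add: nn_integral_eq_integral * ennreal_plus)
    qed
    have "(\<integral>\<^sup>+\<eta>. S2 \<eta> \<partial>?R) = (\<integral>\<^sup>+\<eta>. V \<eta> + ennreal ((f \<eta>)\<^sup>2) \<partial>?R)"
      by (rule nn_integral_cong_AE[OF split])
    also have "\<dots> = (\<integral>\<^sup>+\<eta>. V \<eta> \<partial>?R) + (\<integral>\<^sup>+\<eta>. ennreal ((f \<eta>)\<^sup>2) \<partial>?R)"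
      by (rule nn_integral_add) auto
    also have "(\<integral>\<^sup>+\<eta>. ennreal ((f \<eta>)\<^sup>2) \<partial>?R) = (\<integral>\<^sup>+\<eta>. ennreal ((f \<eta>)\<^sup>2) \<partial>\<mu>)"
      using E_sets_law[OF mu_law] law_E[OF mu_law]
      by (subst nn_integral_restrict_space) (auto intro!: nn_integral_cong_AE)
    finally have "(\<integral>\<^sup>+\<eta>. V \<eta> \<partial>?R) = 0"
      using int_S2 sq_finite by (auto simp: ennreal_add_left_cancel_le simp flip: ennreal_add_left_cancel)
    then have "AE \<eta> in ?R. V \<eta> = 0" by (subst (asm) nn_integral_0_iff_AE) auto
    then have "AE \<eta> in \<mu>. V \<eta> = 0" by (simp add: AE_R)
    then have "AE \<eta> in \<mu>. \<eta> \<in> E \<longrightarrow> (AE \<omega> in P \<eta>. f (\<omega> t) = f \<eta>)"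
    proof eventually_elim
      fix \<eta> assume V: "V \<eta> = 0"
      show "\<eta> \<in> E \<longrightarrow> (AE \<omega> in P \<eta>. f (\<omega> t) = f \<eta>)"
      proof
        assume E: "\<eta> \<in> E"
        note [measurable] = eval_P[OF t E]
        show "AE \<omega> in P \<eta>. f (\<omega> t) = f \<eta>"
          using V unfolding V_def by (subst (asm) nn_integral_0_iff_AE) (auto simp: ennreal_eq_0_iff)
      qed
    qed
    then show "AE z in ?W t. f (snd z) = f (fst z)" by (simp add: AE_W)
  qed
qed

end

corollary ergodic_iff_two_time:
  "\<mu> \<in> ergodic_measures E P \<longleftrightarrow> \<mu> \<in> invariant_measures E P \<and>
     (\<forall>f\<in>L2 \<mu>. (\<forall>t\<ge>0. AE z in two_time_law \<mu> t. f (snd z) = f (fst z)) \<longrightarrow>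
        (AE \<eta> in \<mu>. f \<eta> = (\<integral>\<eta>'. f \<eta>' \<partial>\<mu>)))"
  unfolding ergodic_measures_def by (auto simp: semigroup_fixes_iff)

lemma nn_integral_two_time_law_density:
  assumes mu: "\<mu> \<in> laws_on_E" and nu: "density \<mu> c \<in> laws_on_E" and t: "t \<ge> 0"
    and c [measurable]: "c \<in> borel_measurable config_space"
    and F [measurable]: "F \<in> borel_measurable config_pairs"
  shows "(\<integral>\<^sup>+z. F z \<partial>two_time_law (density \<mu> c) t) = (\<integral>\<^sup>+z. c (fst z) * F z \<partial>two_time_law \<mu> t)"
proof -
  note [measurable_cong] = law_sets[OF mu]
  let ?G = "\<lambda>\<eta>. \<integral>\<^sup>+\<omega>. F (\<eta>, \<omega> t) \<partial>P \<eta>"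
  have G: "(\<lambda>\<eta>. ?G \<eta> * indicator E \<eta>) \<in> borel_measurable config_space"
    using measurable_P_integral[OF t F] E_sets
    by (subst (asm) borel_measurable_restrict_space_iff_ennreal) (auto simp: measurable_law[OF mu])
  have "(\<integral>\<^sup>+z. F z \<partial>two_time_law (density \<mu> c) t) = (\<integral>\<^sup>+\<eta>\<in>E. ?G \<eta> \<partial>density \<mu> c)"
    by (rule nn_integral_two_time_law[OF nu t F])
  also have "\<dots> = (\<integral>\<^sup>+\<eta>. c \<eta> * (?G \<eta> * indicator E \<eta>) \<partial>\<mu>)"
    using G by (intro nn_integral_density) (auto simp: measurable_law[OF mu])
  also have "\<dots> = (\<integral>\<^sup>+\<eta>\<in>E. (\<integral>\<^sup>+\<omega>. c \<eta> * F (\<eta>, \<omega> t) \<partial>P \<eta>) \<partial>\<mu>)"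
  proof (rule nn_integral_cong)
    fix \<eta>
    show "c \<eta> * (?G \<eta> * indicator E \<eta>) = (\<integral>\<^sup>+\<omega>. c \<eta> * F (\<eta>, \<omega> t) \<partial>P \<eta>) * indicator E \<eta>"
    proof (cases "\<eta> \<in> E")
      case True
      note [measurable] = eval_P[OF t True]
      show ?thesis by (subst nn_integral_cmult) (auto simp: mult_ac)
    qed simp
  qed
  also have "\<dots> = (\<integral>\<^sup>+z. c (fst z) * F z \<partial>two_time_law \<mu> t)"
    by (subst nn_integral_two_time_law[OF mu t]) auto
  finally show ?thesis .
qed

lemma density_in_laws_on_E:
  assumes mu: "\<mu> \<in> laws_on_E" and c: "c \<in> borel_measurable config_space"
    and "prob_space (density \<mu> c)"
  shows "density \<mu> c \<in> laws_on_E"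
proof -
  note [measurable_cong] = law_sets[OF mu]
  have "AE \<eta> in density \<mu> c. \<eta> \<in> E"
    using c law_E[OF mu] by (subst AE_density) (auto simp: measurable_law[OF mu])
  then show ?thesis
    using assms by (auto simp: laws_on_E_def prob_measures_def)
qed

text \<open>
  A density that the dynamics fixes can be moved from time \<open>0\<close> to time \<open>t\<close>, where the second marginal of the two-time law
  turns it into the density with respect to \<open>\<mu>\<close> again.
\<close>

lemma invariant_densityI:
  assumes inv: "\<mu> \<in> invariant_measures E P"
    and c [measurable]: "c \<in> borel_measurable config_space"
    and prob: "prob_space (density \<mu> c)"
    and AE: "\<And>t. t \<ge> 0 \<Longrightarrow> AE z in two_time_law \<mu> t. c (snd z) = c (fst z)"
  shows "density \<mu> c \<in> invariant_measures E P"
proof -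
  note mu = invariant_imp_laws[OF inv]
  note nu = density_in_laws_on_E[OF mu c prob]
  note [measurable_cong] = law_sets[OF mu]
  show ?thesis
    unfolding invariant_iff_two_time_law[OF nu]
  proof (intro allI impI measure_eqI)
    fix t :: real and A assume t: "t \<ge> 0"
      and "A \<in> sets (distr (two_time_law (density \<mu> c) t) config_space snd)"
    then have A [measurable]: "A \<in> sets config_space" by simp
    note [measurable_cong] = sets_two_time_law[OF mu t] sets_two_time_law[OF nu t]
    have "emeasure (distr (two_time_law (density \<mu> c) t) config_space snd) A
       = (\<integral>\<^sup>+z. indicator A (snd z) \<partial>two_time_law (density \<mu> c) t)"
      by (subst nn_integral_distr[symmetric, of snd _ config_space])
        (auto simp: measurable_two_time_law[OF nu t])
    also have "\<dots> = (\<integral>\<^sup>+z. c (fst z) * indicator A (snd z) \<partial>two_time_law \<mu> t)"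
      by (rule nn_integral_two_time_law_density[OF mu nu t c]) auto
    also have "\<dots> = (\<integral>\<^sup>+z. c (snd z) * indicator A (snd z) \<partial>two_time_law \<mu> t)"
      using AE[OF t] by (intro nn_integral_cong_AE) auto
    also have "\<dots> = (\<integral>\<^sup>+\<eta>. c \<eta> * indicator A \<eta> \<partial>\<mu>)"
      by (rule nn_integral_snd[OF inv t]) auto
    also have "\<dots> = emeasure (density \<mu> c) A"
      by (subst emeasure_density) (auto simp: law_sets[OF mu] cong: measurable_cong_sets)
    finally show "emeasure (distr (two_time_law (density \<mu> c) t) config_space snd) A
      = emeasure (density \<mu> c) A" .
  qed (simp add: law_sets[OF mu])
qed

end

section \<open>Square-integrable functions and mixtures\<close>

lemma integrable_mult_L2:
  assumes "f \<in> L2 M" "g \<in> L2 M"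
  shows "integrable M (\<lambda>x. f x * g x)"
proof (rule Bochner_Integration.integrable_bound)
  show "integrable M (\<lambda>x. (f x)\<^sup>2 + (g x)\<^sup>2)" using assms by (simp add: L2_def)
  show "(\<lambda>x. f x * g x) \<in> borel_measurable M" using assms by (auto simp: L2_def)
  show "AE x in M. norm (f x * g x) \<le> norm ((f x)\<^sup>2 + (g x)\<^sup>2)"
  proof (rule AE_I2)
    fix x
    have "2 * \<bar>f x * g x\<bar> \<le> (f x)\<^sup>2 + (g x)\<^sup>2"
      using sum_squares_bound[of "\<bar>f x\<bar>" "\<bar>g x\<bar>"] by (simp add: abs_mult)
    then show "norm (f x * g x) \<le> norm ((f x)\<^sup>2 + (g x)\<^sup>2)" by simp
  qed
qed

lemma L2_add: "f \<in> L2 M \<Longrightarrow> g \<in> L2 M \<Longrightarrow> (\<lambda>x. f x + g x) \<in> L2 M"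
  using integrable_mult_L2[of f M g] unfolding L2_def by (auto simp: power2_sum mult.assoc)

lemma L2_zero: "(\<lambda>x. 0) \<in> L2 M"
  by (simp add: L2_def)

lemma L2_cmult: "f \<in> L2 M \<Longrightarrow> (\<lambda>x. c * f x) \<in> L2 M"
  unfolding L2_def by (auto simp: power_mult_distrib)

lemma L2_diff: "f \<in> L2 M \<Longrightarrow> g \<in> L2 M \<Longrightarrow> (\<lambda>x. f x - g x) \<in> L2 M"
  using L2_add[of f M "\<lambda>x. -1 * g x"] L2_cmult[of g M "-1"] by simp

lemma L2_sum: "(\<And>i. i \<in> I \<Longrightarrow> f i \<in> L2 M) \<Longrightarrow> (\<lambda>x. \<Sum>i\<in>I. f i x) \<in> L2 M"
  by (induction I rule: infinite_finite_induct) (auto intro: L2_add L2_zero)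

lemma (in prob_space) L2_const: "(\<lambda>x. c) \<in> L2 M"
  by (simp add: L2_def)

lemma (in prob_space) L2_integrable: "f \<in> L2 M \<Longrightarrow> integrable M f"
  unfolding L2_def by (auto intro: square_integrable_imp_integrable)

text \<open>
  As the law of a random choice by a biased coin, a convex combination is a monadic bind, which comes
  with its integrals and with measurability.
\<close>

definition mixture :: "real \<Rightarrow> 'a measure \<Rightarrow> 'a measure \<Rightarrow> 'a measure" where
  "mixture a \<mu> \<nu> = measure_pmf (bernoulli_pmf a) \<bind> (\<lambda>b. if b then \<mu> else \<nu>)"

context
  fixes \<mu> \<nu> :: "'g config measure" and a :: real
  assumes mu: "\<mu> \<in> prob_measures" and nu: "\<nu> \<in> prob_measures" and a: "0 < a" "a < 1"
begin

lemma mixture_kernel: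
  "(\<lambda>b. if b then \<mu> else \<nu>) \<in> measure_pmf (bernoulli_pmf a) \<rightarrow>\<^sub>M prob_algebra config_space"
  using mu nu by (auto simp: space_prob_algebra prob_measures_def)

lemma mixture_in_prob_measures: "mixture a \<mu> \<nu> \<in> prob_measures"
proof -
  have *: "measure_pmf (bernoulli_pmf a) \<in> space (prob_algebra (measure_pmf (bernoulli_pmf a)))"
    by (simp add: space_prob_algebra measure_pmf.prob_space_axioms)
  show ?thesis
    using prob_space_bind'[OF * mixture_kernel] sets_bind'[OF * mixture_kernel]
    by (simp add: prob_measures_def mixture_def)
qed

lemma nn_integral_mixture:
  assumes "f \<in> borel_measurable config_space"
  shows "(\<integral>\<^sup>+\<eta>. f \<eta> \<partial>mixture a \<mu> \<nu>) =
           ennreal a * (\<integral>\<^sup>+\<eta>. f \<eta> \<partial>\<mu>) + ennreal (1 - a) * (\<integral>\<^sup>+\<eta>. f \<eta> \<partial>\<nu>)"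
  unfolding mixture_def
  using a by (subst nn_integral_bind[OF assms measurable_prob_algebraD[OF mixture_kernel]])
    (simp add: mult.commute)

lemma emeasure_mixture:
  assumes "A \<in> sets config_space"
  shows "emeasure (mixture a \<mu> \<nu>) A = ennreal a * emeasure \<mu> A + ennreal (1 - a) * emeasure \<nu> A"
  using nn_integral_mixture[of "indicator A"] assms mixture_in_prob_measures mu nu
  by (simp add: prob_measures_def)

lemma measure_mixture:
  assumes "A \<in> sets config_space"
  shows "measure (mixture a \<mu> \<nu>) A = a * measure \<mu> A + (1 - a) * measure \<nu> A"
proof -
  interpret m: prob_space \<mu> using mu by (simp add: prob_measures_def)
  interpret n: prob_space \<nu> using nu by (simp add: prob_measures_def)
  interpret x: prob_space "mixture a \<mu> \<nu>" using mixture_in_prob_measures by (simp add: prob_measures_def)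
  show ?thesis
    using emeasure_mixture[OF assms] a
    by (simp add: m.emeasure_eq_measure n.emeasure_eq_measure x.emeasure_eq_measure
        flip: ennreal_mult'' ennreal_plus)
qed

lemma eq_mixtureI:
  assumes "\<kappa> \<in> prob_measures"
    and "\<And>A. A \<in> sets \<kappa> \<Longrightarrow> measure \<kappa> A = a * measure \<mu> A + (1 - a) * measure \<nu> A"
  shows "\<kappa> = mixture a \<mu> \<nu>"
proof (rule measure_eqI)
  show s: "sets \<kappa> = sets (mixture a \<mu> \<nu>)"
    using assms(1) mixture_in_prob_measures by (simp add: prob_measures_def)
  interpret k: prob_space \<kappa> using assms(1) by (simp add: prob_measures_def)
  interpret x: prob_space "mixture a \<mu> \<nu>" using mixture_in_prob_measures by (simp add: prob_measures_def)
  show "emeasure \<kappa> A = emeasure (mixture a \<mu> \<nu>) A" if "A \<in> sets \<kappa>" for A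
    using assms(2)[OF that] measure_mixture[of A] that assms(1)
    by (simp add: k.emeasure_eq_measure x.emeasure_eq_measure prob_measures_def)
qed

end

lemma mixture_commute:
  assumes "\<mu> \<in> prob_measures" "\<nu> \<in> prob_measures" "0 < a" "a < 1"
  shows "mixture a \<mu> \<nu> = mixture (1 - a) \<nu> \<mu>"
proof (rule eq_mixtureI)
  show prob: "mixture a \<mu> \<nu> \<in> prob_measures" by (rule mixture_in_prob_measures[OF assms])
  fix A assume "A \<in> sets (mixture a \<mu> \<nu>)"
  then have "A \<in> sets config_space" using prob by (simp add: prob_measures_def)
  then show "measure (mixture a \<mu> \<nu>) A = (1 - a) * measure \<nu> A + (1 - (1 - a)) * measure \<mu> A"
    using measure_mixture[OF assms] by simp
qed (use assms in auto)

text \<open>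
  Over probability measures on configurations, being an extreme point is a statement about equality
  of measures rather than about their values on sets.
\<close>

lemma extreme_iff_mixture:
  assumes "\<M> \<subseteq> prob_measures"
  shows "\<mu> \<in> extreme_measures \<M> \<longleftrightarrow> \<mu> \<in> \<M> \<and>
    (\<forall>\<mu>\<^sub>1\<in>\<M>. \<forall>\<mu>\<^sub>2\<in>\<M>. \<forall>a. 0 < a \<longrightarrow> a < 1 \<longrightarrow> \<mu> = mixture a \<mu>\<^sub>1 \<mu>\<^sub>2 \<longrightarrow> \<mu>\<^sub>1 = \<mu>\<^sub>2)"
proof -
  have *: "(\<forall>A\<in>sets \<mu>. measure \<mu> A = a * measure \<mu>\<^sub>1 A + (1 - a) * measure \<mu>\<^sub>2 A) \<longleftrightarrow> \<mu> = mixture a \<mu>\<^sub>1 \<mu>\<^sub>2"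
    if "\<mu> \<in> \<M>" "\<mu>\<^sub>1 \<in> \<M>" "\<mu>\<^sub>2 \<in> \<M>" "0 < a" "a < 1" for \<mu>\<^sub>1 \<mu>\<^sub>2 a
  proof
    assume "\<forall>A\<in>sets \<mu>. measure \<mu> A = a * measure \<mu>\<^sub>1 A + (1 - a) * measure \<mu>\<^sub>2 A"
    with that assms show "\<mu> = mixture a \<mu>\<^sub>1 \<mu>\<^sub>2" by (intro eq_mixtureI) auto
  next
    assume "\<mu> = mixture a \<mu>\<^sub>1 \<mu>\<^sub>2"
    moreover have "sets \<mu> = sets config_space" "\<mu>\<^sub>1 \<in> prob_measures" "\<mu>\<^sub>2 \<in> prob_measures"
      using that assms by (auto simp: prob_measures_def)
    ultimately show "\<forall>A\<in>sets \<mu>. measure \<mu> A = a * measure \<mu>\<^sub>1 A + (1 - a) * measure \<mu>\<^sub>2 A"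
      using measure_mixture[of \<mu>\<^sub>1 \<mu>\<^sub>2 a] that(4,5) by blast
  qed
  show ?thesis
  proof (cases "\<mu> \<in> \<M>")
    case True
    have "(\<exists>\<mu>\<^sub>1\<in>\<M>. \<exists>\<mu>\<^sub>2\<in>\<M>. \<exists>a. 0 < a \<and> a < 1 \<and> \<mu>\<^sub>1 \<noteq> \<mu>\<^sub>2 \<and>
            (\<forall>A\<in>sets \<mu>. measure \<mu> A = a * measure \<mu>\<^sub>1 A + (1 - a) * measure \<mu>\<^sub>2 A)) \<longleftrightarrow>
          (\<exists>\<mu>\<^sub>1\<in>\<M>. \<exists>\<mu>\<^sub>2\<in>\<M>. \<exists>a. 0 < a \<and> a < 1 \<and> \<mu>\<^sub>1 \<noteq> \<mu>\<^sub>2 \<and> \<mu> = mixture a \<mu>\<^sub>1 \<mu>\<^sub>2)"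
      by (intro bex_cong ex_cong1 conj_cong refl *[OF True])
    then have "\<mu> \<in> extreme_measures \<M> \<longleftrightarrow>
        \<not> (\<exists>\<mu>\<^sub>1\<in>\<M>. \<exists>\<mu>\<^sub>2\<in>\<M>. \<exists>a. 0 < a \<and> a < 1 \<and> \<mu>\<^sub>1 \<noteq> \<mu>\<^sub>2 \<and> \<mu> = mixture a \<mu>\<^sub>1 \<mu>\<^sub>2)"
      using True unfolding extreme_measures_def mem_Collect_eq by (simp only: simp_thms)
    also have "\<dots> \<longleftrightarrow> (\<forall>\<mu>\<^sub>1\<in>\<M>. \<forall>\<mu>\<^sub>2\<in>\<M>. \<forall>a. 0 < a \<longrightarrow> a < 1 \<longrightarrow> \<mu> = mixture a \<mu>\<^sub>1 \<mu>\<^sub>2 \<longrightarrow> \<mu>\<^sub>1 = \<mu>\<^sub>2)"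
    proof -
      define R where "R a \<mu>\<^sub>1 \<mu>\<^sub>2 \<longleftrightarrow> \<mu> = mixture a \<mu>\<^sub>1 \<mu>\<^sub>2" for a \<mu>\<^sub>1 \<mu>\<^sub>2
      show ?thesis unfolding R_def[symmetric] by blast
    qed
    finally show ?thesis using True by (simp only: simp_thms)
  qed (simp add: extreme_measures_def)
qed

section \<open>Extreme invariant measures are the ergodic ones\<close>

context config_process
begin

context
  fixes \<mu> :: "'g config measure" and t :: real
  assumes inv: "\<mu> \<in> invariant_measures E P" and t: "t \<ge> 0"
begin

lemma L2_config: "f \<in> L2 \<mu> \<Longrightarrow> f \<in> borel_measurable config_space"
  by (simp add: L2_def measurable_inv[OF inv t])

lemma L2_fst: "f \<in> L2 \<mu> \<Longrightarrow> (\<lambda>z. f (fst z)) \<in> L2 (two_time_law \<mu> t)"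
  using integrable_fst[OF inv t, of "\<lambda>\<eta>. (f \<eta>)\<^sup>2"]
    measurable_compose[OF measurable_fst L2_config[of f]]
  unfolding L2_def mem_Collect_eq measurable_inv[OF inv t] by blast

lemma L2_snd: "f \<in> L2 \<mu> \<Longrightarrow> (\<lambda>z. f (snd z)) \<in> L2 (two_time_law \<mu> t)"
  using integrable_snd[OF inv t, of "\<lambda>\<eta>. (f \<eta>)\<^sup>2"]
    measurable_compose[OF measurable_snd L2_config[of f]]
  unfolding L2_def mem_Collect_eq measurable_inv[OF inv t] by blast

lemma two_time_increment:
  assumes f: "f \<in> L2 \<mu>"
  shows "(\<integral>z. (f (snd z) - f (fst z))\<^sup>2 \<partial>two_time_law \<mu> t) =
           2 * (\<integral>\<eta>. (f \<eta>)\<^sup>2 \<partial>\<mu>) - 2 * (\<integral>z. f (fst z) * f (snd z) \<partial>two_time_law \<mu> t)"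
proof -
  note [measurable] = L2_config[OF f]
  have int: "integrable (two_time_law \<mu> t) (\<lambda>z. (f (fst z))\<^sup>2)"
    "integrable (two_time_law \<mu> t) (\<lambda>z. (f (snd z))\<^sup>2)"
    "integrable (two_time_law \<mu> t) (\<lambda>z. f (fst z) * f (snd z))"
    using L2_fst[OF f] L2_snd[OF f] integrable_mult_L2[OF L2_fst[OF f] L2_snd[OF f]]
    by (auto simp: L2_def)
  have "(f (snd z) - f (fst z))\<^sup>2 = (f (snd z))\<^sup>2 + (f (fst z))\<^sup>2 - 2 * (f (fst z) * f (snd z))" for z :: "'g config \<times> 'g config"
    by (simp add: power2_diff)
  then show ?thesis
    using int integral_fst[OF inv t, of "\<lambda>\<eta>. (f \<eta>)\<^sup>2"] integral_snd[OF inv t, of "\<lambda>\<eta>. (f \<eta>)\<^sup>2"] by simp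
qed

text \<open>
  The converse inequality always holds by Cauchy-Schwarz, and the case of equality forces the
  increment to vanish.
\<close>

lemma two_time_fixedI:
  assumes f: "f \<in> L2 \<mu>"
    and le: "(\<integral>\<eta>. (f \<eta>)\<^sup>2 \<partial>\<mu>) \<le> (\<integral>z. f (fst z) * f (snd z) \<partial>two_time_law \<mu> t)"
  shows "AE z in two_time_law \<mu> t. f (snd z) = f (fst z)"
proof -
  let ?W = "two_time_law \<mu>"
  have int: "integrable (?W t) (\<lambda>z. (f (snd z) - f (fst z))\<^sup>2)"
    using L2_diff[OF L2_snd[OF f] L2_fst[OF f]] by (simp add: L2_def)
  have "(\<integral>z. (f (snd z) - f (fst z))\<^sup>2 \<partial>?W t) \<le> 0"
    using two_time_increment[OF f] le by simp
  moreover have "(\<integral>z. (f (snd z) - f (fst z))\<^sup>2 \<partial>?W t) \<ge> 0" by simp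
  ultimately have "(\<integral>z. (f (snd z) - f (fst z))\<^sup>2 \<partial>?W t) = 0" by linarith
  then have "AE z in ?W t. (f (snd z) - f (fst z))\<^sup>2 = 0"
    using integral_nonneg_eq_0_iff_AE[OF int] by simp
  then show ?thesis by simp
qed

end

text \<open>
  The density of \<open>\<nu>\<close> with respect to \<open>\<mu>\<close> is bounded, hence square-integrable. Invariance of \<open>\<nu>\<close> says
  that its correlation over the time span \<open>t\<close> equals its second moment, so that the dynamics fixes
  it, and ergodicity makes it constant.
\<close>

lemma ergodic_dominated_eq:
  assumes erg: "\<mu> \<in> ergodic_measures E P" and inv': "\<nu> \<in> invariant_measures E P"
    and a: "0 < a" and dom: "\<And>A. A \<in> sets config_space \<Longrightarrow> a * measure \<nu> A \<le> measure \<mu> A"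
  shows "\<nu> = \<mu>"
proof -
  let ?W = "two_time_law \<mu>"
  have inv: "\<mu> \<in> invariant_measures E P" using erg by (simp add: ergodic_measures_def)
  note mu = invariant_imp_laws[OF inv] and nu = invariant_imp_laws[OF inv']
  interpret m: prob_space \<mu> by (rule law_prob[OF mu])
  interpret n: prob_space \<nu> by (rule law_prob[OF nu])
  have "absolutely_continuous \<mu> \<nu>"
    unfolding absolutely_continuous_def
  proof
    fix A assume A: "A \<in> null_sets \<mu>"
    then have s: "A \<in> sets config_space" using null_setsD2[OF A] by (simp add: law_sets[OF mu])
    have "a * measure \<nu> A \<le> 0" using dom[OF s] measure_eq_0_null_sets[OF A] by simp
    then have "measure \<nu> A \<le> 0" using a by (simp add: mult_le_0_iff)
    then have "emeasure \<nu> A = 0" by (simp add: n.emeasure_eq_measure measure_le_0_iff)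
    then show "A \<in> null_sets \<nu>" by (rule null_setsI) (simp add: law_sets[OF nu] s)
  qed
  then obtain f where f0: "f \<in> borel_measurable \<mu>" and f: "density \<mu> f = \<nu>"
    using m.Radon_Nikodym[of \<nu>] law_sets[OF mu] law_sets[OF nu] by auto
  then have [measurable]: "f \<in> borel_measurable config_space" by (simp add: measurable_law[OF mu])
  define B where "B = {\<eta>. f \<eta> > ennreal (1 / a)}"
  have B [measurable]: "B \<in> sets config_space"
  proof -
    have "{\<eta>\<in>space config_space. f \<eta> > ennreal (1 / a)} \<in> sets config_space" by measurable
    then show ?thesis by (simp add: B_def)
  qed
  then have B' [measurable]: "B \<in> sets \<mu>" by (simp add: law_sets[OF mu])
  have nuB: "emeasure \<nu> B \<le> ennreal (1 / a) * emeasure \<mu> B"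
    using dom[OF B] a by (simp add: n.emeasure_eq_measure m.emeasure_eq_measure field_simps flip: ennreal_mult'')
  \<comment> \<open>the density exceeds \<open>1 / a\<close> on a null set only, since \<open>\<nu>\<close> is at most \<open>\<mu> / a\<close> on \<open>B\<close>\<close>
  have "(\<integral>\<^sup>+\<eta>. f \<eta> * indicator B \<eta> - ennreal (1 / a) * indicator B \<eta> \<partial>\<mu>)
     = (\<integral>\<^sup>+\<eta>. f \<eta> * indicator B \<eta> \<partial>\<mu>) - (\<integral>\<^sup>+\<eta>. ennreal (1 / a) * indicator B \<eta> \<partial>\<mu>)"
  proof (rule nn_integral_diff)
    show "(\<integral>\<^sup>+\<eta>. ennreal (1 / a) * indicator B \<eta> \<partial>\<mu>) \<noteq> \<infinity>"
      using B' by (simp add: nn_integral_cmult_indicator ennreal_mult_eq_top_iff m.emeasure_eq_measure)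
    show "AE \<eta> in \<mu>. ennreal (1 / a) * indicator B \<eta> \<le> f \<eta> * indicator B \<eta>"
      by (rule AE_I2) (auto simp: B_def indicator_def)
  qed (use f0 in measurable)
  also have "\<dots> = emeasure \<nu> B - ennreal (1 / a) * emeasure \<mu> B"
    using emeasure_density[OF f0 B'] B' by (simp add: f nn_integral_cmult_indicator)
  also have "\<dots> = 0"
    using nuB by (simp add: diff_eq_0_iff_ennreal n.emeasure_eq_measure)
  finally have "AE \<eta> in \<mu>. f \<eta> * indicator B \<eta> - ennreal (1 / a) * indicator B \<eta> = 0"
    using f0 by (subst (asm) nn_integral_0_iff_AE) auto
  then have bound: "AE \<eta> in \<mu>. f \<eta> \<le> ennreal (1 / a)"
  proof eventually_elim
    fix \<eta> assume *: "f \<eta> * indicator B \<eta> - ennreal (1 / a) * indicator B \<eta> = 0"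
    show "f \<eta> \<le> ennreal (1 / a)"
      using * by (cases "\<eta> \<in> B") (auto simp: diff_eq_0_iff_ennreal B_def not_less)
  qed
  define u where "u \<eta> = enn2real (f \<eta>)" for \<eta>
  have [measurable]: "u \<in> borel_measurable config_space" unfolding u_def by measurable
  have fu: "AE \<eta> in \<mu>. f \<eta> = ennreal (u \<eta>)"
    using bound by eventually_elim (auto simp: u_def ennreal_enn2real_if top_unique)
  have ub: "AE \<eta> in \<mu>. u \<eta> \<le> 1 / a"
    using bound by eventually_elim (use a in \<open>auto simp: u_def intro!: enn2real_leI\<close>)
  have u0: "u \<eta> \<ge> 0" for \<eta> by (simp add: u_def)
  have u2: "integrable \<mu> (\<lambda>\<eta>. (u \<eta>)\<^sup>2)"
  proof (rule m.integrable_const_bound)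
    show "AE \<eta> in \<mu>. norm ((u \<eta>)\<^sup>2) \<le> (1 / a)\<^sup>2"
      using ub by eventually_elim (use u0 in \<open>auto intro!: power_mono\<close>)
  qed (simp add: measurable_law[OF mu])
  have uL2: "u \<in> L2 \<mu>" using u2 by (simp add: L2_def measurable_law[OF mu])
  have "(\<integral>\<^sup>+\<eta>. ennreal (u \<eta>) \<partial>\<mu>) = (\<integral>\<^sup>+\<eta>. f \<eta> \<partial>\<mu>)"
    using fu by (intro nn_integral_cong_AE) auto
  also have "\<dots> = emeasure \<nu> (space \<nu>)"
    using emeasure_density[OF f0 sets.top] by (simp add: f law_space[OF mu] law_space[OF nu])
  finally have mean: "(\<integral>\<eta>. u \<eta> \<partial>\<mu>) = 1"
    using u0 by (subst integral_eq_nn_integral) (auto simp: measurable_law[OF mu] n.emeasure_space_1)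
  have "AE z in ?W t. u (snd z) = u (fst z)" if t: "t \<ge> 0" for t
  proof (rule two_time_fixedI[OF inv t uL2])
    note [simp] = measurable_two_time_law[OF mu t]
    have "ennreal (\<integral>z. u (fst z) * u (snd z) \<partial>?W t) =
      (\<integral>\<^sup>+z. ennreal (u (fst z) * u (snd z)) \<partial>?W t)"
      using integrable_mult_L2[OF L2_fst[OF inv t uL2] L2_snd[OF inv t uL2]] u0
      by (intro nn_integral_eq_integral[symmetric]) auto
    also have "\<dots> = (\<integral>\<^sup>+z. f (fst z) * f (snd z) \<partial>?W t)"
      using AE_fst[OF inv t fu] AE_snd[OF inv t fu] u0
      by (intro nn_integral_cong_AE) (auto simp: ennreal_mult)
    also have "\<dots> = (\<integral>\<^sup>+z. f (snd z) \<partial>two_time_law \<nu> t)"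
      using nn_integral_two_time_law_density[of \<mu> f t "\<lambda>z. f (snd z)"] mu nu f t by simp
    also have "\<dots> = (\<integral>\<^sup>+\<eta>. f \<eta> \<partial>\<nu>)" by (rule nn_integral_snd[OF inv' t]) measurable
    also have "\<dots> = (\<integral>\<^sup>+\<eta>. f \<eta> * f \<eta> \<partial>\<mu>)"
      unfolding f[symmetric] using f0 by (intro nn_integral_density) auto
    also have "\<dots> = (\<integral>\<^sup>+\<eta>. ennreal ((u \<eta>)\<^sup>2) \<partial>\<mu>)"
      using fu u0 by (intro nn_integral_cong_AE) (auto simp: ennreal_mult power2_eq_square)
    also have "\<dots> = ennreal (\<integral>\<eta>. (u \<eta>)\<^sup>2 \<partial>\<mu>)"
      using u2 by (intro nn_integral_eq_integral) auto
    finally have "(\<integral>z. u (fst z) * u (snd z) \<partial>?W t) = (\<integral>\<eta>. (u \<eta>)\<^sup>2 \<partial>\<mu>)"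
      using u0 by (subst (asm) ennreal_inj) auto
    then show "(\<integral>\<eta>. (u \<eta>)\<^sup>2 \<partial>\<mu>) \<le> (\<integral>z. u (fst z) * u (snd z) \<partial>?W t)" by simp
  qed
  then have "AE \<eta> in \<mu>. u \<eta> = 1"
    using erg[unfolded ergodic_iff_two_time, THEN conjunct2, rule_format, OF uL2] mean by simp
  with fu have "AE \<eta> in \<mu>. f \<eta> = 1" by eventually_elim simp
  then have "density \<mu> f = density \<mu> (\<lambda>_. 1)" using f0 by (intro density_cong) simp_all
  then show ?thesis unfolding f density_1 .
qed

lemma invariant_subset_prob: "invariant_measures E P \<subseteq> prob_measures"
  unfolding invariant_measures_def by (rule Collect_restrict)

lemma ergodic_imp_extreme:
  assumes erg: "\<mu> \<in> ergodic_measures E P"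
  shows "\<mu> \<in> extreme_measures (invariant_measures E P)"
  unfolding extreme_iff_mixture[OF invariant_subset_prob]
proof (intro conjI ballI allI impI)
  show "\<mu> \<in> invariant_measures E P" using erg by (simp add: ergodic_measures_def)
  fix \<mu>\<^sub>1 \<mu>\<^sub>2 and a :: real
  assume inv: "\<mu>\<^sub>1 \<in> invariant_measures E P" "\<mu>\<^sub>2 \<in> invariant_measures E P"
    and a: "0 < a" "a < 1" and eq: "\<mu> = mixture a \<mu>\<^sub>1 \<mu>\<^sub>2"
  then have prob: "\<mu>\<^sub>1 \<in> prob_measures" "\<mu>\<^sub>2 \<in> prob_measures" using invariant_subset_prob by auto
  have "\<mu>\<^sub>1 = \<mu>"
    by (rule ergodic_dominated_eq[OF erg inv(1) a(1)]) (use a in \<open>simp add: eq measure_mixture[OF prob a]\<close>)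
  moreover have "\<mu>\<^sub>2 = \<mu>"
    by (rule ergodic_dominated_eq[OF erg inv(2), of "1 - a"])
      (use a in \<open>simp_all add: eq measure_mixture[OF prob a]\<close>)
  ultimately show "\<mu>\<^sub>1 = \<mu>\<^sub>2" by simp
qed

text \<open>
  If a fixed function \<open>f\<close> is not constant, then it exceeds its mean with a probability strictly between
  \<open>0\<close> and \<open>1\<close>. Conditioning on this event and on its complement gives two invariant measures of
  which \<open>\<mu>\<close> is a mixture.
\<close>

lemma extreme_imp_ergodic:
  assumes ext: "\<mu> \<in> extreme_measures (invariant_measures E P)"
  shows "\<mu> \<in> ergodic_measures E P"
  unfolding ergodic_iff_two_time
proof (intro conjI ballI impI)
  let ?W = "two_time_law \<mu>"
  show inv: "\<mu> \<in> invariant_measures E P"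
    using ext unfolding extreme_measures_def mem_Collect_eq by (rule conjunct1)
  note mu = invariant_imp_laws[OF inv]
  interpret prob_space \<mu> by (rule law_prob[OF mu])
  fix f assume f: "f \<in> L2 \<mu>" and fixed: "\<forall>t\<ge>0. AE z in ?W t. f (snd z) = f (fst z)"
  have [measurable]: "f \<in> borel_measurable config_space" by (rule L2_config[OF inv order_refl f])
  note [simp] = measurable_law[OF mu] law_sets[OF mu] law_space[OF mu]
  have [simp]: "prob UNIV = 1" using prob_space by simp
  note int = L2_integrable[OF f]
  let ?m = "\<integral>\<eta>. f \<eta> \<partial>\<mu>"
  let ?A = "{\<eta>. ?m < f \<eta>}"
  have A: "?A \<in> sets config_space"
  proof -
    have "{\<eta>\<in>space config_space. ?m < f \<eta>} \<in> sets config_space" by measurable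
    then show ?thesis by simp
  qed
  show "AE \<eta> in \<mu>. f \<eta> = ?m"
  proof (rule ccontr)
    assume nconst: "\<not> (AE \<eta> in \<mu>. f \<eta> = ?m)"
    have pos: "0 < prob ?A"
    proof (rule ccontr)
      assume "\<not> 0 < prob ?A"
      then have "prob ?A = 0" using measure_nonneg[of \<mu> ?A] by linarith
      then have "AE \<eta> in \<mu>. \<eta> \<notin> ?A" using prob_eq_0[of ?A] A by simp
      then have le: "AE \<eta> in \<mu>. 0 \<le> ?m - f \<eta>" by eventually_elim (simp add: not_less)
      have "(\<integral>\<eta>. ?m - f \<eta> \<partial>\<mu>) = 0" using int by (simp add: prob_space)
      then have "AE \<eta> in \<mu>. ?m - f \<eta> = 0"
        using integral_nonneg_eq_0_iff_AE[OF _ le] int by simp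
      then have "AE \<eta> in \<mu>. f \<eta> = ?m" by eventually_elim simp
      then show False using nconst by simp
    qed
    have lt1: "prob ?A < 1"
    proof (rule ccontr)
      assume "\<not> prob ?A < 1"
      then have "prob ?A = 1" using prob_le_1[of ?A] by linarith
      then have "AE \<eta> in \<mu>. \<eta> \<in> ?A" using prob_eq_1[of ?A] A by simp
      then have gt: "AE \<eta> in \<mu>. 0 \<le> f \<eta> - ?m" by eventually_elim simp
      have "(\<integral>\<eta>. f \<eta> - ?m \<partial>\<mu>) = 0" using int by (simp add: prob_space)
      then have "AE \<eta> in \<mu>. f \<eta> - ?m = 0"
        using integral_nonneg_eq_0_iff_AE[OF _ gt] int by simp
      then have "AE \<eta> in \<mu>. f \<eta> = ?m" by eventually_elim simp
      then show False using nconst by simp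
    qed
    have cond: "uniform_measure \<mu> S \<in> invariant_measures E P"
      if S: "S \<in> sets config_space" and pS: "prob S \<noteq> 0"
        and fx: "\<And>t. t \<ge> 0 \<Longrightarrow> AE z in ?W t. (snd z \<in> S) = (fst z \<in> S)" for S
      unfolding uniform_measure_def
    proof (rule invariant_densityI[OF inv])
      show "(\<lambda>x. indicator S x / emeasure \<mu> S) \<in> borel_measurable config_space"
        using S by measurable
      show "prob_space (density \<mu> (\<lambda>x. indicator S x / emeasure \<mu> S))"
        using pS by (fold uniform_measure_def, intro prob_space_uniform_measure)
          (auto simp: emeasure_eq_measure)
      show "AE z in ?W t. indicator S (snd z) / emeasure \<mu> S = indicator S (fst z) / emeasure \<mu> S"
        if "t \<ge> 0" for t
        using fx[OF that] by eventually_elim (auto simp: indicator_def)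
    qed
    let ?n1 = "uniform_measure \<mu> ?A" and ?n2 = "uniform_measure \<mu> (- ?A)"
    have Ac: "- ?A \<in> sets config_space" using sets.compl_sets[OF A] by (simp add: Compl_eq_Diff_UNIV)
    have pAc: "prob (- ?A) = 1 - prob ?A"
      using prob_compl[of ?A] A by (simp add: Compl_eq_Diff_UNIV)
    have i1: "?n1 \<in> invariant_measures E P"
    proof (rule cond[OF A])
      fix t :: real assume "t \<ge> 0"
      with fixed have "AE z in ?W t. f (snd z) = f (fst z)" by blast
      then show "AE z in ?W t. (snd z \<in> ?A) = (fst z \<in> ?A)"
        by eventually_elim simp
    qed (use pos in simp)
    have i2: "?n2 \<in> invariant_measures E P"
    proof (rule cond[OF Ac])
      fix t :: real assume "t \<ge> 0"
      with fixed have "AE z in ?W t. f (snd z) = f (fst z)" by blast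
      then show "AE z in ?W t. (snd z \<in> - ?A) = (fst z \<in> - ?A)"
        by eventually_elim simp
    qed (use lt1 pAc in simp)
    have eA: "emeasure \<mu> ?A \<noteq> 0" "emeasure \<mu> (- ?A) \<noteq> 0"
      using pos lt1 pAc by (auto simp: emeasure_eq_measure)
    have "\<mu> = mixture (prob ?A) ?n1 ?n2"
    proof (rule eq_mixtureI)
      fix B assume "B \<in> sets \<mu>"
      then have B: "B \<in> sets config_space" by simp
      have "prob B = prob (?A \<inter> B) + prob (- ?A \<inter> B)"
      proof -
        have "prob ((?A \<inter> B) \<union> (- ?A \<inter> B)) = prob (?A \<inter> B) + prob (- ?A \<inter> B)"
          by (rule finite_measure_Union) (use A Ac B in auto)
        also have "(?A \<inter> B) \<union> (- ?A \<inter> B) = B" by blast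
        finally show ?thesis .
      qed
      then show "prob B = prob ?A * measure ?n1 B + (1 - prob ?A) * measure ?n2 B"
        using A Ac B eA pos lt1 pAc
        by (simp add: measure_uniform_measure)
    qed (use i1 i2 inv invariant_subset_prob pos lt1 in auto)
    then have "?n1 = ?n2"
      using ext[unfolded extreme_iff_mixture[OF invariant_subset_prob], THEN conjunct2, rule_format, OF i1 i2 pos lt1]
      by simp
    moreover have "measure ?n1 ?A = 1"
      using measure_uniform_measure[OF eA(1), of ?A] A pos by simp
    moreover have "measure ?n2 ?A = 0"
      using measure_uniform_measure[OF eA(2), of ?A] A by (simp add: Compl_disjoint2)
    ultimately show False by simp
  qed
qed

theorem extreme_invariant_eq_ergodic:
  "extreme_measures (invariant_measures E P) = ergodic_measures E P"
  using ergodic_imp_extreme extreme_imp_ergodic by blast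

end

section \<open>Finite configurations and the duality function\<close>

definition mass :: "'g config \<Rightarrow> nat" where
  "mass \<xi> = (\<Sum>x\<in>supp \<xi>. \<xi> x)"

lemma particles_eq_mass:
  assumes "\<xi> \<in> fin_configs" shows "particles \<xi> = of_nat (mass \<xi>)"
proof -
  have "finite (supp \<xi>)" using assms by (simp add: fin_configs_iff)
  then have "(\<Sum>\<^sub>\<infinity>x\<in>UNIV. of_nat (\<xi> x)) = (\<Sum>x\<in>supp \<xi>. of_nat (\<xi> x) :: ennreal)"
    by (subst infsum_cong_neutral[where T = "supp \<xi>" and g = "\<lambda>x. of_nat (\<xi> x)"])
       (auto simp: supp_def)
  then show ?thesis by (simp add: particles_def mass_def)
qed

lemma n_configs_iff: "\<xi> \<in> n_configs n \<longleftrightarrow> \<xi> \<in> fin_configs \<and> mass \<xi> = n"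
proof
  assume "\<xi> \<in> n_configs n"
  then have p: "particles \<xi> = of_nat n" by (simp add: n_configs_def)
  then have "\<xi> \<in> fin_configs" by (simp add: fin_configs_def of_nat_less_top)
  moreover from this p have "(of_nat (mass \<xi>) :: ennreal) = of_nat n" by (simp add: particles_eq_mass)
  ultimately show "\<xi> \<in> fin_configs \<and> mass \<xi> = n" by (simp only: of_nat_eq_iff)
qed (simp add: n_configs_def particles_eq_mass)

lemma particles_le_iff: "particles \<xi> \<le> of_nat n \<longleftrightarrow> \<xi> \<in> fin_configs \<and> mass \<xi> \<le> n"
proof
  assume p: "particles \<xi> \<le> of_nat n"
  then have "\<xi> \<in> fin_configs"
    using of_nat_less_top[of n] by (simp add: fin_configs_def order.strict_trans1)
  with p show "\<xi> \<in> fin_configs \<and> mass \<xi> \<le> n"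
    by (simp add: particles_eq_mass del: of_nat_le_iff) (metis of_nat_le_iff)
qed (simp add: particles_eq_mass)

lemma single_fin [simp]: "single x \<in> fin_configs" and supp_single [simp]: "supp (single x) = {x}"
  and mass_single [simp]: "mass (single x) = 1"
  by (auto simp: fin_configs_iff supp_def single_def mass_def)

lemma mass_zero_iff: "\<xi> \<in> fin_configs \<Longrightarrow> mass \<xi> = 0 \<longleftrightarrow> \<xi> = (\<lambda>_. 0)"
  by (auto simp: fin_configs_iff mass_def supp_def fun_eq_iff)

lemma card_supp_le_mass:
  assumes "\<xi> \<in> fin_configs" shows "card (supp \<xi>) \<le> mass \<xi>"
proof -
  have "card (supp \<xi>) = (\<Sum>x\<in>supp \<xi>. 1)" by simp
  also have "\<dots> \<le> mass \<xi>" unfolding mass_def by (rule sum_mono) (auto simp: supp_def)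
  finally show ?thesis .
qed

lemma le_mass: "\<xi> \<in> fin_configs \<Longrightarrow> \<xi> x \<le> mass \<xi>"
  using member_le_sum[of x "supp \<xi>" \<xi>]
  by (cases "x \<in> supp \<xi>") (auto simp: fin_configs_iff mass_def supp_def)

lemma mass_one_imp_single:
  assumes "\<xi> \<in> fin_configs" "mass \<xi> = 1" obtains y where "\<xi> = single y"
proof -
  have "supp \<xi> \<noteq> {}" using assms(2) by (auto simp: mass_def)
  then obtain y where y: "y \<in> supp \<xi>" by auto
  have "card (supp \<xi>) \<le> 1" using card_supp_le_mass[OF assms(1)] assms(2) by simp
  moreover have "card (supp \<xi>) \<noteq> 0" using y assms(1) by (auto simp: fin_configs_iff)
  ultimately have "card (supp \<xi>) = 1" by linarith
  then obtain z where "supp \<xi> = {z}" by (rule card_1_singletonE)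
  with y have s: "supp \<xi> = {y}" by simp
  then have "\<xi> y = 1" using assms(2) by (simp add: mass_def)
  moreover have "\<xi> x = 0" if "x \<noteq> y" for x
  proof -
    have "x \<notin> supp \<xi>" using that s by simp
    then show ?thesis by (simp add: supp_def)
  qed
  ultimately have "\<xi> = single y" by (simp add: fun_eq_iff single_def)
  then show ?thesis by (rule that)
qed

lemma perpD: "perp \<xi> \<zeta> \<Longrightarrow> x \<in> supp \<xi> \<Longrightarrow> \<zeta> x = 0"
  by (auto simp: perp_def supp_def disjoint_iff)

lemma perp_commute: "perp \<xi> \<zeta> \<longleftrightarrow> perp \<zeta> \<xi>"
  by (auto simp: perp_def)

lemma
  assumes "\<xi> \<in> fin_configs" "\<zeta> \<in> fin_configs" and perp: "perp \<xi> \<zeta>"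
  shows fin_configs_add: "(\<lambda>x. \<xi> x + \<zeta> x) \<in> fin_configs"
    and mass_add_perp: "mass (\<lambda>x. \<xi> x + \<zeta> x) = mass \<xi> + mass \<zeta>"
proof -
  have s: "supp (\<lambda>x. \<xi> x + \<zeta> x) = supp \<xi> \<union> supp \<zeta>" by (auto simp: supp_def)
  then show "(\<lambda>x. \<xi> x + \<zeta> x) \<in> fin_configs" using assms by (simp add: fin_configs_iff)
  have "mass (\<lambda>x. \<xi> x + \<zeta> x) = (\<Sum>x\<in>supp \<xi>. \<xi> x + \<zeta> x) + (\<Sum>x\<in>supp \<zeta>. \<xi> x + \<zeta> x)"
    unfolding mass_def s using assms
    by (intro sum.union_disjoint) (auto simp: fin_configs_iff perp_def)
  also have "(\<Sum>x\<in>supp \<xi>. \<xi> x + \<zeta> x) = mass \<xi>"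
    unfolding mass_def using perpD[OF perp] by (intro sum.cong) auto
  also have "(\<Sum>x\<in>supp \<zeta>. \<xi> x + \<zeta> x) = mass \<zeta>"
    unfolding mass_def using perpD[OF perp[unfolded perp_commute[of \<xi>]]] by (intro sum.cong) auto
  finally show "mass (\<lambda>x. \<xi> x + \<zeta> x) = mass \<xi> + mass \<zeta>" .
qed

lemma tempered_subset_prob: "tempered_measures D \<subseteq> prob_measures"
  unfolding tempered_measures_def by (rule Collect_restrict)

context
  fixes D :: "'g config \<Rightarrow> 'g config \<Rightarrow> real" and \<mu> :: "'g config measure"
  assumes tempered: "\<mu> \<in> tempered_measures D"
begin

lemmas tempered_conjs = tempered[unfolded tempered_measures_def mem_Collect_eq, THEN conjunct2]

lemma tempered_D_integrable: "D_integrable D \<mu>"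
  by (rule tempered_conjs[THEN conjunct1])

lemma tempered_integrable: "\<xi> \<in> fin_configs \<Longrightarrow> integrable \<mu> (D \<xi>)"
  using tempered_D_integrable unfolding D_integrable_def by (rule bspec)

lemma tempered_bdd_above:
  "bdd_above (D_transform D \<mu> ` {\<xi>. particles \<xi> \<le> of_nat n})"
  by (rule tempered_conjs[THEN conjunct2, THEN conjunct1, THEN spec])

lemma tempered_determined:
  assumes "\<nu> \<in> prob_measures" "D_integrable D \<nu>"
    and "\<And>\<xi>. \<xi> \<in> fin_configs \<Longrightarrow> D_transform D \<mu> \<xi> = D_transform D \<nu> \<xi>"
  shows "\<mu> = \<nu>"
  using tempered_conjs[THEN conjunct2, THEN conjunct2, THEN conjunct1, rule_format, OF assms(1,2)] assms(3)
  by simp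

lemma tempered_L2: "\<xi> \<in> fin_configs \<Longrightarrow> D \<xi> \<in> L2 \<mu>"
  by (rule tempered_conjs[THEN conjunct2, THEN conjunct2, THEN conjunct2, THEN conjunct1, THEN bspec])

lemma tempered_dense:
  assumes "f \<in> L2 \<mu>" "0 < \<epsilon>"
  obtains F c where "finite F" "F \<subseteq> fin_configs"
    "(\<integral>\<eta>. (f \<eta> - (\<Sum>\<xi>\<in>F. c \<xi> * D \<xi> \<eta>))\<^sup>2 \<partial>\<mu>) < \<epsilon>"
  using tempered_conjs[THEN conjunct2, THEN conjunct2, THEN conjunct2, THEN conjunct2, rule_format, OF assms]
  by (elim exE conjE)

end

locale duality_function =
  fixes d :: "nat \<Rightarrow> nat \<Rightarrow> real" and D :: "'g config \<Rightarrow> 'g config \<Rightarrow> real"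
  assumes factorized: "factorized_duality_function d D"
begin

lemma d_zero [simp]: "d 0 n = 1"
  and d_nonneg [simp]: "0 \<le> d k n"
  using factorized by (simp_all add: factorized_duality_function_def)

lemma D_eq_prod:
  assumes "finite A" "supp \<xi> \<subseteq> A" shows "D \<xi> \<eta> = (\<Prod>x\<in>A. d (\<xi> x) (\<eta> x))"
proof -
  have "\<xi> \<in> fin_configs" using assms by (auto simp: fin_configs_iff intro: finite_subset)
  then have "D \<xi> \<eta> = (\<Prod>x\<in>supp \<xi>. d (\<xi> x) (\<eta> x))"
    using factorized by (simp add: factorized_duality_function_def)
  also have "\<dots> = (\<Prod>x\<in>A. d (\<xi> x) (\<eta> x))"
    by (rule prod.mono_neutral_left) (use assms in \<open>auto simp: supp_def\<close>)
  finally show ?thesis .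
qed

lemma D_fin: "\<xi> \<in> fin_configs \<Longrightarrow> D \<xi> \<eta> = (\<Prod>x\<in>supp \<xi>. d (\<xi> x) (\<eta> x))"
  by (rule D_eq_prod) (simp_all add: fin_configs_iff)

lemma D_nonneg: "\<xi> \<in> fin_configs \<Longrightarrow> 0 \<le> D \<xi> \<eta>"
  by (simp add: D_fin prod_nonneg)

lemma D_measurable:
  assumes "\<xi> \<in> fin_configs" shows "D \<xi> \<in> borel_measurable config_space"
proof -
  have "(\<lambda>\<eta>. \<Prod>x\<in>supp \<xi>. d (\<xi> x) (\<eta> x)) \<in> borel_measurable config_space" by measurable
  then show ?thesis using D_fin[OF assms] by (simp add: fun_eq_iff[symmetric] cong: measurable_cong)
qed

lemma D_add_perp:
  assumes "\<xi> \<in> fin_configs" "\<zeta> \<in> fin_configs" and perp: "perp \<xi> \<zeta>"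
  shows "D (\<lambda>x. \<xi> x + \<zeta> x) \<eta> = D \<xi> \<eta> * D \<zeta> \<eta>"
proof -
  have "D (\<lambda>x. \<xi> x + \<zeta> x) \<eta> = (\<Prod>x\<in>supp \<xi> \<union> supp \<zeta>. d (\<xi> x + \<zeta> x) (\<eta> x))"
    using assms by (intro D_eq_prod) (auto simp: fin_configs_iff supp_def)
  also have "\<dots> = (\<Prod>x\<in>supp \<xi>. d (\<xi> x + \<zeta> x) (\<eta> x)) * (\<Prod>x\<in>supp \<zeta>. d (\<xi> x + \<zeta> x) (\<eta> x))"
    using assms by (intro prod.union_disjoint) (auto simp: fin_configs_iff perp_def)
  also have "(\<Prod>x\<in>supp \<xi>. d (\<xi> x + \<zeta> x) (\<eta> x)) = D \<xi> \<eta>"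
    unfolding D_fin[OF assms(1)] using perpD[OF perp] by (intro prod.cong) auto
  also have "(\<Prod>x\<in>supp \<zeta>. d (\<xi> x + \<zeta> x) (\<eta> x)) = D \<zeta> \<eta>"
    unfolding D_fin[OF assms(2)] using perpD[OF perp[unfolded perp_commute[of \<xi>]]] by (intro prod.cong) auto
  finally show ?thesis .
qed

text \<open>
  The square of \<open>d k\<close> is a polynomial of degree \<open>2 * k\<close> and therefore a combination of the functions
  \<open>d r\<close> with \<open>r \<le> 2 * k\<close>; they are nonnegative, so that the coefficients may be replaced by their absolute
  values.
\<close>

lemma d_square_le:
  "\<exists>C\<ge>1. \<forall>k\<le>n. \<forall>m. (d k m)\<^sup>2 \<le> C * (\<Sum>r\<le>2*n. d r m)"
proof -
  have "\<exists>C\<ge>0. \<forall>m. (d k m)\<^sup>2 \<le> C * (\<Sum>r\<le>2*n. d r m)" if "k \<le> n" for k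
  proof -
    obtain p :: "real poly" where p: "degree p = k" "\<And>m. d k m = poly p (real m)"
      using factorized unfolding factorized_duality_function_def by meson
    obtain c where c: "\<And>m. poly (p\<^sup>2) (real m) = (\<Sum>r\<le>degree (p\<^sup>2). c r * d r m)"
      using factorized unfolding factorized_duality_function_def by meson
    define C where "C = (\<Sum>r\<le>degree (p\<^sup>2). \<bar>c r\<bar>)"
    have deg: "degree (p\<^sup>2) \<le> 2 * n"
      using degree_power_le[of p 2] p(1) that by (simp add: mult.commute)
    have "(d k m)\<^sup>2 \<le> C * (\<Sum>r\<le>2*n. d r m)" for m
    proof -
      have "(d k m)\<^sup>2 = (\<Sum>r\<le>degree (p\<^sup>2). c r * d r m)"
        using c[of m] p(2)[of m] by (simp add: poly_power)
      also have "\<dots> \<le> (\<Sum>r\<le>degree (p\<^sup>2). C * d r m)"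
      proof (rule sum_mono)
        fix r assume "r \<in> {..degree (p\<^sup>2)}"
        then have "\<bar>c r\<bar> \<le> C" unfolding C_def by (intro member_le_sum) auto
        then show "c r * d r m \<le> C * d r m" by (intro mult_right_mono) auto
      qed
      also have "\<dots> \<le> (\<Sum>r\<le>2*n. C * d r m)"
        using deg by (intro sum_mono2) (auto simp: C_def intro!: mult_nonneg_nonneg sum_nonneg)
      also have "\<dots> = C * (\<Sum>r\<le>2*n. d r m)" by (simp add: sum_distrib_left)
      finally show ?thesis .
    qed
    moreover have "C \<ge> 0" by (simp add: C_def sum_nonneg)
    ultimately show ?thesis by blast
  qed
  then obtain C where C: "\<And>k. k \<le> n \<Longrightarrow> C k \<ge> 0"
    "\<And>k m. k \<le> n \<Longrightarrow> (d k m)\<^sup>2 \<le> C k * (\<Sum>r\<le>2*n. d r m)" by metis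
  have "(d k m)\<^sup>2 \<le> (1 + (\<Sum>k\<le>n. C k)) * (\<Sum>r\<le>2*n. d r m)" if "k \<le> n" for k m
  proof -
    have "C k \<le> (\<Sum>k\<le>n. C k)" using that C(1) by (intro member_le_sum) auto
    then have "C k * (\<Sum>r\<le>2*n. d r m) \<le> (1 + (\<Sum>k\<le>n. C k)) * (\<Sum>r\<le>2*n. d r m)"
      by (intro mult_right_mono) (auto intro: sum_nonneg)
    with C(2)[OF that, of m] show ?thesis by linarith
  qed
  moreover have "1 + (\<Sum>k\<le>n. C k) \<ge> 1" using C(1) sum_nonneg[of "{..n}" C] by simp
  ultimately show ?thesis by blast
qed

text \<open>
  Expanding the product over the sites of \<open>\<zeta>\<close> bounds the square of \<open>D \<zeta>\<close> by duality functions of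
  configurations on the same sites. Their number and their masses are controlled by the mass of \<open>\<zeta>\<close>
  alone, since a configuration of mass \<open>n\<close> occupies at most \<open>n\<close> sites.
\<close>

lemma D_square_le:
  "\<exists>C\<ge>0. \<forall>\<zeta>\<in>fin_configs. mass \<zeta> \<le> n \<longrightarrow>
     (\<exists>R. finite R \<and> card R \<le> (2 * n + 1) ^ n \<and> (\<forall>\<xi>\<in>R. \<xi> \<in> fin_configs \<and> mass \<xi> \<le> n * (2 * n)) \<and>
       (\<forall>\<eta>. (D \<zeta> \<eta>)\<^sup>2 \<le> C * (\<Sum>\<xi>\<in>R. D \<xi> \<eta>)))"
proof -
  obtain C where C1: "C \<ge> 1" and C: "\<And>k m. k \<le> n \<Longrightarrow> (d k m)\<^sup>2 \<le> C * (\<Sum>r\<le>2*n. d r m)"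
    using d_square_le[of n] by blast
  have "\<exists>R. finite R \<and> card R \<le> (2 * n + 1) ^ n \<and> (\<forall>\<xi>\<in>R. \<xi> \<in> fin_configs \<and> mass \<xi> \<le> n * (2 * n)) \<and>
       (\<forall>\<eta>. (D \<zeta> \<eta>)\<^sup>2 \<le> C ^ n * (\<Sum>\<xi>\<in>R. D \<xi> \<eta>))" if \<zeta>: "\<zeta> \<in> fin_configs" "mass \<zeta> \<le> n" for \<zeta>
  proof -
    let ?A = "supp \<zeta>"
    have fin: "finite ?A" using \<zeta> by (simp add: fin_configs_iff)
    have cardA: "card ?A \<le> n" using card_supp_le_mass[OF \<zeta>(1)] \<zeta>(2) by linarith
    let ?G = "PiE ?A (\<lambda>_. {..2*n})"
    define e where "e g x = (if x \<in> ?A then g x else (0::nat))" for g x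
    have finG: "finite ?G" using fin by (simp add: finite_PiE)
    have inj: "inj_on e ?G"
    proof (rule inj_onI)
      fix g h assume "g \<in> ?G" "h \<in> ?G" "e g = e h"
      then show "g = h" by (intro PiE_ext[of g ?A _ h]) (auto simp: e_def fun_eq_iff, metis)
    qed
    have supp_e: "supp (e g) \<subseteq> ?A" for g by (auto simp: supp_def e_def)
    have card_le: "card (e ` ?G) \<le> (2 * n + 1) ^ n"
    proof -
      have "card (e ` ?G) \<le> (2 * n + 1) ^ card ?A"
        using card_image[OF inj] fin by (simp add: card_PiE)
      also have "\<dots> \<le> (2 * n + 1) ^ n" by (rule power_increasing[OF cardA]) simp
      finally show ?thesis .
    qed
    have R: "\<xi> \<in> fin_configs \<and> mass \<xi> \<le> n * (2 * n)" if img: "\<xi> \<in> e ` ?G" for \<xi>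
    proof -
      obtain g where g: "g \<in> ?G" "\<xi> = e g" using img by blast
      have s: "supp \<xi> \<subseteq> ?A" using g supp_e by simp
      then have f: "finite (supp \<xi>)" using fin by (rule finite_subset)
      have "mass \<xi> \<le> (\<Sum>x\<in>supp \<xi>. 2 * n)"
        unfolding mass_def using g s by (intro sum_mono) (auto simp: e_def PiE_def Pi_def)
      also have "\<dots> \<le> card ?A * (2 * n)" using card_mono[OF fin s] by simp
      also have "\<dots> \<le> n * (2 * n)" using cardA by simp
      finally show ?thesis using f by (simp add: fin_configs_iff)
    qed
    have "(D \<zeta> \<eta>)\<^sup>2 \<le> C ^ n * (\<Sum>\<xi>\<in>e ` ?G. D \<xi> \<eta>)" for \<eta>
    proof -
      have "(D \<zeta> \<eta>)\<^sup>2 = (\<Prod>x\<in>?A. (d (\<zeta> x) (\<eta> x))\<^sup>2)"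
        by (simp add: D_fin[OF \<zeta>(1)] prod_power_distrib)
      also have "\<dots> \<le> (\<Prod>x\<in>?A. C * (\<Sum>r\<le>2*n. d r (\<eta> x)))"
        using le_mass[OF \<zeta>(1)] \<zeta>(2) by (intro prod_mono) (auto intro!: C intro: order_trans)
      also have "\<dots> = C ^ card ?A * (\<Prod>x\<in>?A. \<Sum>r\<le>2*n. d r (\<eta> x))"
        by (simp add: prod.distrib)
      also have "(\<Prod>x\<in>?A. \<Sum>r\<le>2*n. d r (\<eta> x)) = (\<Sum>g\<in>?G. \<Prod>x\<in>?A. d (g x) (\<eta> x))"
        using fin by (intro prod_sum_PiE) auto
      also have "\<dots> = (\<Sum>g\<in>?G. D (e g) \<eta>)"
        by (intro sum.cong refl) (simp add: D_eq_prod[OF fin supp_e], simp add: e_def)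
      also have "\<dots> = (\<Sum>\<xi>\<in>e ` ?G. D \<xi> \<eta>)" by (simp add: sum.reindex[OF inj])
      also have "C ^ card ?A * (\<Sum>\<xi>\<in>e ` ?G. D \<xi> \<eta>) \<le> C ^ n * (\<Sum>\<xi>\<in>e ` ?G. D \<xi> \<eta>)"
      proof (rule mult_right_mono)
        show "C ^ card ?A \<le> C ^ n" by (rule power_increasing[OF cardA C1])
        show "0 \<le> (\<Sum>\<xi>\<in>e ` ?G. D \<xi> \<eta>)" using R by (intro sum_nonneg D_nonneg) blast
      qed
      finally show ?thesis .
    qed
    with finG card_le R show ?thesis by (intro exI[of _ "e ` ?G"]) simp
  qed
  moreover have "C ^ n \<ge> 0" using C1 by simp
  ultimately show ?thesis by blast
qed

text \<open>
  The first temperedness condition only speaks of first moments, but it bounds the right-hand side of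
  the previous estimate uniformly.
\<close>

lemma tempered_second_moments:
  assumes "\<mu> \<in> tempered_measures D"
  shows "\<exists>B\<ge>0. \<forall>\<zeta>\<in>fin_configs. mass \<zeta> \<le> n \<longrightarrow> (\<integral>\<eta>. (D \<zeta> \<eta>)\<^sup>2 \<partial>\<mu>) \<le> B"
proof -
  note bdd = tempered_bdd_above[OF assms, of "n * (2 * n)"]
    and int = tempered_integrable[OF assms] and L2 = tempered_L2[OF assms]
  obtain B0 where B0: "\<And>\<xi>. \<xi> \<in> fin_configs \<Longrightarrow> mass \<xi> \<le> n * (2 * n) \<Longrightarrow> D_transform D \<mu> \<xi> \<le> B0"
    using bdd unfolding bdd_above_def particles_le_iff by blast
  define B where "B = max 0 B0"
  have B: "0 \<le> B" "\<And>\<xi>. \<xi> \<in> fin_configs \<Longrightarrow> mass \<xi> \<le> n * (2 * n) \<Longrightarrow> D_transform D \<mu> \<xi> \<le> B"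
    using B0 by (auto simp: B_def intro: max.coboundedI2)
  obtain C where C: "C \<ge> 0" and R: "\<And>\<zeta>. \<zeta> \<in> fin_configs \<Longrightarrow> mass \<zeta> \<le> n \<Longrightarrow>
     (\<exists>R. finite R \<and> card R \<le> (2 * n + 1) ^ n \<and> (\<forall>\<xi>\<in>R. \<xi> \<in> fin_configs \<and> mass \<xi> \<le> n * (2 * n)) \<and>
       (\<forall>\<eta>. (D \<zeta> \<eta>)\<^sup>2 \<le> C * (\<Sum>\<xi>\<in>R. D \<xi> \<eta>)))"
    using D_square_le[of n] by blast
  have "(\<integral>\<eta>. (D \<zeta> \<eta>)\<^sup>2 \<partial>\<mu>) \<le> C * (real ((2 * n + 1) ^ n) * B)"
    if \<zeta>: "\<zeta> \<in> fin_configs" "mass \<zeta> \<le> n" for \<zeta>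
  proof -
    obtain R where fin: "finite R" and cR: "card R \<le> (2 * n + 1) ^ n"
      and mR: "\<And>\<xi>. \<xi> \<in> R \<Longrightarrow> \<xi> \<in> fin_configs \<and> mass \<xi> \<le> n * (2 * n)"
      and le: "\<And>\<eta>. (D \<zeta> \<eta>)\<^sup>2 \<le> C * (\<Sum>\<xi>\<in>R. D \<xi> \<eta>)"
      using R[OF \<zeta>] by blast
    have "(\<integral>\<eta>. (D \<zeta> \<eta>)\<^sup>2 \<partial>\<mu>) \<le> (\<integral>\<eta>. C * (\<Sum>\<xi>\<in>R. D \<xi> \<eta>) \<partial>\<mu>)"
      using L2[OF \<zeta>(1)] mR int le unfolding L2_def
      by (intro integral_mono) (auto intro!: integrable_mult_right Bochner_Integration.integrable_sum)
    also have "\<dots> = C * (\<Sum>\<xi>\<in>R. D_transform D \<mu> \<xi>)"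
      using mR int by (simp add: D_transform_def Bochner_Integration.integral_sum)
    also have "\<dots> \<le> C * (real (card R) * B)"
      using B(2) mR C by (intro mult_left_mono sum_bounded_above) auto
    also have "\<dots> \<le> C * (real ((2 * n + 1) ^ n) * B)"
      using cR C B(1) by (intro mult_left_mono mult_right_mono) (simp_all only: of_nat_mono)
    finally show ?thesis .
  qed
  moreover have "0 \<le> C * (real ((2 * n + 1) ^ n) * B)" using B(1) C by simp
  ultimately show ?thesis by blast
qed

end

section \<open>Tempered measures form a face\<close>

lemma (in prob_space) truncation_tendsto_L2:
  assumes "f \<in> L2 M"
  shows "(\<lambda>k. \<integral>x. (f x - (if \<bar>f x\<bar> \<le> real k then f x else 0))\<^sup>2 \<partial>M) \<longlonglongrightarrow> 0"
proof -
  have [measurable]: "f \<in> borel_measurable M" and int: "integrable M (\<lambda>x. (f x)\<^sup>2)"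
    using assms unfolding L2_def by blast+
  have "(\<lambda>k. \<integral>x. (f x - (if \<bar>f x\<bar> \<le> real k then f x else 0))\<^sup>2 \<partial>M) \<longlonglongrightarrow> (\<integral>x. 0 \<partial>M)"
  proof (rule integral_dominated_convergence[where w = "\<lambda>x. (f x)\<^sup>2"])
    show "AE x in M. (\<lambda>k. (f x - (if \<bar>f x\<bar> \<le> real k then f x else 0))\<^sup>2) \<longlonglongrightarrow> 0"
    proof (rule AE_I2, rule tendsto_eventually)
      fix x
      obtain K :: nat where "\<bar>f x\<bar> \<le> real K" using real_arch_simple by blast
      then show "\<forall>\<^sub>F k in sequentially. (f x - (if \<bar>f x\<bar> \<le> real k then f x else 0))\<^sup>2 = 0"
        by (intro eventually_sequentiallyI[of K]) auto
    qed
  qed (use int in auto)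
  then show ?thesis by simp
qed

text \<open>
  The component is dominated by a multiple of the mixture, which gives the bounds on the transform.
  For the determination by the transform, replacing the component by a measure with the same transform
  does not change the transform of the mixture, hence not the mixture, hence not the component. For
  density of the span, a square-integrable function of the component need not be square-integrable
  for the mixture, but its truncations are.
\<close>

lemma tempered_mixture_component:
  assumes D: "duality_function d D"
    and mu: "\<mu> \<in> prob_measures" and nu: "\<nu> \<in> prob_measures" and a: "0 < a" "a < 1"
    and temp: "mixture a \<mu> \<nu> \<in> tempered_measures D"
  shows "\<mu> \<in> tempered_measures D"
proof -
  interpret D: duality_function d D by (rule D)
  let ?x = "mixture a \<mu> \<nu>"
  have xP: "?x \<in> prob_measures" by (rule mixture_in_prob_measures[OF mu nu a])
  interpret x: prob_space ?x using xP by (simp add: prob_measures_def)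
  interpret m: prob_space \<mu> using mu by (simp add: prob_measures_def)
  interpret n: prob_space \<nu> using nu by (simp add: prob_measures_def)
  have sets: "sets ?x = sets config_space" "sets \<mu> = sets config_space" "sets \<nu> = sets config_space"
    using xP mu nu by (simp_all add: prob_measures_def)
  have meas: "measurable ?x N = measurable config_space N" "measurable \<mu> N = measurable config_space N"
    "measurable \<nu> N = measurable config_space N" for N :: "'c measure"
    by (rule measurable_cong_sets[OF _ refl], rule sets)+
  have int: "integrable \<mu> f \<and> integrable \<nu> f" if "integrable ?x f" for f :: "_ \<Rightarrow> real"
  proof -
    have f: "f \<in> borel_measurable config_space"
      using borel_measurable_integrable[OF that] by (simp add: meas)
    have "(\<integral>\<^sup>+\<eta>. ennreal (norm (f \<eta>)) \<partial>?x) < \<infinity>" using that by (simp add: integrable_iff_bounded)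
    then have "ennreal a * (\<integral>\<^sup>+\<eta>. ennreal (norm (f \<eta>)) \<partial>\<mu>) < \<infinity>"
      "ennreal (1 - a) * (\<integral>\<^sup>+\<eta>. ennreal (norm (f \<eta>)) \<partial>\<nu>) < \<infinity>"
      using f by (simp_all add: nn_integral_mixture[OF mu nu a])
    then have "(\<integral>\<^sup>+\<eta>. ennreal (norm (f \<eta>)) \<partial>\<mu>) < \<infinity>" "(\<integral>\<^sup>+\<eta>. ennreal (norm (f \<eta>)) \<partial>\<nu>) < \<infinity>"
      using a by (auto simp: ennreal_mult_less_top)
    then show ?thesis using f by (simp add: integrable_iff_bounded meas)
  qed
  have int_eq: "(\<integral>\<eta>. f \<eta> \<partial>?x) = a * (\<integral>\<eta>. f \<eta> \<partial>\<mu>) + (1 - a) * (\<integral>\<eta>. f \<eta> \<partial>\<nu>)"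
    if i: "integrable ?x f" and pos: "\<And>\<eta>. f \<eta> \<ge> 0" for f :: "_ \<Rightarrow> real"
  proof -
    have f: "(\<lambda>\<eta>. ennreal (f \<eta>)) \<in> borel_measurable config_space"
      using borel_measurable_integrable[OF i] by (simp add: meas)
    have "ennreal (\<integral>\<eta>. f \<eta> \<partial>?x) = ennreal a * ennreal (\<integral>\<eta>. f \<eta> \<partial>\<mu>) + ennreal (1 - a) * ennreal (\<integral>\<eta>. f \<eta> \<partial>\<nu>)"
      using nn_integral_mixture[OF mu nu a f] i int[OF i] pos by (simp add: nn_integral_eq_integral)
    also have "\<dots> = ennreal (a * (\<integral>\<eta>. f \<eta> \<partial>\<mu>) + (1 - a) * (\<integral>\<eta>. f \<eta> \<partial>\<nu>))"
      using a pos by (simp add: ennreal_mult' ennreal_plus)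
    finally show ?thesis using a pos by (subst (asm) ennreal_inj) auto
  qed
  have le: "a * (\<integral>\<eta>. f \<eta> \<partial>\<mu>) \<le> (\<integral>\<eta>. f \<eta> \<partial>?x)"
    if "integrable ?x f" "\<And>\<eta>. f \<eta> \<ge> 0" for f :: "_ \<Rightarrow> real"
    using int_eq[OF that] a that(2) by simp
  have D_int: "integrable ?x (D \<xi>)" if "\<xi> \<in> fin_configs" for \<xi>
    by (rule tempered_integrable[OF temp that])
  have DL2: "D \<xi> \<in> L2 \<mu>" if "\<xi> \<in> fin_configs" for \<xi>
    using tempered_L2[OF temp that] int[of "\<lambda>\<eta>. (D \<xi> \<eta>)\<^sup>2"] D.D_measurable[OF that] unfolding L2_def mem_Collect_eq meas by blast
  show ?thesis
    unfolding tempered_measures_def mem_Collect_eq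
  proof (intro conjI ballI allI impI)
    show "\<mu> \<in> prob_measures" by (rule mu)
    show "D_integrable D \<mu>" using D_int int by (simp add: D_integrable_def)
    show "D \<xi> \<in> L2 \<mu>" if "\<xi> \<in> fin_configs" for \<xi> by (rule DL2[OF that])
  next
    fix n :: nat
    obtain B where B: "\<And>\<xi>. particles \<xi> \<le> of_nat n \<Longrightarrow> D_transform D ?x \<xi> \<le> B"
      using tempered_bdd_above[OF temp, of n] unfolding bdd_above_def by blast
    show "bdd_above (D_transform D \<mu> ` {\<xi>. particles \<xi> \<le> of_nat n})"
    proof (rule bdd_aboveI2)
      fix \<xi> :: "'a config" assume "\<xi> \<in> {\<xi>. particles \<xi> \<le> of_nat n}"
      then have p: "particles \<xi> \<le> of_nat n" and f: "\<xi> \<in> fin_configs" by (simp_all add: particles_le_iff)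
      have "a * D_transform D \<mu> \<xi> \<le> B"
        using le[OF D_int[OF f] D.D_nonneg[OF f]] B[OF p] by (simp add: D_transform_def)
      then show "D_transform D \<mu> \<xi> \<le> B / a" using a by (simp add: field_simps)
    qed
  next
    fix \<kappa> :: "'a config measure" assume \<kappa>: "\<kappa> \<in> prob_measures" "D_integrable D \<kappa>"
    show "(\<forall>\<xi>\<in>fin_configs. D_transform D \<mu> \<xi> = D_transform D \<kappa> \<xi>) = (\<mu> = \<kappa>)"
    proof
      assume eq: "\<forall>\<xi>\<in>fin_configs. D_transform D \<mu> \<xi> = D_transform D \<kappa> \<xi>"
      let ?y = "mixture a \<kappa> \<nu>"
      have yP: "?y \<in> prob_measures" by (rule mixture_in_prob_measures[OF \<kappa>(1) nu a])
      have measy: "measurable ?y N = measurable config_space N" "measurable \<kappa> N = measurable config_space N" for N :: "'c measure"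
        using yP \<kappa> by (auto intro!: measurable_cong_sets simp: prob_measures_def)
      have y: "integrable ?y (D \<xi>) \<and> D_transform D ?x \<xi> = D_transform D ?y \<xi>" if f: "\<xi> \<in> fin_configs" for \<xi>
      proof -
        have i: "integrable \<kappa> (D \<xi>)" "integrable \<nu> (D \<xi>)"
          using \<kappa>(2) f int[OF D_int[OF f]] by (simp_all add: D_integrable_def)
        note pos = D.D_nonneg[OF f]
        have m: "D \<xi> \<in> borel_measurable config_space" by (rule D.D_measurable[OF f])
        have "(\<integral>\<^sup>+\<eta>. ennreal (D \<xi> \<eta>) \<partial>?y) =
            ennreal a * ennreal (\<integral>\<eta>. D \<xi> \<eta> \<partial>\<kappa>) + ennreal (1 - a) * ennreal (\<integral>\<eta>. D \<xi> \<eta> \<partial>\<nu>)"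
          using nn_integral_mixture[OF \<kappa>(1) nu a, of "\<lambda>\<eta>. ennreal (D \<xi> \<eta>)"] m i pos
          by (simp add: nn_integral_eq_integral)
        also have "\<dots> = ennreal (a * (\<integral>\<eta>. D \<xi> \<eta> \<partial>\<kappa>) + (1 - a) * (\<integral>\<eta>. D \<xi> \<eta> \<partial>\<nu>))"
          using a pos by (simp add: ennreal_mult' ennreal_plus)
        finally have *: "(\<integral>\<^sup>+\<eta>. ennreal (D \<xi> \<eta>) \<partial>?y) = ennreal (a * (\<integral>\<eta>. D \<xi> \<eta> \<partial>\<kappa>) + (1 - a) * (\<integral>\<eta>. D \<xi> \<eta> \<partial>\<nu>))" .
        have "has_bochner_integral ?y (D \<xi>) (a * (\<integral>\<eta>. D \<xi> \<eta> \<partial>\<kappa>) + (1 - a) * (\<integral>\<eta>. D \<xi> \<eta> \<partial>\<nu>))"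
          by (rule has_bochner_integral_nn_integral[OF _ _ _ *]) (use m pos a in \<open>simp_all add: measy\<close>)
        then have "integrable ?y (D \<xi>)" "D_transform D ?y \<xi> = a * D_transform D \<kappa> \<xi> + (1 - a) * D_transform D \<nu> \<xi>"
          by (auto simp: has_bochner_integral_iff D_transform_def)
        moreover have "D_transform D ?x \<xi> = a * D_transform D \<mu> \<xi> + (1 - a) * D_transform D \<nu> \<xi>"
          using int_eq[OF D_int[OF f] pos] by (simp add: D_transform_def)
        ultimately show ?thesis using eq f by simp
      qed
      then have "?x = ?y" by (intro tempered_determined[OF temp yP]) (simp_all add: D_integrable_def)
      show "\<mu> = \<kappa>"
      proof (rule measure_eqI)
        show "sets \<mu> = sets \<kappa>" using mu \<kappa> by (simp add: prob_measures_def)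
        interpret k: prob_space \<kappa> using \<kappa> by (simp add: prob_measures_def)
        fix A assume "A \<in> sets \<mu>"
        then have A: "A \<in> sets config_space" by (simp add: sets)
        have "a * measure \<mu> A + (1 - a) * measure \<nu> A = a * measure \<kappa> A + (1 - a) * measure \<nu> A"
          unfolding measure_mixture[OF mu nu a A, symmetric] measure_mixture[OF \<kappa>(1) nu a A, symmetric]
            \<open>?x = ?y\<close> ..
        then have "measure \<mu> A = measure \<kappa> A" using a(1) by auto
        then show "emeasure \<mu> A = emeasure \<kappa> A"
          by (simp add: m.emeasure_eq_measure k.emeasure_eq_measure)
      qed
    qed simp
  next
    fix f and \<epsilon> :: real assume f: "f \<in> L2 \<mu>" and \<epsilon>: "0 < \<epsilon>"
    have [measurable]: "f \<in> borel_measurable config_space" using f unfolding L2_def meas by blast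
    obtain k :: nat where k: "(\<integral>\<eta>. (f \<eta> - (if \<bar>f \<eta>\<bar> \<le> real k then f \<eta> else 0))\<^sup>2 \<partial>\<mu>) < \<epsilon> / 4"
      using order_tendstoD(2)[OF m.truncation_tendsto_L2[OF f], of "\<epsilon> / 4"] \<epsilon>
      by (auto simp: eventually_sequentially)
    define g where "g \<eta> = (if \<bar>f \<eta>\<bar> \<le> real k then f \<eta> else 0)" for \<eta>
    have g [measurable]: "g \<in> borel_measurable config_space" unfolding g_def by measurable
    have gb: "\<bar>g \<eta>\<bar> \<le> real k" for \<eta> by (simp add: g_def)
    have gsq: "(g \<eta>)\<^sup>2 \<le> (real k)\<^sup>2" for \<eta> using power_mono[OF gb, of \<eta> 2] by simp
    have gL2x: "g \<in> L2 ?x"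
      unfolding L2_def using g gsq
      by (auto simp: meas intro!: x.integrable_const_bound[of _ "(real k)\<^sup>2"])
    have gL2: "g \<in> L2 \<mu>"
      unfolding L2_def using g gsq
      by (auto simp: meas intro!: m.integrable_const_bound[of _ "(real k)\<^sup>2"])
    have "0 < a * (\<epsilon> / 4)" using a \<epsilon> by simp
    from tempered_dense[OF temp gL2x this]
    obtain F c where F: "finite F" "F \<subseteq> fin_configs"
      and h: "(\<integral>\<eta>. (g \<eta> - (\<Sum>\<xi>\<in>F. c \<xi> * D \<xi> \<eta>))\<^sup>2 \<partial>?x) < a * (\<epsilon> / 4)" .
    let ?h = "\<lambda>\<eta>. \<Sum>\<xi>\<in>F. c \<xi> * D \<xi> \<eta>"
    have hL2: "?h \<in> L2 \<mu>" using F DL2 by (intro L2_sum L2_cmult) auto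
    have hL2x: "?h \<in> L2 ?x" using F tempered_L2[OF temp] by (intro L2_sum L2_cmult) auto
    have "a * (\<integral>\<eta>. (g \<eta> - ?h \<eta>)\<^sup>2 \<partial>\<mu>) \<le> (\<integral>\<eta>. (g \<eta> - ?h \<eta>)\<^sup>2 \<partial>?x)"
      using L2_diff[OF gL2x hL2x] by (intro le) (simp_all add: L2_def)
    with h have "a * (\<integral>\<eta>. (g \<eta> - ?h \<eta>)\<^sup>2 \<partial>\<mu>) < a * (\<epsilon> / 4)" by linarith
    then have gh: "(\<integral>\<eta>. (g \<eta> - ?h \<eta>)\<^sup>2 \<partial>\<mu>) < \<epsilon> / 4" using a by simp
    have i1: "integrable \<mu> (\<lambda>\<eta>. (f \<eta> - g \<eta>)\<^sup>2)" and i2: "integrable \<mu> (\<lambda>\<eta>. (g \<eta> - ?h \<eta>)\<^sup>2)"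
      and i3: "integrable \<mu> (\<lambda>\<eta>. (f \<eta> - ?h \<eta>)\<^sup>2)"
      using L2_diff[OF f gL2] L2_diff[OF gL2 hL2] L2_diff[OF f hL2] unfolding L2_def by blast+
    have "(\<integral>\<eta>. (f \<eta> - ?h \<eta>)\<^sup>2 \<partial>\<mu>) \<le> (\<integral>\<eta>. 2 * (f \<eta> - g \<eta>)\<^sup>2 + 2 * (g \<eta> - ?h \<eta>)\<^sup>2 \<partial>\<mu>)"
    proof (rule integral_mono)
      fix \<eta>
      have "(u + v)\<^sup>2 \<le> 2 * u\<^sup>2 + 2 * v\<^sup>2" for u v :: real
        using sum_squares_bound[of u v] by (simp add: power2_sum)
      from this[of "f \<eta> - g \<eta>" "g \<eta> - ?h \<eta>"]
      show "(f \<eta> - ?h \<eta>)\<^sup>2 \<le> 2 * (f \<eta> - g \<eta>)\<^sup>2 + 2 * (g \<eta> - ?h \<eta>)\<^sup>2" by simp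
    qed (use i1 i2 i3 in auto)
    also have "\<dots> = 2 * (\<integral>\<eta>. (f \<eta> - g \<eta>)\<^sup>2 \<partial>\<mu>) + 2 * (\<integral>\<eta>. (g \<eta> - ?h \<eta>)\<^sup>2 \<partial>\<mu>)"
      using i1 i2 by simp
    also have "\<dots> < \<epsilon>" using k gh by (simp add: g_def)
    finally show "\<exists>F c. finite F \<and> F \<subseteq> fin_configs \<and> (\<integral>\<eta>. (f \<eta> - (\<Sum>\<xi>\<in>F. c \<xi> * D \<xi> \<eta>))\<^sup>2 \<partial>\<mu>) < \<epsilon>"
      using F by blast
  qed
qed

text \<open>
  Components of a tempered mixture are tempered, so that enlarging the set from which the components
  are taken allows no new decompositions of a tempered measure.
\<close>

lemma extreme_tempered_Int:
  assumes D: "duality_function d D" and M: "\<M> \<subseteq> prob_measures"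
  shows "extreme_measures (tempered_measures D \<inter> \<M>) = tempered_measures D \<inter> extreme_measures \<M>"
proof (rule set_eqI)
  fix \<mu>
  have M': "tempered_measures D \<inter> \<M> \<subseteq> prob_measures" using M by blast
  have comp: "\<mu>\<^sub>1 \<in> tempered_measures D \<and> \<mu>\<^sub>2 \<in> tempered_measures D"
    if "mixture a \<mu>\<^sub>1 \<mu>\<^sub>2 \<in> tempered_measures D" "\<mu>\<^sub>1 \<in> \<M>" "\<mu>\<^sub>2 \<in> \<M>" "0 < a" "a < 1" for a \<mu>\<^sub>1 \<mu>\<^sub>2
  proof -
    have p: "\<mu>\<^sub>1 \<in> prob_measures" "\<mu>\<^sub>2 \<in> prob_measures" using that M by blast+
    have "mixture (1 - a) \<mu>\<^sub>2 \<mu>\<^sub>1 \<in> tempered_measures D"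
      using that(1) unfolding mixture_commute[OF p that(4,5)] .
    then show ?thesis
      using tempered_mixture_component[OF D p that(4,5,1)]
        tempered_mixture_component[OF D p(2,1), of "1 - a"] that(4,5) by simp
  qed
  show "\<mu> \<in> extreme_measures (tempered_measures D \<inter> \<M>) \<longleftrightarrow> \<mu> \<in> tempered_measures D \<inter> extreme_measures \<M>"
  proof
    assume ext: "\<mu> \<in> extreme_measures (tempered_measures D \<inter> \<M>)"
    then have in1: "\<mu> \<in> tempered_measures D" "\<mu> \<in> \<M>"
      unfolding extreme_iff_mixture[OF M'] by blast+
    have "\<mu> \<in> extreme_measures \<M>"
      unfolding extreme_iff_mixture[OF M]
    proof (intro conjI ballI allI impI in1)
      fix \<mu>\<^sub>1 \<mu>\<^sub>2 and a :: real
      assume *: "\<mu>\<^sub>1 \<in> \<M>" "\<mu>\<^sub>2 \<in> \<M>" "0 < a" "a < 1" "\<mu> = mixture a \<mu>\<^sub>1 \<mu>\<^sub>2"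
      with in1 comp[of a \<mu>\<^sub>1 \<mu>\<^sub>2] have "\<mu>\<^sub>1 \<in> tempered_measures D \<inter> \<M>" "\<mu>\<^sub>2 \<in> tempered_measures D \<inter> \<M>" by auto
      from ext[unfolded extreme_iff_mixture[OF M'], THEN conjunct2, rule_format, OF this *(3,4,5)]
      show "\<mu>\<^sub>1 = \<mu>\<^sub>2" .
    qed
    with in1 show "\<mu> \<in> tempered_measures D \<inter> extreme_measures \<M>" by simp
  next
    assume "\<mu> \<in> tempered_measures D \<inter> extreme_measures \<M>"
    then have t: "\<mu> \<in> tempered_measures D" and ext: "\<mu> \<in> extreme_measures \<M>" by (rule IntD1, rule IntD2)
    show "\<mu> \<in> extreme_measures (tempered_measures D \<inter> \<M>)"
      unfolding extreme_iff_mixture[OF M']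
    proof (intro conjI ballI allI impI IntI t)
      show "\<mu> \<in> \<M>" by (rule ext[unfolded extreme_iff_mixture[OF M], THEN conjunct1])
      fix \<mu>\<^sub>1 \<mu>\<^sub>2 and a :: real
      assume *: "\<mu>\<^sub>1 \<in> tempered_measures D \<inter> \<M>" "\<mu>\<^sub>2 \<in> tempered_measures D \<inter> \<M>"
        "0 < a" "a < 1" "\<mu> = mixture a \<mu>\<^sub>1 \<mu>\<^sub>2"
      show "\<mu>\<^sub>1 = \<mu>\<^sub>2"
        by (rule ext[unfolded extreme_iff_mixture[OF M], THEN conjunct2, rule_format,
              OF IntD2[OF *(1)] IntD2[OF *(2)] *(3,4,5)])
    qed
  qed
qed

section \<open>Cauchy sequences of square-integrable functions\<close>

lemma L2_Cauchy_Schwarz: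
  assumes f: "f \<in> L2 M" and g: "g \<in> L2 M"
  shows "(\<integral>x. f x * g x \<partial>M)\<^sup>2 \<le> (\<integral>x. (f x)\<^sup>2 \<partial>M) * (\<integral>x. (g x)\<^sup>2 \<partial>M)"
proof -
  have [measurable]: "f \<in> borel_measurable M" "g \<in> borel_measurable M"
    and int: "integrable M (\<lambda>x. (f x)\<^sup>2)" "integrable M (\<lambda>x. (g x)\<^sup>2)"
    using f g unfolding L2_def by blast+
  have fg: "integrable M (\<lambda>x. \<bar>f x\<bar> * \<bar>g x\<bar>)"
    using integrable_mult_L2[OF f g, THEN integrable_abs] by (simp add: abs_mult)
  have "ennreal ((\<integral>x. \<bar>f x\<bar> * \<bar>g x\<bar> \<partial>M)\<^sup>2) = (\<integral>\<^sup>+x. ennreal \<bar>f x\<bar> * ennreal \<bar>g x\<bar> \<partial>M)\<^sup>2"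
    using nn_integral_eq_integral[OF fg] by (simp add: ennreal_mult flip: ennreal_power)
  also have "\<dots> \<le> (\<integral>\<^sup>+x. (ennreal \<bar>f x\<bar>)\<^sup>2 \<partial>M) * (\<integral>\<^sup>+x. (ennreal \<bar>g x\<bar>)\<^sup>2 \<partial>M)"
    by (rule Cauchy_Schwarz_nn_integral) measurable
  also have "\<dots> = ennreal ((\<integral>x. (f x)\<^sup>2 \<partial>M) * (\<integral>x. (g x)\<^sup>2 \<partial>M))"
    using int by (simp add: ennreal_power nn_integral_eq_integral ennreal_mult)
  finally have "(\<integral>x. \<bar>f x\<bar> * \<bar>g x\<bar> \<partial>M)\<^sup>2 \<le> (\<integral>x. (f x)\<^sup>2 \<partial>M) * (\<integral>x. (g x)\<^sup>2 \<partial>M)"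
    by (subst (asm) ennreal_le_iff) (auto intro!: mult_nonneg_nonneg)
  moreover have "\<bar>\<integral>x. f x * g x \<partial>M\<bar> \<le> (\<integral>x. \<bar>f x\<bar> * \<bar>g x\<bar> \<partial>M)"
    using integral_abs_bound[of M "\<lambda>x. f x * g x"] by (simp add: abs_mult)
  ultimately show ?thesis
    using power_mono[of "\<bar>\<integral>x. f x * g x \<partial>M\<bar>" "\<integral>x. \<bar>f x\<bar> * \<bar>g x\<bar> \<partial>M" 2] by simp
qed

lemma (in prob_space) L1_le_L2:
  assumes f: "f \<in> L2 M"
  shows "(\<integral>x. \<bar>f x\<bar> \<partial>M)\<^sup>2 \<le> (\<integral>x. (f x)\<^sup>2 \<partial>M)"
proof -
  have "(\<lambda>x. \<bar>f x\<bar>) \<in> L2 M" using f unfolding L2_def by auto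
  from L2_Cauchy_Schwarz[OF this L2_const[of 1]] show ?thesis by (simp add: prob_space)
qed

text \<open>
  A Cauchy sequence in \<open>L\<^sup>2\<close> is Cauchy in \<open>L\<^sup>1\<close> and has an almost everywhere convergent subsequence; by
  the lemma of Fatou its limit is also the limit in \<open>L\<^sup>2\<close>.
\<close>

lemma (in prob_space) L2_complete:
  fixes A :: "nat \<Rightarrow> 'a \<Rightarrow> real"
  assumes A: "\<And>n. A n \<in> L2 M"
    and Cauchy: "\<And>e. e > 0 \<Longrightarrow> \<exists>N. \<forall>m\<ge>N. \<forall>n\<ge>N. (\<integral>x. (A m x - A n x)\<^sup>2 \<partial>M) < e"
  obtains h where "h \<in> L2 M" "(\<lambda>n. \<integral>x. (A n x - h x)\<^sup>2 \<partial>M) \<longlonglongrightarrow> 0"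
proof -
  have [measurable]: "A n \<in> borel_measurable M" for n using A[of n] unfolding L2_def by blast
  have int: "integrable M (A n)" for n by (rule L2_integrable[OF A])
  have "\<exists>N. \<forall>i\<ge>N. \<forall>j\<ge>N. (\<integral>x. norm (A i x - A j x) \<partial>M) < e" if e: "e > 0" for e :: real
  proof -
    obtain N where N: "\<And>m n. m \<ge> N \<Longrightarrow> n \<ge> N \<Longrightarrow> (\<integral>x. (A m x - A n x)\<^sup>2 \<partial>M) < e\<^sup>2"
      using Cauchy[of "e\<^sup>2"] e by auto
    have "(\<integral>x. norm (A i x - A j x) \<partial>M) < e" if "i \<ge> N" "j \<ge> N" for i j
    proof (rule power2_less_imp_less)
      show "(\<integral>x. norm (A i x - A j x) \<partial>M)\<^sup>2 < e\<^sup>2"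
        using L1_le_L2[OF L2_diff[OF A A], of i j] N[OF that] by simp
    qed (use e in simp)
    then show ?thesis by blast
  qed
  from cauchy_L1_AE_cauchy_subseq[OF int this]
  obtain r where r: "strict_mono r" and ae: "AE x in M. Cauchy (\<lambda>i. A (r i) x)" .
  define h where "h x = lim (\<lambda>i. A (r i) x)" for x
  have [measurable]: "h \<in> borel_measurable M" unfolding h_def by measurable
  have lim: "AE x in M. (\<lambda>i. A (r i) x) \<longlonglongrightarrow> h x"
    using ae by eventually_elim (simp add: h_def Cauchy_convergent_iff convergent_LIMSEQ_iff)
  have close: "(\<integral>\<^sup>+x. ennreal ((A n x - h x)\<^sup>2) \<partial>M) \<le> ennreal e"
    if N: "\<forall>m\<ge>N. \<forall>n\<ge>N. (\<integral>x. (A m x - A n x)\<^sup>2 \<partial>M) < e" and n: "n \<ge> N" for e n N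
  proof -
    have "(\<integral>\<^sup>+x. ennreal ((A n x - h x)\<^sup>2) \<partial>M) = (\<integral>\<^sup>+x. liminf (\<lambda>i. ennreal ((A n x - A (r i) x)\<^sup>2)) \<partial>M)"
    proof (rule nn_integral_cong_AE)
      show "AE x in M. ennreal ((A n x - h x)\<^sup>2) = liminf (\<lambda>i. ennreal ((A n x - A (r i) x)\<^sup>2))"
        using lim
      proof eventually_elim
        fix x assume "(\<lambda>i. A (r i) x) \<longlonglongrightarrow> h x"
        then have "(\<lambda>i. ennreal ((A n x - A (r i) x)\<^sup>2)) \<longlonglongrightarrow> ennreal ((A n x - h x)\<^sup>2)"
          by (intro tendsto_intros)
        then show "ennreal ((A n x - h x)\<^sup>2) = liminf (\<lambda>i. ennreal ((A n x - A (r i) x)\<^sup>2))"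
          by (rule lim_imp_Liminf[OF sequentially_bot, symmetric])
      qed
    qed
    also have "\<dots> \<le> liminf (\<lambda>i. \<integral>\<^sup>+x. ennreal ((A n x - A (r i) x)\<^sup>2) \<partial>M)"
      by (rule nn_integral_liminf) measurable
    also have "\<dots> \<le> ennreal e"
    proof (rule Liminf_le[OF sequentially_bot])
      show "\<forall>\<^sub>F i in sequentially. (\<integral>\<^sup>+x. ennreal ((A n x - A (r i) x)\<^sup>2) \<partial>M) \<le> ennreal e"
      proof (rule eventually_sequentiallyI[of N])
        fix i assume "N \<le> i"
        then have ri: "N \<le> r i" using seq_suble[OF r, of i] by linarith
        have "integrable M (\<lambda>x. (A n x - A (r i) x)\<^sup>2)"
          using L2_diff[OF A A, of n "r i"] unfolding L2_def by blast
        then show "(\<integral>\<^sup>+x. ennreal ((A n x - A (r i) x)\<^sup>2) \<partial>M) \<le> ennreal e"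
          using N[rule_format, OF n ri] by (subst nn_integral_eq_integral) (auto intro!: ennreal_leI)
      qed
    qed
    finally show ?thesis .
  qed
  have hL2: "h \<in> L2 M"
  proof -
    obtain N where N: "\<forall>m\<ge>N. \<forall>n\<ge>N. (\<integral>x. (A m x - A n x)\<^sup>2 \<partial>M) < 1"
      using Cauchy[of 1] by auto
    have "(\<integral>\<^sup>+x. ennreal ((A N x - h x)\<^sup>2) \<partial>M) < \<infinity>"
      using close[OF N order_refl] by (auto simp: order.strict_trans1)
    then have "(\<lambda>x. A N x - h x) \<in> L2 M"
      unfolding L2_def mem_Collect_eq by (intro conjI integrableI_bounded) simp_all
    from L2_diff[OF A[of N] this] show ?thesis by simp
  qed
  have "(\<lambda>n. \<integral>x. (A n x - h x)\<^sup>2 \<partial>M) \<longlonglongrightarrow> 0"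
  proof (rule LIMSEQ_I)
    fix e :: real assume e: "e > 0"
    obtain N where N: "\<forall>m\<ge>N. \<forall>n\<ge>N. (\<integral>x. (A m x - A n x)\<^sup>2 \<partial>M) < e / 2"
      using Cauchy[of "e / 2"] e by auto
    have "norm ((\<integral>x. (A n x - h x)\<^sup>2 \<partial>M) - 0) < e" if "n \<ge> N" for n
    proof -
      have i: "integrable M (\<lambda>x. (A n x - h x)\<^sup>2)"
        using L2_diff[OF A hL2, of n] unfolding L2_def by blast
      have "ennreal (\<integral>x. (A n x - h x)\<^sup>2 \<partial>M) \<le> ennreal (e / 2)"
        using close[OF N that] nn_integral_eq_integral[OF i] by simp
      then have "(\<integral>x. (A n x - h x)\<^sup>2 \<partial>M) \<le> e / 2" using e by (subst (asm) ennreal_le_iff) auto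
      then show ?thesis using e by simp
    qed
    then show "\<exists>no. \<forall>n\<ge>no. norm ((\<integral>x. (A n x - h x)\<^sup>2 \<partial>M) - 0) < e" by blast
  qed
  with hL2 show ?thesis by (rule that)
qed

section \<open>Correlations in time and the dual process\<close>

lemma countable_fin_configs: "countable (fin_configs :: ('g::countable) config set)"
proof -
  define graph where "graph \<xi> = {(x, \<xi> x) | x. x \<in> supp \<xi>}" for \<xi> :: "'g config"
  have "inj_on graph fin_configs"
  proof (rule inj_onI)
    fix \<xi> \<zeta> :: "'g config" assume eq: "graph \<xi> = graph \<zeta>"
    show "\<xi> = \<zeta>"
    proof
      fix x
      have "(x, k) \<in> graph \<xi> \<longleftrightarrow> (x, k) \<in> graph \<zeta>" for k using eq by simp
      then have "k \<noteq> 0 \<and> \<xi> x = k \<longleftrightarrow> k \<noteq> 0 \<and> \<zeta> x = k" for k by (auto simp: graph_def supp_def)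
      then show "\<xi> x = \<zeta> x" by metis
    qed
  qed
  moreover have "graph ` fin_configs \<subseteq> Collect finite"
    by (auto simp: graph_def fin_configs_iff)
  ultimately show ?thesis
    using countable_Collect_finite countable_image_inj_on countable_subset by metis
qed

locale dual_process_pair = config_process E P + duality_function d D
  for E :: "('g::countable) config set" and P and d and D +
  fixes Q :: "'g config \<Rightarrow> (real \<Rightarrow> 'g config) measure"
  assumes dual_markov: "markov_process (count_space fin_configs) Q"
    and duality: "dual_processes E P Q D"
    and dual_conserves: "conserves_particles fin_configs Q"
begin

lemma prob_space_Q: "\<xi> \<in> fin_configs \<Longrightarrow> prob_space (Q \<xi>)"
  and sets_Q: "\<xi> \<in> fin_configs \<Longrightarrow> sets (Q \<xi>) = sets (path_space (count_space fin_configs))"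
proof -
  have "Q \<in> count_space fin_configs \<rightarrow>\<^sub>M prob_algebra (path_space (count_space fin_configs))"
    using dual_markov unfolding markov_process_def by (rule conjunct1)
  note measurable_space[OF this, of \<xi>]
  then show "\<xi> \<in> fin_configs \<Longrightarrow> prob_space (Q \<xi>)"
    "\<xi> \<in> fin_configs \<Longrightarrow> sets (Q \<xi>) = sets (path_space (count_space fin_configs))"
    by (simp_all add: space_prob_algebra)
qed

lemma eval_dual:
  assumes "t \<ge> 0" shows "(\<lambda>\<omega>. \<omega> t) \<in> path_space (count_space fin_configs) \<rightarrow>\<^sub>M count_space fin_configs"
  using assms unfolding path_space_def by (intro measurable_component_singleton) simp

lemma eval_Q:
  assumes "t \<ge> 0" "\<xi> \<in> fin_configs" shows "(\<lambda>\<omega>. \<omega> t) \<in> Q \<xi> \<rightarrow>\<^sub>M count_space fin_configs"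
  using eval_dual[OF assms(1)] measurable_cong_sets[OF sets_Q[OF assms(2)] refl] by blast

lemma eval_Q_measurable:
  assumes "t \<ge> 0" "\<xi> \<in> fin_configs"
  shows "(\<lambda>\<omega>. f (\<omega> t) :: 'b :: topological_space) \<in> borel_measurable (Q \<xi>)"
  by (rule measurable_compose[OF eval_Q[OF assms]]) simp

lemma eval_Q_fin:
  assumes "t \<ge> 0" "\<xi> \<in> fin_configs" "\<omega> \<in> space (Q \<xi>)" shows "\<omega> t \<in> fin_configs"
  using measurable_space[OF eval_Q[OF assms(1,2)] assms(3)] by simp

lemma AE_Q_mass:
  assumes "t \<ge> 0" "\<xi> \<in> fin_configs"
  shows "AE \<omega> in Q \<xi>. \<omega> t \<in> fin_configs \<and> mass (\<omega> t) = mass \<xi>"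
proof -
  have "AE \<omega> in Q \<xi>. particles (\<omega> t) = particles \<xi>"
    using dual_conserves assms unfolding conserves_particles_def by blast
  moreover have "AE \<omega> in Q \<xi>. \<omega> t \<in> fin_configs" by (rule AE_I2) (rule eval_Q_fin[OF assms])
  ultimately show ?thesis
    by eventually_elim (simp add: particles_eq_mass assms)
qed

definition corr :: "'g config measure \<Rightarrow> 'g config \<Rightarrow> 'g config \<Rightarrow> real" where
  "corr \<mu> \<xi> \<zeta> = (\<integral>\<eta>. D \<xi> \<eta> * D \<zeta> \<eta> \<partial>\<mu>)"

lemma D_empty [simp]: "D (\<lambda>_. 0) \<eta> = 1"
  by (simp add: D_eq_prod[of "{}"] supp_def)

lemma empty_fin [simp]: "(\<lambda>_. 0) \<in> fin_configs"
  by (simp add: fin_configs_iff supp_def)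

context
  fixes \<mu> :: "'g config measure"
  assumes inv: "\<mu> \<in> invariant_measures E P" and temp: "\<mu> \<in> tempered_measures D"
begin

lemmas law = invariant_imp_laws[OF inv]

text \<open>
  Duality is applied for a fixed starting point \<open>\<eta>\<close>, and then the two expectations are exchanged. Joint
  measurability holds because the dual process takes countably many values.
\<close>

lemma nn_integral_two_time_product:
  assumes \<xi>: "\<xi> \<in> fin_configs" and \<zeta>: "\<zeta> \<in> fin_configs" and t: "t \<ge> 0"
  shows "(\<integral>\<^sup>+z. ennreal (D \<xi> (fst z) * D \<zeta> (snd z)) \<partial>two_time_law \<mu> t) =
         (\<integral>\<^sup>+\<omega>. (\<integral>\<^sup>+\<eta>. ennreal (D \<xi> \<eta> * D (\<omega> t) \<eta>) \<partial>\<mu>) \<partial>Q \<zeta>)"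
proof -
  interpret m: prob_space \<mu> by (rule law_prob[OF law])
  interpret q: prob_space "Q \<zeta>" by (rule prob_space_Q[OF \<zeta>])
  interpret pair_sigma_finite "Q \<zeta>" \<mu> ..
  note [measurable] = D_measurable[OF \<xi>] D_measurable[OF \<zeta>]
  have joint: "(\<lambda>(\<omega>, \<eta>). ennreal (D \<xi> \<eta> * D (\<omega> t) \<eta>)) \<in> borel_measurable (Q \<zeta> \<Otimes>\<^sub>M \<mu>)"
  proof -
    have "(\<lambda>z. ennreal (D \<xi> (snd z) * D (fst z t) (snd z))) \<in> borel_measurable (Q \<zeta> \<Otimes>\<^sub>M \<mu>)"
    proof (rule measurable_compose_countable'[where g = "\<lambda>z. fst z t" and I = fin_configs and
          f = "\<lambda>\<kappa> z. ennreal (D \<xi> (snd z) * D \<kappa> (snd z))"])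
      show "(\<lambda>z. fst z t) \<in> Q \<zeta> \<Otimes>\<^sub>M \<mu> \<rightarrow>\<^sub>M count_space fin_configs"
        by (rule measurable_compose[OF measurable_fst eval_Q[OF t \<zeta>]])
      fix \<kappa> :: "'g config" assume "\<kappa> \<in> fin_configs"
      note k = D_measurable[OF this]
      have "(\<lambda>\<eta>. ennreal (D \<xi> \<eta> * D \<kappa> \<eta>)) \<in> borel_measurable \<mu>"
        unfolding measurable_law[OF law] using k by measurable
      from measurable_compose[OF measurable_snd this]
      show "(\<lambda>z. ennreal (D \<xi> (snd z) * D \<kappa> (snd z))) \<in> borel_measurable (Q \<zeta> \<Otimes>\<^sub>M \<mu>)" .
    qed (rule countable_fin_configs)
    then show ?thesis by (simp add: case_prod_beta')
  qed
  have "(\<integral>\<^sup>+z. ennreal (D \<xi> (fst z) * D \<zeta> (snd z)) \<partial>two_time_law \<mu> t) =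
      (\<integral>\<^sup>+\<eta>\<in>E. (\<integral>\<^sup>+\<omega>. ennreal (D \<xi> \<eta> * D \<zeta> (\<omega> t)) \<partial>P \<eta>) \<partial>\<mu>)"
    by (subst nn_integral_two_time_law[OF law t]) simp_all
  also have "\<dots> = (\<integral>\<^sup>+\<eta>. (\<integral>\<^sup>+\<omega>. ennreal (D \<xi> \<eta> * D (\<omega> t) \<eta>) \<partial>Q \<zeta>) \<partial>\<mu>)"
  proof (rule nn_integral_cong_AE)
    show "AE \<eta> in \<mu>. (\<integral>\<^sup>+\<omega>. ennreal (D \<xi> \<eta> * D \<zeta> (\<omega> t)) \<partial>P \<eta>) * indicator E \<eta> =
        (\<integral>\<^sup>+\<omega>. ennreal (D \<xi> \<eta> * D (\<omega> t) \<eta>) \<partial>Q \<zeta>)"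
      using law_E[OF law]
    proof eventually_elim
      fix \<eta> assume \<eta>: "\<eta> \<in> E"
      note [measurable] = eval_P[OF t \<eta>]
      have "(\<integral>\<^sup>+\<omega>. ennreal (D \<xi> \<eta> * D \<zeta> (\<omega> t)) \<partial>P \<eta>) = ennreal (D \<xi> \<eta>) * (\<integral>\<^sup>+\<omega>. ennreal (D \<zeta> (\<omega> t)) \<partial>P \<eta>)"
        using D_nonneg[OF \<xi>, of \<eta>] by (simp add: ennreal_mult' nn_integral_cmult)
      also have "(\<integral>\<^sup>+\<omega>. ennreal (D \<zeta> (\<omega> t)) \<partial>P \<eta>) = (\<integral>\<^sup>+\<omega>. ennreal (D (\<omega> t) \<eta>) \<partial>Q \<zeta>)"
        using duality \<zeta> \<eta> t unfolding dual_processes_def by blast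
      also have "ennreal (D \<xi> \<eta>) * \<dots> = (\<integral>\<^sup>+\<omega>. ennreal (D \<xi> \<eta>) * ennreal (D (\<omega> t) \<eta>) \<partial>Q \<zeta>)"
        by (rule nn_integral_cmult[symmetric])
          (rule measurable_compose[OF eval_Q[OF t \<zeta>]], simp)
      also have "\<dots> = (\<integral>\<^sup>+\<omega>. ennreal (D \<xi> \<eta> * D (\<omega> t) \<eta>) \<partial>Q \<zeta>)"
        using D_nonneg[OF \<xi>, of \<eta>] by (simp add: ennreal_mult')
      finally show "(\<integral>\<^sup>+\<omega>. ennreal (D \<xi> \<eta> * D \<zeta> (\<omega> t)) \<partial>P \<eta>) * indicator E \<eta> =
        (\<integral>\<^sup>+\<omega>. ennreal (D \<xi> \<eta> * D (\<omega> t) \<eta>) \<partial>Q \<zeta>)" using \<eta> by simp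
    qed
  qed
  also have "\<dots> = (\<integral>\<^sup>+\<omega>. (\<integral>\<^sup>+\<eta>. ennreal (D \<xi> \<eta> * D (\<omega> t) \<eta>) \<partial>\<mu>) \<partial>Q \<zeta>)"
    using Fubini[OF joint] by simp
  finally show ?thesis .
qed

lemma corr_integrable:
  "\<xi> \<in> fin_configs \<Longrightarrow> \<zeta> \<in> fin_configs \<Longrightarrow> integrable \<mu> (\<lambda>\<eta>. D \<xi> \<eta> * D \<zeta> \<eta>)"
  by (intro integrable_mult_L2 tempered_L2[OF temp])

lemma corr_nonneg: "\<xi> \<in> fin_configs \<Longrightarrow> \<zeta> \<in> fin_configs \<Longrightarrow> 0 \<le> corr \<mu> \<xi> \<zeta>"
  unfolding corr_def by (intro integral_nonneg_AE AE_I2 mult_nonneg_nonneg D_nonneg)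

lemma corr_empty: "corr \<mu> (\<lambda>_. 0) \<zeta> = D_transform D \<mu> \<zeta>"
  by (simp add: corr_def D_transform_def)

lemma corr_perp:
  assumes "\<xi> \<in> fin_configs" "\<zeta> \<in> fin_configs" "perp \<xi> \<zeta>"
  shows "corr \<mu> \<xi> \<zeta> = D_transform D \<mu> (\<lambda>x. \<xi> x + \<zeta> x)"
  by (simp add: corr_def D_transform_def D_add_perp[OF assms])

lemma corr_bounded:
  "\<exists>B\<ge>0. \<forall>\<xi>\<in>fin_configs. \<forall>\<zeta>\<in>fin_configs. mass \<xi> \<le> n \<longrightarrow> mass \<zeta> \<le> n \<longrightarrow> corr \<mu> \<xi> \<zeta> \<le> B"
proof -
  obtain B where B: "B \<ge> 0" "\<And>\<zeta>. \<zeta> \<in> fin_configs \<Longrightarrow> mass \<zeta> \<le> n \<Longrightarrow> (\<integral>\<eta>. (D \<zeta> \<eta>)\<^sup>2 \<partial>\<mu>) \<le> B"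
    using tempered_second_moments[OF temp, of n] by blast
  have "corr \<mu> \<xi> \<zeta> \<le> B"
    if "\<xi> \<in> fin_configs" "\<zeta> \<in> fin_configs" "mass \<xi> \<le> n" "mass \<zeta> \<le> n" for \<xi> \<zeta>
  proof (rule power2_le_imp_le)
    have "(corr \<mu> \<xi> \<zeta>)\<^sup>2 \<le> (\<integral>\<eta>. (D \<xi> \<eta>)\<^sup>2 \<partial>\<mu>) * (\<integral>\<eta>. (D \<zeta> \<eta>)\<^sup>2 \<partial>\<mu>)"
      unfolding corr_def by (intro L2_Cauchy_Schwarz tempered_L2[OF temp] that)
    also have "\<dots> \<le> B * B" using that B by (intro mult_mono) simp_all
    finally show "(corr \<mu> \<xi> \<zeta>)\<^sup>2 \<le> B\<^sup>2" by (simp add: power2_eq_square)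
  qed (rule B(1))
  with B(1) show ?thesis by blast
qed

lemma integrable_corr_Q:
  assumes \<xi>: "\<xi> \<in> fin_configs" and \<zeta>: "\<zeta> \<in> fin_configs" and t: "t \<ge> 0"
  shows "integrable (Q \<zeta>) (\<lambda>\<omega>. corr \<mu> \<xi> (\<omega> t))"
proof -
  interpret q: prob_space "Q \<zeta>" by (rule prob_space_Q[OF \<zeta>])
  obtain B where B: "\<And>\<xi>' \<zeta>'. \<xi>' \<in> fin_configs \<Longrightarrow> \<zeta>' \<in> fin_configs \<Longrightarrow> mass \<xi>' \<le> max (mass \<xi>) (mass \<zeta>) \<Longrightarrow>
      mass \<zeta>' \<le> max (mass \<xi>) (mass \<zeta>) \<Longrightarrow> corr \<mu> \<xi>' \<zeta>' \<le> B"
    using corr_bounded[of "max (mass \<xi>) (mass \<zeta>)"] by blast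
  show ?thesis
  proof (rule q.integrable_const_bound)
    show "AE \<omega> in Q \<zeta>. norm (corr \<mu> \<xi> (\<omega> t)) \<le> B"
      using AE_Q_mass[OF t \<zeta>]
      by eventually_elim (use B corr_nonneg \<xi> in simp)
  qed (rule eval_Q_measurable[OF t \<zeta>])
qed

lemma integral_two_time_product:
  assumes \<xi>: "\<xi> \<in> fin_configs" and \<zeta>: "\<zeta> \<in> fin_configs" and t: "t \<ge> 0"
  shows "(\<integral>z. D \<xi> (fst z) * D \<zeta> (snd z) \<partial>two_time_law \<mu> t) = (\<integral>\<omega>. corr \<mu> \<xi> (\<omega> t) \<partial>Q \<zeta>)"
proof -
  let ?W = "two_time_law \<mu>"
  have "(\<integral>\<^sup>+z. ennreal (D \<xi> (fst z) * D \<zeta> (snd z)) \<partial>?W t) = (\<integral>\<^sup>+\<omega>. ennreal (corr \<mu> \<xi> (\<omega> t)) \<partial>Q \<zeta>)"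
    unfolding nn_integral_two_time_product[OF \<xi> \<zeta> t]
  proof (rule nn_integral_cong)
    fix \<omega> assume "\<omega> \<in> space (Q \<zeta>)"
    then have \<omega>: "\<omega> t \<in> fin_configs" by (rule eval_Q_fin[OF t \<zeta>])
    show "(\<integral>\<^sup>+\<eta>. ennreal (D \<xi> \<eta> * D (\<omega> t) \<eta>) \<partial>\<mu>) = ennreal (corr \<mu> \<xi> (\<omega> t))"
      unfolding corr_def
      by (rule nn_integral_eq_integral[OF corr_integrable[OF \<xi> \<omega>]])
        (intro AE_I2 mult_nonneg_nonneg D_nonneg \<xi> \<omega>)
  qed
  also have "\<dots> = ennreal (\<integral>\<omega>. corr \<mu> \<xi> (\<omega> t) \<partial>Q \<zeta>)"
    by (rule nn_integral_eq_integral[OF integrable_corr_Q[OF \<xi> \<zeta> t]])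
      (intro AE_I2 corr_nonneg \<xi> eval_Q_fin[OF t \<zeta>])
  finally have "(\<integral>\<^sup>+z. ennreal (D \<xi> (fst z) * D \<zeta> (snd z)) \<partial>?W t) = \<dots>" .
  moreover have "(\<integral>\<^sup>+z. ennreal (D \<xi> (fst z) * D \<zeta> (snd z)) \<partial>?W t) =
      ennreal (\<integral>z. D \<xi> (fst z) * D \<zeta> (snd z) \<partial>?W t)"
    by (rule nn_integral_eq_integral)
      (intro integrable_mult_L2 L2_fst[OF inv t] L2_snd[OF inv t] tempered_L2[OF temp] AE_I2
          mult_nonneg_nonneg D_nonneg \<xi> \<zeta>)+
  moreover have "0 \<le> (\<integral>z. D \<xi> (fst z) * D \<zeta> (snd z) \<partial>?W t)"
    by (intro integral_nonneg_AE AE_I2 mult_nonneg_nonneg D_nonneg \<xi> \<zeta>)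
  moreover have "0 \<le> (\<integral>\<omega>. corr \<mu> \<xi> (\<omega> t) \<partial>Q \<zeta>)"
    by (intro integral_nonneg_AE AE_I2 corr_nonneg \<xi> eval_Q_fin[OF t \<zeta>])
  ultimately show ?thesis by (simp add: ennreal_inj)
qed

text \<open>
  The case \<open>\<xi> = \<emptyset>\<close> of the correlation formula.
\<close>

lemma D_transform_harmonic:
  assumes \<zeta>: "\<zeta> \<in> fin_configs" and t: "t \<ge> 0"
  shows "(\<integral>\<omega>. D_transform D \<mu> (\<omega> t) \<partial>Q \<zeta>) = D_transform D \<mu> \<zeta>"
  using integral_two_time_product[OF empty_fin \<zeta> t] integral_snd[OF inv t D_measurable[OF \<zeta>]]
  by (simp add: corr_empty D_transform_def)

end

end

section \<open>Invariant product measures are ergodic\<close>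

context duality_function
begin

lemma D_transform_nonneg: "\<xi> \<in> fin_configs \<Longrightarrow> 0 \<le> D_transform D \<mu> \<xi>"
  unfolding D_transform_def by (intro integral_nonneg_AE AE_I2 D_nonneg)

lemma D_transform_eq_nn_integral:
  assumes "sets \<mu> = sets config_space" "\<xi> \<in> fin_configs"
  shows "D_transform D \<mu> \<xi> = enn2real (\<integral>\<^sup>+\<eta>. ennreal (D \<xi> \<eta>) \<partial>\<mu>)"
  unfolding D_transform_def using assms
  by (intro integral_eq_nn_integral)
    (simp_all add: D_nonneg D_measurable measurable_cong_sets[OF assms(1) refl])

end

locale site_product = duality_function d D
  for d and D :: "'g config \<Rightarrow> 'g config \<Rightarrow> real" +
  fixes m :: "'g \<Rightarrow> nat measure"
  assumes prob_site: "\<And>x. prob_space (m x)"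
    and sets_site: "\<And>x. sets (m x) = sets (count_space UNIV)"
begin

abbreviation "\<pi> \<equiv> PiM UNIV m"

lemma sets_product: "sets \<pi> = sets config_space"
  unfolding config_space_def by (rule sets_PiM_cong[OF refl sets_site])

lemma product_in_prob_measures: "\<pi> \<in> prob_measures"
  by (simp add: prob_measures_def sets_product prob_space_PiM prob_site)

lemma nn_integral_D_product:
  assumes A: "finite A" "supp \<xi> \<subseteq> A"
  shows "(\<integral>\<^sup>+\<eta>. ennreal (D \<xi> \<eta>) \<partial>\<pi>) = (\<Prod>x\<in>A. \<integral>\<^sup>+n. ennreal (d (\<xi> x) n) \<partial>m x)"
proof -
  interpret product_prob_space m UNIV
    by (simp add: product_prob_space_def product_prob_space_axioms_def product_sigma_finite_def
        prob_site prob_space_imp_sigma_finite)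
  have site: "(\<lambda>n. ennreal (d (\<xi> x) n)) \<in> borel_measurable (m x)" for x
    by (simp add: measurable_cong_sets[OF sets_site refl])
  have "(\<integral>\<^sup>+\<eta>. ennreal (D \<xi> \<eta>) \<partial>\<pi>) = (\<integral>\<^sup>+\<eta>. (\<Prod>x\<in>A. ennreal (d (\<xi> x) (restrict \<eta> A x))) \<partial>\<pi>)"
    by (intro nn_integral_cong) (simp add: D_eq_prod[OF A] prod_ennreal)
  also have "\<dots> = (\<integral>\<^sup>+\<eta>. (\<Prod>x\<in>A. ennreal (d (\<xi> x) (\<eta> x))) \<partial>distr \<pi> (PiM A m) (\<lambda>\<eta>. restrict \<eta> A))"
  proof (rule nn_integral_distr[symmetric])
    show "(\<lambda>\<eta>. \<Prod>x\<in>A. ennreal (d (\<xi> x) (\<eta> x))) \<in> borel_measurable (distr \<pi> (PiM A m) (\<lambda>\<eta>. restrict \<eta> A))"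
      unfolding measurable_distr_eq1
    proof (rule borel_measurable_prod_ennreal)
      fix x assume "x \<in> A"
      then show "(\<lambda>\<eta>. ennreal (d (\<xi> x) (\<eta> x))) \<in> borel_measurable (PiM A m)"
        by (rule measurable_compose[OF measurable_component_singleton[of x A m] site[of x]])
    qed
  qed (rule measurable_restrict_subset, simp)
  also have "distr \<pi> (PiM A m) (\<lambda>\<eta>. restrict \<eta> A) = PiM A m"
    by (rule distr_PiM_restrict_finite) (use A in auto)
  also have "(\<integral>\<^sup>+\<eta>. (\<Prod>x\<in>A. ennreal (d (\<xi> x) (\<eta> x))) \<partial>PiM A m) = (\<Prod>x\<in>A. \<integral>\<^sup>+n. ennreal (d (\<xi> x) n) \<partial>m x)"
    by (rule product_nn_integral_prod[OF A(1) site])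
  finally show ?thesis .
qed

lemma D_transform_product_perp:
  assumes \<xi>: "\<xi> \<in> fin_configs" and \<zeta>: "\<zeta> \<in> fin_configs" and perp: "perp \<xi> \<zeta>"
  shows "D_transform D \<pi> (\<lambda>x. \<xi> x + \<zeta> x) = D_transform D \<pi> \<xi> * D_transform D \<pi> \<zeta>"
proof -
  note fin = \<xi>[unfolded fin_configs_iff] \<zeta>[unfolded fin_configs_iff]
  have "(\<integral>\<^sup>+\<eta>. ennreal (D (\<lambda>x. \<xi> x + \<zeta> x) \<eta>) \<partial>\<pi>) =
      (\<Prod>x\<in>supp \<xi> \<union> supp \<zeta>. \<integral>\<^sup>+n. ennreal (d (\<xi> x + \<zeta> x) n) \<partial>m x)"
    by (rule nn_integral_D_product) (use fin in \<open>auto simp: supp_def\<close>)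
  also have "\<dots> = (\<Prod>x\<in>supp \<xi>. \<integral>\<^sup>+n. ennreal (d (\<xi> x + \<zeta> x) n) \<partial>m x) *
      (\<Prod>x\<in>supp \<zeta>. \<integral>\<^sup>+n. ennreal (d (\<xi> x + \<zeta> x) n) \<partial>m x)"
    using fin perp unfolding perp_def by (rule prod.union_disjoint)
  also have "(\<Prod>x\<in>supp \<xi>. \<integral>\<^sup>+n. ennreal (d (\<xi> x + \<zeta> x) n) \<partial>m x) = (\<integral>\<^sup>+\<eta>. ennreal (D \<xi> \<eta>) \<partial>\<pi>)"
    unfolding nn_integral_D_product[OF fin(1) order_refl] using perpD[OF perp] by (intro prod.cong) simp_all
  also have "(\<Prod>x\<in>supp \<zeta>. \<integral>\<^sup>+n. ennreal (d (\<xi> x + \<zeta> x) n) \<partial>m x) = (\<integral>\<^sup>+\<eta>. ennreal (D \<zeta> \<eta>) \<partial>\<pi>)"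
    unfolding nn_integral_D_product[OF fin(2) order_refl]
    using perpD[OF perp[unfolded perp_commute[of \<xi>]]] by (intro prod.cong) simp_all
  finally show ?thesis
    by (simp add: D_transform_eq_nn_integral[OF sets_product] \<xi> \<zeta> fin_configs_add[OF \<xi> \<zeta> perp] enn2real_mult)
qed

end

lemma product_measure_perp:
  assumes "duality_function d D" "\<mu> \<in> product_measures"
    and "\<xi> \<in> fin_configs" "\<zeta> \<in> fin_configs" "perp \<xi> \<zeta>"
  shows "D_transform D \<mu> (\<lambda>x. \<xi> x + \<zeta> x) = D_transform D \<mu> \<xi> * D_transform D \<mu> \<zeta>"
proof -
  obtain m where m: "\<And>x. prob_space (m x) \<and> sets (m x) = sets (count_space (UNIV :: nat set))"
    and \<mu>: "\<mu> = PiM UNIV m"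
    using assms(2) unfolding product_measures_def mem_Collect_eq by blast
  interpret site_product d D m
    using assms(1) m by (simp add: site_product_def site_product_axioms_def)
  show ?thesis unfolding \<mu> by (rule D_transform_product_perp[OF assms(3-5)])
qed

lemma product_measures_subset_prob: "product_measures \<subseteq> prob_measures"
proof
  fix \<mu> :: "'g config measure" assume "\<mu> \<in> product_measures"
  then obtain m where m: "\<And>x. prob_space (m x) \<and> sets (m x) = sets (count_space (UNIV :: nat set))"
    and \<mu>: "\<mu> = PiM UNIV m"
    unfolding product_measures_def mem_Collect_eq by blast
  have "sets \<mu> = sets config_space"
    unfolding \<mu> config_space_def using m by (intro sets_PiM_cong) simp_all
  moreover have "prob_space \<mu>" unfolding \<mu> by (rule prob_space_PiM) (simp add: m)
  ultimately show "\<mu> \<in> prob_measures" by (simp add: prob_measures_def)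
qed

context dual_process_pair
begin

lemma duality_function: "duality_function d D" ..

text \<open>
  The correlation of \<open>D \<xi>\<close> and \<open>D \<kappa>\<close> is the product of the transforms as soon as \<open>\<kappa>\<close> is disjoint from
  \<open>\<xi>\<close>, and the transform is harmonic for the dual process. The probability that the dual process still
  meets \<open>\<xi>\<close> tends to \<open>0\<close>, and there the second moments bound the error.
\<close>

lemma product_two_time_tendsto:
  assumes inv: "\<mu> \<in> invariant_measures E P" and temp: "\<mu> \<in> tempered_measures D"
    and prod: "\<mu> \<in> product_measures"
    and \<xi>: "\<xi> \<in> fin_configs" and \<zeta>: "\<zeta> \<in> fin_configs"
    and spread: "((\<lambda>t. measure (Q \<zeta>) {\<omega> \<in> space (Q \<zeta>). perp (\<omega> t) \<xi>}) \<longlongrightarrow> 1) at_top"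
  shows "((\<lambda>t. \<integral>z. D \<xi> (fst z) * D \<zeta> (snd z) \<partial>two_time_law \<mu> t)
     \<longlongrightarrow> D_transform D \<mu> \<xi> * D_transform D \<mu> \<zeta>) at_top"
proof -
  let ?W = "two_time_law \<mu>"
  interpret q: prob_space "Q \<zeta>" by (rule prob_space_Q[OF \<zeta>])
  define n where "n = max (mass \<xi>) (mass \<zeta>)"
  obtain B where B: "B \<ge> 0" "\<And>\<xi> \<zeta>. \<xi> \<in> fin_configs \<Longrightarrow> \<zeta> \<in> fin_configs \<Longrightarrow> mass \<xi> \<le> n \<Longrightarrow> mass \<zeta> \<le> n \<Longrightarrow> corr \<mu> \<xi> \<zeta> \<le> B"
    using corr_bounded[OF inv temp, of n] by blast
  have TB: "D_transform D \<mu> \<kappa> \<le> B" if "\<kappa> \<in> fin_configs" "mass \<kappa> \<le> n" for \<kappa>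
    using B(2)[of "\<lambda>_. 0" \<kappa>] that by (simp add: corr_empty[OF inv temp] mass_def supp_def)
  let ?p = "\<lambda>t. measure (Q \<zeta>) {\<omega> \<in> space (Q \<zeta>). perp (\<omega> t) \<xi>}"
  let ?T = "D_transform D \<mu>"
  have bound: "norm ((\<integral>z. D \<xi> (fst z) * D \<zeta> (snd z) \<partial>?W t) - ?T \<xi> * ?T \<zeta>) \<le> (B + B * B) * (1 - ?p t)"
    if t: "t \<ge> 0" for t
  proof -
    note i1 = integrable_corr_Q[OF inv temp \<xi> \<zeta> t]
    have i2: "integrable (Q \<zeta>) (\<lambda>\<omega>. ?T (\<omega> t))"
      using integrable_corr_Q[OF inv temp empty_fin \<zeta> t] by (simp add: corr_empty[OF inv temp])
    let ?N = "{\<omega> \<in> space (Q \<zeta>). \<not> perp (\<omega> t) \<xi>}"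
    have N: "?N \<in> sets (Q \<zeta>)"
    proof -
      have "(\<lambda>\<omega>. \<omega> t) -` {\<kappa> \<in> fin_configs. \<not> perp \<kappa> \<xi>} \<inter> space (Q \<zeta>) \<in> sets (Q \<zeta>)"
        by (rule measurable_sets[OF eval_Q[OF t \<zeta>]]) auto
      also have "(\<lambda>\<omega>. \<omega> t) -` {\<kappa> \<in> fin_configs. \<not> perp \<kappa> \<xi>} \<inter> space (Q \<zeta>) = ?N"
        using eval_Q_fin[OF t \<zeta>] by auto
      finally show ?thesis .
    qed
    have "(\<integral>z. D \<xi> (fst z) * D \<zeta> (snd z) \<partial>?W t) - ?T \<xi> * ?T \<zeta>
      = (\<integral>\<omega>. corr \<mu> \<xi> (\<omega> t) - ?T \<xi> * ?T (\<omega> t) \<partial>Q \<zeta>)"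
      using i1 i2 by (simp add: integral_two_time_product[OF inv temp \<xi> \<zeta> t] D_transform_harmonic[OF inv temp \<zeta> t])
    also have "norm \<dots> \<le> (\<integral>\<omega>. norm (corr \<mu> \<xi> (\<omega> t) - ?T \<xi> * ?T (\<omega> t)) \<partial>Q \<zeta>)"
      by (rule integral_norm_bound)
    also have "\<dots> \<le> (\<integral>\<omega>. (B + B * B) * indicator ?N \<omega> \<partial>Q \<zeta>)"
    proof (rule integral_mono_AE)
      show "integrable (Q \<zeta>) (\<lambda>\<omega>. norm (corr \<mu> \<xi> (\<omega> t) - ?T \<xi> * ?T (\<omega> t)))"
        using i1 i2 by simp
      show "integrable (Q \<zeta>) (\<lambda>\<omega>. (B + B * B) * indicator ?N \<omega>)"
        using N by (intro integrable_mult_right integrable_real_indicator) (simp_all add: q.emeasure_eq_measure)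
      show "AE \<omega> in Q \<zeta>. norm (corr \<mu> \<xi> (\<omega> t) - ?T \<xi> * ?T (\<omega> t)) \<le> (B + B * B) * indicator ?N \<omega>"
        using AE_Q_mass[OF t \<zeta>] AE_space
      proof eventually_elim
        fix \<omega> assume "\<omega> t \<in> fin_configs \<and> mass (\<omega> t) = mass \<zeta>" and sp: "\<omega> \<in> space (Q \<zeta>)"
        then have \<omega>: "\<omega> t \<in> fin_configs" "mass (\<omega> t) \<le> n" by (simp_all add: n_def)
        have \<xi>n: "mass \<xi> \<le> n" by (simp add: n_def)
        show "norm (corr \<mu> \<xi> (\<omega> t) - ?T \<xi> * ?T (\<omega> t)) \<le> (B + B * B) * indicator ?N \<omega>"
        proof (cases "perp (\<omega> t) \<xi>")
          case True
          then have p: "perp \<xi> (\<omega> t)" by (simp add: perp_commute)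
          have "corr \<mu> \<xi> (\<omega> t) = ?T \<xi> * ?T (\<omega> t)"
            unfolding corr_perp[OF inv temp \<xi> \<omega>(1) p]
            by (rule product_measure_perp[OF duality_function prod \<xi> \<omega>(1) p])
          then show ?thesis using B(1) by simp
        next
          case False
          have "0 \<le> corr \<mu> \<xi> (\<omega> t)" "corr \<mu> \<xi> (\<omega> t) \<le> B"
            by (rule corr_nonneg[OF inv temp \<xi> \<omega>(1)], rule B(2)[OF \<xi> \<omega>(1) \<xi>n \<omega>(2)])
          moreover have "0 \<le> ?T \<xi> * ?T (\<omega> t)"
            by (intro mult_nonneg_nonneg D_transform_nonneg \<xi> \<omega>(1))
          moreover have "?T \<xi> * ?T (\<omega> t) \<le> B * B"
            by (intro mult_mono TB \<xi> \<omega> \<xi>n D_transform_nonneg B(1))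
          ultimately have "\<bar>corr \<mu> \<xi> (\<omega> t) - ?T \<xi> * ?T (\<omega> t)\<bar> \<le> B + B * B" by linarith
          then show ?thesis using False sp by simp
        qed
      qed
    qed
    also have "\<dots> = (B + B * B) * measure (Q \<zeta>) ?N" using N by simp
    also have "measure (Q \<zeta>) ?N = 1 - ?p t"
    proof -
      have "space (Q \<zeta>) - ?N = {\<omega> \<in> space (Q \<zeta>). perp (\<omega> t) \<xi>}" by blast
      with q.prob_compl[OF N] show ?thesis by simp
    qed
    finally show ?thesis .
  qed
  have "((\<lambda>t. (B + B * B) * (1 - ?p t)) \<longlongrightarrow> (B + B * B) * (1 - 1)) at_top"
    by (intro tendsto_intros spread)
  then have "((\<lambda>t. (B + B * B) * (1 - ?p t)) \<longlongrightarrow> 0) at_top" by simp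
  then have "((\<lambda>t. (\<integral>z. D \<xi> (fst z) * D \<zeta> (snd z) \<partial>?W t) - ?T \<xi> * ?T \<zeta>) \<longlongrightarrow> 0) at_top"
    by (rule Lim_null_comparison[rotated])
      (use bound in \<open>auto simp: eventually_at_top_linorder intro!: exI[of _ 0]\<close>)
  then show ?thesis by (rule LIM_zero_cancel)
qed

text \<open>
  Let \<open>h\<close> be a combination of duality functions close to the fixed function \<open>f\<close>, and \<open>b\<close> its mean. Since
  \<open>f(\<eta>(0)) = f(\<eta>(t))\<close>, the second moment of \<open>f - b\<close> is bounded by twice the covariance of
  \<open>h(\<eta>(0))\<close> and \<open>h(\<eta>(t))\<close> plus an error of the order of the squared distance between \<open>f\<close> and \<open>h\<close>. The
  covariance vanishes as \<open>t\<close> grows.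
\<close>

theorem product_imp_ergodic:
  assumes inv: "\<mu> \<in> invariant_measures E P" and temp: "\<mu> \<in> tempered_measures D"
    and prod: "\<mu> \<in> product_measures"
    and spread: "\<And>\<xi> \<xi>'. \<xi> \<in> fin_configs \<Longrightarrow> \<xi>' \<in> fin_configs \<Longrightarrow>
           ((\<lambda>t. measure (Q \<xi>) {\<omega> \<in> space (Q \<xi>). perp (\<omega> t) \<xi>'}) \<longlongrightarrow> 1) at_top"
  shows "\<mu> \<in> ergodic_measures E P"
  unfolding ergodic_iff_two_time
proof (intro conjI ballI impI inv)
  let ?T = "D_transform D \<mu>"
  let ?W = "two_time_law \<mu>"
  interpret prob_space \<mu> by (rule law_prob[OF invariant_imp_laws[OF inv]])
  fix f assume f: "f \<in> L2 \<mu>" and fixed: "\<forall>t\<ge>0. AE z in ?W t. f (snd z) = f (fst z)"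
  define m where "m = (\<integral>\<eta>. f \<eta> \<partial>\<mu>)"
  have i: "integrable \<mu> f" and i2: "integrable \<mu> (\<lambda>\<eta>. (f \<eta>)\<^sup>2)"
    using L2_integrable[OF f] f unfolding L2_def by blast+
  have small: "(\<integral>\<eta>. (f \<eta> - m)\<^sup>2 \<partial>\<mu>) \<le> 6 * \<epsilon>" if \<epsilon>: "\<epsilon> > 0" for \<epsilon>
  proof -
    from tempered_dense[OF temp f \<epsilon>] obtain F c where F: "finite F" "F \<subseteq> fin_configs"
      and close: "(\<integral>\<eta>. (f \<eta> - (\<Sum>\<xi>\<in>F. c \<xi> * D \<xi> \<eta>))\<^sup>2 \<partial>\<mu>) < \<epsilon>" .
    define h where "h \<eta> = (\<Sum>\<xi>\<in>F. c \<xi> * D \<xi> \<eta>)" for \<eta>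
    have hL2: "h \<in> L2 \<mu>"
      unfolding h_def using F(2) by (intro L2_sum L2_cmult tempered_L2[OF temp]) blast
    have e: "(\<lambda>\<eta>. h \<eta> - f \<eta>) \<in> L2 \<mu>" by (rule L2_diff[OF hL2 f])
    have close': "(\<integral>\<eta>. (h \<eta> - f \<eta>)\<^sup>2 \<partial>\<mu>) < \<epsilon>"
      using close unfolding h_def[symmetric] by (simp add: power2_commute)
    define b where "b = (\<integral>\<eta>. h \<eta> \<partial>\<mu>)"
    have b: "b = (\<Sum>\<xi>\<in>F. c \<xi> * ?T \<xi>)"
      unfolding b_def h_def D_transform_def using F(2) tempered_integrable[OF temp]
      by (subst Bochner_Integration.integral_sum) (auto simp: subset_iff)
    have xL2: "(\<lambda>\<eta>. f \<eta> - b) \<in> L2 \<mu>" and hbL2: "(\<lambda>\<eta>. h \<eta> - b) \<in> L2 \<mu>"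
      by (intro L2_diff f hL2 L2_const)+
    have bound: "(\<integral>\<eta>. (f \<eta> - b)\<^sup>2 \<partial>\<mu>) \<le> 2 * ((\<integral>z. h (fst z) * h (snd z) \<partial>?W t) - b\<^sup>2) + 6 * \<epsilon>"
      if t: "t \<ge> 0" for t
    proof -
      interpret W: prob_space "?W t" by (rule prob_space_two_time_law[OF invariant_imp_laws[OF inv] t])
      note meas = L2_config[OF inv t]
      have eq: "(\<integral>\<eta>. (f \<eta> - b)\<^sup>2 \<partial>\<mu>) = (\<integral>z. (f (fst z) - b)\<^sup>2 \<partial>?W t)"
        using integral_fst[OF inv t, of "\<lambda>\<eta>. (f \<eta> - b)\<^sup>2"] meas[OF xL2] by simp
      have I: "integrable (?W t) (\<lambda>z. (h (fst z) - b) * (h (snd z) - b))"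
          "integrable (?W t) (\<lambda>z. (h (fst z) - f (fst z))\<^sup>2)"
          "integrable (?W t) (\<lambda>z. (h (snd z) - f (snd z))\<^sup>2)"
          "integrable (?W t) (\<lambda>z. (f (fst z) - b)\<^sup>2)"
          "integrable (?W t) (\<lambda>z. h (fst z) * h (snd z))"
          "integrable (?W t) (\<lambda>z. h (fst z))" "integrable (?W t) (\<lambda>z. h (snd z))"
        using integrable_mult_L2[OF L2_fst[OF inv t hbL2] L2_snd[OF inv t hbL2]]
          L2_fst[OF inv t e] L2_snd[OF inv t e] L2_fst[OF inv t xL2]
          integrable_mult_L2[OF L2_fst[OF inv t hL2] L2_snd[OF inv t hL2]]
          W.L2_integrable[OF L2_fst[OF inv t hL2]] W.L2_integrable[OF L2_snd[OF inv t hL2]]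
        unfolding L2_def by blast+
      have "(\<integral>z. (f (fst z) - b)\<^sup>2 \<partial>?W t) \<le>
        (\<integral>z. 2 * ((h (fst z) - b) * (h (snd z) - b)) + 3 * ((h (fst z) - f (fst z))\<^sup>2 + (h (snd z) - f (snd z))\<^sup>2) \<partial>?W t)"
      proof (rule integral_mono_AE)
        show "AE z in ?W t. (f (fst z) - b)\<^sup>2 \<le>
            2 * ((h (fst z) - b) * (h (snd z) - b)) + 3 * ((h (fst z) - f (fst z))\<^sup>2 + (h (snd z) - f (snd z))\<^sup>2)"
          using fixed[rule_format, OF t]
        proof eventually_elim
          fix z :: "'g config \<times> 'g config" assume fz: "f (snd z) = f (fst z)"
          have "x\<^sup>2 \<le> 2 * ((x + u) * (x + v)) + 3 * (u\<^sup>2 + v\<^sup>2)" for x u v :: real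
          proof -
            have "2 * ((x + u) * (x + v)) + 3 * (u\<^sup>2 + v\<^sup>2) - x\<^sup>2 = (x + u + v)\<^sup>2 + 2 * u\<^sup>2 + 2 * v\<^sup>2"
              by (simp add: power2_eq_square algebra_simps)
            also have "\<dots> \<ge> 0" by simp
            finally show ?thesis by simp
          qed
          from this[of "f (fst z) - b" "h (fst z) - f (fst z)" "h (snd z) - f (snd z)"]
          show "(f (fst z) - b)\<^sup>2 \<le> 2 * ((h (fst z) - b) * (h (snd z) - b)) +
              3 * ((h (fst z) - f (fst z))\<^sup>2 + (h (snd z) - f (snd z))\<^sup>2)"
            by (simp add: fz)
        qed
      qed (use I in auto)
      also have "\<dots> = 2 * (\<integral>z. (h (fst z) - b) * (h (snd z) - b) \<partial>?W t) +
          3 * ((\<integral>\<eta>. (h \<eta> - f \<eta>)\<^sup>2 \<partial>\<mu>) + (\<integral>\<eta>. (h \<eta> - f \<eta>)\<^sup>2 \<partial>\<mu>))"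
        using I integral_fst[OF inv t, of "\<lambda>\<eta>. (h \<eta> - f \<eta>)\<^sup>2"] integral_snd[OF inv t, of "\<lambda>\<eta>. (h \<eta> - f \<eta>)\<^sup>2"]
          meas[OF e] by simp
      also have "(\<integral>z. (h (fst z) - b) * (h (snd z) - b) \<partial>?W t) =
          (\<integral>z. h (fst z) * h (snd z) - b * h (fst z) - b * h (snd z) + b\<^sup>2 \<partial>?W t)"
        by (simp add: algebra_simps power2_eq_square)
      also have "\<dots> = (\<integral>z. h (fst z) * h (snd z) \<partial>?W t) - b * b - b * b + b\<^sup>2"
        using I integral_fst[OF inv t meas[OF hL2]] integral_snd[OF inv t meas[OF hL2]]
        by (simp add: b_def[symmetric] W.prob_space)
      finally show ?thesis using close' unfolding eq by (simp add: power2_eq_square)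
    qed
    have "((\<lambda>t. \<integral>z. h (fst z) * h (snd z) \<partial>?W t) \<longlongrightarrow> b\<^sup>2) at_top"
    proof -
      have "((\<lambda>t. \<Sum>\<xi>\<in>F. \<Sum>\<zeta>\<in>F. c \<xi> * c \<zeta> * (\<integral>z. D \<xi> (fst z) * D \<zeta> (snd z) \<partial>?W t))
         \<longlongrightarrow> (\<Sum>\<xi>\<in>F. \<Sum>\<zeta>\<in>F. c \<xi> * c \<zeta> * (?T \<xi> * ?T \<zeta>))) at_top"
        using F(2) by (intro tendsto_sum tendsto_mult_left product_two_time_tendsto[OF inv temp prod] spread) auto
      also have "(\<Sum>\<xi>\<in>F. \<Sum>\<zeta>\<in>F. c \<xi> * c \<zeta> * (?T \<xi> * ?T \<zeta>)) = b\<^sup>2"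
        by (simp add: b power2_eq_square sum_product algebra_simps)
      finally show ?thesis
      proof (rule Lim_transform_eventually)
        show "\<forall>\<^sub>F t in at_top. (\<Sum>\<xi>\<in>F. \<Sum>\<zeta>\<in>F. c \<xi> * c \<zeta> * (\<integral>z. D \<xi> (fst z) * D \<zeta> (snd z) \<partial>?W t)) =
           (\<integral>z. h (fst z) * h (snd z) \<partial>?W t)"
          using eventually_ge_at_top[of 0]
        proof eventually_elim
          fix t :: real assume t: "0 \<le> t"
          have I: "integrable (?W t) (\<lambda>z. D \<xi> (fst z) * D \<zeta> (snd z))" if "\<xi> \<in> F" "\<zeta> \<in> F" for \<xi> \<zeta>
            using F(2) that by (intro integrable_mult_L2 L2_fst[OF inv t] L2_snd[OF inv t] tempered_L2[OF temp]) auto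
          have "h (fst z) * h (snd z) = (\<Sum>\<xi>\<in>F. \<Sum>\<zeta>\<in>F. c \<xi> * c \<zeta> * (D \<xi> (fst z) * D \<zeta> (snd z)))" for z :: "'g config \<times> 'g config"
            unfolding h_def sum_product by (simp add: algebra_simps)
          then show "(\<Sum>\<xi>\<in>F. \<Sum>\<zeta>\<in>F. c \<xi> * c \<zeta> * (\<integral>z. D \<xi> (fst z) * D \<zeta> (snd z) \<partial>?W t)) =
             (\<integral>z. h (fst z) * h (snd z) \<partial>?W t)"
            using I by (simp add: Bochner_Integration.integral_sum)
        qed
      qed
    qed
    then have lim: "((\<lambda>t. 2 * ((\<integral>z. h (fst z) * h (snd z) \<partial>?W t) - b\<^sup>2) + 6 * \<epsilon>) \<longlongrightarrow> 2 * (b\<^sup>2 - b\<^sup>2) + 6 * \<epsilon>) at_top"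
      by (intro tendsto_intros)
    have "(\<integral>\<eta>. (f \<eta> - b)\<^sup>2 \<partial>\<mu>) \<le> 2 * (b\<^sup>2 - b\<^sup>2) + 6 * \<epsilon>"
      by (rule tendsto_lowerbound[OF lim])
        (use bound in \<open>auto simp: eventually_at_top_linorder intro!: exI[of _ 0]\<close>)
    then have "(\<integral>\<eta>. (f \<eta> - b)\<^sup>2 \<partial>\<mu>) \<le> 6 * \<epsilon>" by simp
    moreover have "(\<integral>\<eta>. (f \<eta> - b)\<^sup>2 \<partial>\<mu>) = (\<integral>\<eta>. (f \<eta> - m)\<^sup>2 \<partial>\<mu>) + (m - b)\<^sup>2"
      unfolding power2_diff using i i2 m_def[symmetric] by (simp add: prob_space power2_eq_square algebra_simps)
    moreover have "0 \<le> (m - b)\<^sup>2" by simp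
    ultimately show ?thesis by linarith
  qed
  have "(\<integral>\<eta>. (f \<eta> - m)\<^sup>2 \<partial>\<mu>) \<le> 0"
  proof (rule field_le_epsilon)
    fix e :: real assume "0 < e"
    then show "(\<integral>\<eta>. (f \<eta> - m)\<^sup>2 \<partial>\<mu>) \<le> 0 + e" using small[of "e / 6"] by simp
  qed
  moreover have "0 \<le> (\<integral>\<eta>. (f \<eta> - m)\<^sup>2 \<partial>\<mu>)" by simp
  ultimately have "(\<integral>\<eta>. (f \<eta> - m)\<^sup>2 \<partial>\<mu>) = 0" by linarith
  moreover have im: "integrable \<mu> (\<lambda>\<eta>. (f \<eta> - m)\<^sup>2)"
    using L2_diff[OF f L2_const[of m]] unfolding L2_def by blast
  ultimately have "AE \<eta> in \<mu>. (f \<eta> - m)\<^sup>2 = 0"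
    using integral_nonneg_eq_0_iff_AE[OF im] by simp
  then show "AE \<eta> in \<mu>. f \<eta> = (\<integral>\<eta>'. f \<eta>' \<partial>\<mu>)" unfolding m_def by eventually_elim simp
qed

end

section \<open>The transform under a successful coupling\<close>

context dual_process_pair
begin

lemma integral_along_path_law:
  assumes law: "has_path_law M (count_space fin_configs) X (Q \<xi>)" and t: "t \<ge> 0"
    and \<xi>: "\<xi> \<in> fin_configs"
  shows "(\<integral>w. h (X t w) \<partial>M) = (\<integral>\<omega>. (h (\<omega> t) :: real) \<partial>Q \<xi>)"
proof -
  let ?path = "\<lambda>w. \<lambda>t\<in>{0..}. X t w"
  have X: "\<And>t. t \<ge> 0 \<Longrightarrow> X t \<in> M \<rightarrow>\<^sub>M count_space fin_configs"
    and eq: "distr M (path_space (count_space fin_configs)) ?path = Q \<xi>"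
    using law unfolding has_path_law_def by blast+
  have path: "?path \<in> M \<rightarrow>\<^sub>M path_space (count_space fin_configs)"
    unfolding path_space_def by (rule measurable_restrict) (simp add: X)
  have h: "(\<lambda>\<omega>. h (\<omega> t)) \<in> borel_measurable (path_space (count_space fin_configs))"
    by (rule measurable_compose[OF eval_dual[OF t]]) simp
  show ?thesis
    unfolding eq[symmetric] using integral_distr[OF path h] t by simp
qed

lemma coupling_time_finite_imp:
  assumes "coupling_time X Y w < \<infinity>" shows "\<exists>T. \<forall>t\<ge>T. X t w = Y t w"
proof (rule ccontr)
  assume "\<nexists>T. \<forall>t\<ge>T. X t w = Y t w"
  then have "{ereal T | T. T > 0 \<and> (\<forall>t\<ge>T. X t w = Y t w)} = {}" by blast
  then have "coupling_time X Y w = \<infinity>"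
    unfolding coupling_time_def by (simp only: Inf_empty top_ereal_def)
  with assms show False by simp
qed

text \<open>
  Along the two coupled paths the transform has constant expectations, namely its values at the two
  starting points, whereas the paths eventually coincide. Dominated convergence is applied along
  integer times; outside the configurations of mass \<open>n\<close> the transform is cut off to make it bounded.
\<close>

lemma coupling_D_transform_eq:
  assumes inv: "\<mu> \<in> invariant_measures E P" and temp: "\<mu> \<in> tempered_measures D"
    and coup: "successful_coupling TYPE('w) Q"
    and \<xi>: "\<xi> \<in> fin_configs" and \<zeta>: "\<zeta> \<in> fin_configs" and mass: "mass \<xi> = mass \<zeta>"
  shows "D_transform D \<mu> \<xi> = D_transform D \<mu> \<zeta>"
proof -
  let ?T = "D_transform D \<mu>"
  define n where "n = mass \<zeta>"
  have mem: "\<xi> \<in> n_configs n" "\<zeta> \<in> n_configs n"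
    using \<xi> \<zeta> mass by (simp_all add: n_configs_iff n_def)
  have ex: "\<exists>(M :: 'w measure) X Y. prob_space M \<and> has_path_law M (count_space fin_configs) X (Q \<xi>) \<and>
      has_path_law M (count_space fin_configs) Y (Q \<zeta>) \<and> (AE w in M. coupling_time X Y w < \<infinity>)"
    using coup[unfolded successful_coupling_def, rule_format, OF mem] .
  then obtain M :: "'w measure" and X Y where M: "prob_space M"
    and X: "has_path_law M (count_space fin_configs) X (Q \<xi>)"
    and Y: "has_path_law M (count_space fin_configs) Y (Q \<zeta>)"
    and ct: "AE w in M. coupling_time X Y w < \<infinity>" by (elim exE conjE)
  interpret M: prob_space M by (rule M)
  obtain B where B: "\<And>\<kappa>. \<kappa> \<in> fin_configs \<Longrightarrow> mass \<kappa> \<le> n \<Longrightarrow> ?T \<kappa> \<le> B"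
    using tempered_bdd_above[OF temp, of n] unfolding bdd_above_def particles_le_iff by blast
  define h where "h \<kappa> = (if \<kappa> \<in> fin_configs \<and> mass \<kappa> = n then ?T \<kappa> else 0)" for \<kappa>
  have hb: "\<bar>h \<kappa>\<bar> \<le> max 0 B" for \<kappa>
    using B[of \<kappa>] D_transform_nonneg[of \<kappa> \<mu>] by (auto simp: h_def)
  have val: "(\<integral>\<omega>. h (\<omega> t) \<partial>Q \<kappa>) = ?T \<kappa>" if "t \<ge> 0" "\<kappa> \<in> fin_configs" "mass \<kappa> = n" for t \<kappa>
  proof -
    have "(\<integral>\<omega>. h (\<omega> t) \<partial>Q \<kappa>) = (\<integral>\<omega>. ?T (\<omega> t) \<partial>Q \<kappa>)"
    proof (rule integral_cong_AE)
      show "AE \<omega> in Q \<kappa>. h (\<omega> t) = ?T (\<omega> t)"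
        using AE_Q_mass[OF that(1,2)] by eventually_elim (simp add: h_def that)
    qed (rule eval_Q_measurable[OF that(1,2)])+
    then show ?thesis by (simp add: D_transform_harmonic[OF inv temp that(2,1)])
  qed
  have meas: "(\<lambda>w. h (X (real k) w)) \<in> borel_measurable M" "(\<lambda>w. h (Y (real k) w)) \<in> borel_measurable M" for k :: nat
  proof -
    have XY: "X (real k) \<in> M \<rightarrow>\<^sub>M count_space fin_configs" "Y (real k) \<in> M \<rightarrow>\<^sub>M count_space fin_configs"
      using X Y unfolding has_path_law_def by simp_all
    show "(\<lambda>w. h (X (real k) w)) \<in> borel_measurable M"
      by (rule measurable_compose[OF XY(1)]) simp
    show "(\<lambda>w. h (Y (real k) w)) \<in> borel_measurable M"
      by (rule measurable_compose[OF XY(2)]) simp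
  qed
  have diff: "(\<integral>w. h (X (real k) w) - h (Y (real k) w) \<partial>M) = ?T \<xi> - ?T \<zeta>" for k :: nat
  proof -
    have "integrable M (\<lambda>w. h (X (real k) w))" "integrable M (\<lambda>w. h (Y (real k) w))"
      using hb meas by (auto intro!: M.integrable_const_bound[of _ "max 0 B"])
    then show ?thesis
      using integral_along_path_law[OF X, of "real k" h] integral_along_path_law[OF Y, of "real k" h]
        val[of "real k" \<xi>] val[of "real k" \<zeta>] \<xi> \<zeta> mass by (simp add: n_def)
  qed
  have "(\<lambda>k::nat. \<integral>w. h (X (real k) w) - h (Y (real k) w) \<partial>M) \<longlonglongrightarrow> (\<integral>w. 0 \<partial>M)"
  proof (rule integral_dominated_convergence[where w = "\<lambda>_. 2 * max 0 B"])
    show "AE w in M. (\<lambda>k::nat. h (X (real k) w) - h (Y (real k) w)) \<longlonglongrightarrow> 0"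
      using ct
    proof eventually_elim
      fix w assume "coupling_time X Y w < \<infinity>"
      from coupling_time_finite_imp[OF this] obtain T where T: "\<forall>t\<ge>T. X t w = Y t w" ..
      obtain K :: nat where "T \<le> real K" using real_arch_simple by blast
      then show "(\<lambda>k::nat. h (X (real k) w) - h (Y (real k) w)) \<longlonglongrightarrow> 0"
        using T by (intro tendsto_eventually eventually_sequentiallyI[of K]) simp
    qed
    show "AE w in M. norm (h (X (real k) w) - h (Y (real k) w)) \<le> 2 * max 0 B" for k :: nat
    proof (rule AE_I2)
      fix w
      show "norm (h (X (real k) w) - h (Y (real k) w)) \<le> 2 * max 0 B"
        using hb[of "X (real k) w"] hb[of "Y (real k) w"] unfolding real_norm_def by linarith
    qed
  qed (use meas in simp_all)
  then show ?thesis unfolding diff by (simp add: LIMSEQ_const_iff)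
qed

section \<open>Ergodic tempered measures\<close>

text \<open>
  The empirical densities \<open>A n\<close>, averages of \<open>D (single x)\<close> over \<open>n + 1\<close> distinct sites outside the
  support of \<open>\<xi>\<close>, converge in \<open>L\<^sup>2(\<mu>)\<close> to a fixed function \<open>h\<close>. By ergodicity \<open>h\<close> is its mean, the
  transform of a single particle. Each \<open>A n\<close> has the correlation with \<open>D \<xi>\<close> that is the transform of
  one particle more than \<open>\<xi>\<close>, and in the limit this correlation factorizes.
\<close>

lemma ergodic_D_transform_step:
  assumes infinite: "infinite (UNIV :: 'g set)"
    and erg: "\<mu> \<in> ergodic_measures E P" and temp: "\<mu> \<in> tempered_measures D"
    and const: "\<And>\<xi> \<zeta>. \<xi> \<in> fin_configs \<Longrightarrow> \<zeta> \<in> fin_configs \<Longrightarrow> mass \<xi> = mass \<zeta> \<Longrightarrow>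
         D_transform D \<mu> \<xi> = D_transform D \<mu> \<zeta>"
    and \<xi>: "\<xi> \<in> fin_configs" and \<kappa>: "\<kappa> \<in> fin_configs" "mass \<kappa> = Suc (mass \<xi>)"
  shows "D_transform D \<mu> \<kappa> = D_transform D \<mu> (single y) * D_transform D \<mu> \<xi>"
proof -
  let ?W = "two_time_law \<mu>"
  have inv: "\<mu> \<in> invariant_measures E P" using erg unfolding ergodic_iff_two_time by (rule conjunct1)
  interpret prob_space \<mu> by (rule law_prob[OF invariant_imp_laws[OF inv]])
  let ?T = "D_transform D \<mu>"
  have "infinite (- supp \<xi>)"
    using infinite \<xi> by (simp add: fin_configs_iff Compl_eq_Diff_UNIV Diff_infinite_finite)
  then obtain x :: "nat \<Rightarrow> 'g" where inj: "inj x" and x: "range x \<subseteq> - supp \<xi>"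
    using infinite_countable_subset by blast
  define s where "s i = single (x i)" for i
  have s: "s i \<in> fin_configs" "mass (s i) = 1" for i by (simp_all add: s_def)
  define p where "p = ?T (single y)"
  have Ts: "?T (s i) = p" for i unfolding p_def by (rule const) (simp_all add: s_def)
  define q where "q = corr \<mu> (s 0) (s 1)"
  have perp_single: "perp (single u) (single v) \<longleftrightarrow> u \<noteq> v" for u v :: 'g
    by (auto simp: perp_def)
  have corr_single: "corr \<mu> (single u) (single v) = q" if "u \<noteq> v" for u v
  proof -
    have 01: "x 0 \<noteq> x 1" using inj by (simp add: inj_eq)
    have "perp (single u) (single v)" "perp (s 0) (s 1)" using that 01 by (simp_all add: perp_single s_def)
    then show ?thesis
      unfolding q_def using s[of 0] s[of 1]
      by (simp add: corr_perp[OF inv temp] const[of "\<lambda>z. single u z + single v z" "\<lambda>z. s 0 z + s 1 z"]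
          fin_configs_add mass_add_perp)
  qed
  have q0: "q \<ge> 0" unfolding q_def by (rule corr_nonneg[OF inv temp s(1) s(1)])
  obtain B where B: "B \<ge> 0" "\<And>i. corr \<mu> (s i) (s i) \<le> B"
    using corr_bounded[OF inv temp, of 1] s by (metis order_refl)
  define A where "A n \<eta> = (\<Sum>i<Suc n. D (s i) \<eta>) / real (Suc n)" for n \<eta>
  have A_alt: "A n = (\<lambda>\<eta>. (1 / real (Suc n)) * (\<Sum>i<Suc n. D (s i) \<eta>))" for n
    by (simp add: A_def fun_eq_iff)
  have AL2: "A n \<in> L2 \<mu>" for n
    unfolding A_alt by (intro L2_cmult L2_sum tempered_L2[OF temp] s)
  have A_int: "(\<integral>\<eta>. A n \<eta> \<partial>\<mu>) = p" for n
  proof -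
    have "(\<integral>\<eta>. A n \<eta> \<partial>\<mu>) = (\<Sum>i<Suc n. ?T (s i)) / real (Suc n)"
      unfolding A_def D_transform_def using tempered_integrable[OF temp s(1)]
      by (simp add: Bochner_Integration.integral_sum del: sum.lessThan_Suc)
    also have "\<dots> = p" by (simp add: Ts del: sum.lessThan_Suc)
    finally show ?thesis .
  qed
  \<comment> \<open>at most one of the distinct sites \<open>x i\<close> is equal to \<open>v\<close>, all others contribute \<open>q\<close>\<close>
  have row_lower: "real n * q \<le> (\<Sum>i<Suc n. corr \<mu> (s i) (single v))" for n v
  proof -
    have "real n * q \<le> real (card ({..<Suc n} - {i. x i = v})) * q"
    proof (intro mult_right_mono q0)
      have "card ({..<Suc n} \<inter> {i. x i = v}) \<le> 1"
        using inj by (auto simp: card_le_Suc0_iff_eq inj_eq)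
      moreover have "card ({..<Suc n} - {i. x i = v}) = card {..<Suc n} - card ({..<Suc n} \<inter> {i. x i = v})"
        by (rule card_Diff_subset_Int) simp
      ultimately show "real n \<le> real (card ({..<Suc n} - {i. x i = v}))" by simp
    qed
    also have "\<dots> = (\<Sum>i\<in>{..<Suc n} - {i. x i = v}. corr \<mu> (s i) (single v))"
      by (simp add: corr_single s_def)
    also have "\<dots> \<le> (\<Sum>i<Suc n. corr \<mu> (s i) (single v))"
      by (rule sum_mono2) (auto intro: corr_nonneg[OF inv temp] s)
    finally show ?thesis .
  qed
  have row_upper: "(\<Sum>i<Suc n. corr \<mu> (s i) (s j)) \<le> real (Suc n) * q + B" if "j < Suc n" for n j
  proof -
    have "(\<Sum>i<Suc n. corr \<mu> (s i) (s j)) = corr \<mu> (s j) (s j) + (\<Sum>i\<in>{..<Suc n} - {j}. corr \<mu> (s i) (s j))"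
      using that by (intro sum.remove) auto
    also have "(\<Sum>i\<in>{..<Suc n} - {j}. corr \<mu> (s i) (s j)) = (\<Sum>i\<in>{..<Suc n} - {j}. q)"
      using inj by (intro sum.cong) (auto simp: s_def inj_eq intro!: corr_single)
    also have "\<dots> = real n * q" using that by simp
    finally show ?thesis using B(2)[of j] q0 by (simp add: algebra_simps)
  qed
  have corr_A: "(\<integral>\<eta>. A m \<eta> * A n \<eta> \<partial>\<mu>) = (\<Sum>j<Suc n. \<Sum>i<Suc m. corr \<mu> (s i) (s j)) / (real (Suc m) * real (Suc n))" for m n
  proof -
    have "A m \<eta> * A n \<eta> = (\<Sum>j<Suc n. \<Sum>i<Suc m. D (s i) \<eta> * D (s j) \<eta>) / (real (Suc m) * real (Suc n))" for \<eta>
      unfolding A_def times_divide_times_eq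
      by (subst sum_product, subst sum.swap) simp
    then show ?thesis
      unfolding corr_def using corr_integrable[OF inv temp s(1) s(1)]
      by (simp add: Bochner_Integration.integral_sum del: sum.lessThan_Suc)
  qed
  have lower: "real m / real (Suc m) * q \<le> (\<integral>\<eta>. A m \<eta> * A n \<eta> \<partial>\<mu>)" for m n
  proof -
    have "real (Suc n) * (real m * q) \<le> (\<Sum>j<Suc n. \<Sum>i<Suc m. corr \<mu> (s i) (s j))"
      using sum_bounded_below[of "{..<Suc n}" "real m * q" "\<lambda>j. \<Sum>i<Suc m. corr \<mu> (s i) (s j)"]
        row_lower[of m] by (simp add: s_def del: sum.lessThan_Suc)
    then show ?thesis unfolding corr_A by (simp add: field_simps del: sum.lessThan_Suc of_nat_Suc)
  qed
  have upper: "(\<integral>\<eta>. (A n \<eta>)\<^sup>2 \<partial>\<mu>) \<le> q + B / real (Suc n)" for n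
  proof -
    have "(\<Sum>j<Suc n. \<Sum>i<Suc n. corr \<mu> (s i) (s j)) \<le> real (Suc n) * (real (Suc n) * q + B)"
      using sum_bounded_above[of "{..<Suc n}" "\<lambda>j. \<Sum>i<Suc n. corr \<mu> (s i) (s j)" "real (Suc n) * q + B"]
        row_upper[of _ n] by (simp del: sum.lessThan_Suc of_nat_Suc)
    then have "(\<integral>\<eta>. (A n \<eta>)\<^sup>2 \<partial>\<mu>) \<le> real (Suc n) * (real (Suc n) * q + B) / (real (Suc n) * real (Suc n))"
      unfolding power2_eq_square corr_A by (intro divide_right_mono) simp_all
    also have "\<dots> = q + B / real (Suc n)" by (simp add: field_simps del: of_nat_Suc)
    finally show ?thesis .
  qed
  have inv_Suc: "(\<lambda>n. c / real (Suc n)) \<longlonglongrightarrow> 0" for c :: real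
    using LIMSEQ_inverse_real_of_nat[THEN tendsto_mult_left, of c] by (simp add: divide_inverse)
  have q_frac: "real m / real (Suc m) * q = q - q / real (Suc m)" for m
    by (simp add: field_simps)
  \<comment> \<open>a common null sequence that dominates all errors below\<close>
  define b where "b n = (2 * B + 2 * q) / real (Suc n)" for n
  have b0: "b \<longlonglongrightarrow> 0" unfolding b_def by (rule inv_Suc)
  \<comment> \<open>up to null sequences, mixed second moments are at least \<open>q\<close> and second moments at most \<open>q\<close>\<close>
  have A_Cauchy: "(\<integral>\<eta>. (A m \<eta> - A n \<eta>)\<^sup>2 \<partial>\<mu>) \<le> b m + b n" for m n
  proof -
    have I: "integrable \<mu> (\<lambda>\<eta>. (A m \<eta>)\<^sup>2)" "integrable \<mu> (\<lambda>\<eta>. (A n \<eta>)\<^sup>2)" "integrable \<mu> (\<lambda>\<eta>. A m \<eta> * A n \<eta>)"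
      using AL2[of m] AL2[of n] integrable_mult_L2[OF AL2 AL2, of m n] unfolding L2_def by blast+
    have "(A m \<eta> - A n \<eta>)\<^sup>2 = (A m \<eta>)\<^sup>2 + (A n \<eta>)\<^sup>2 - 2 * (A m \<eta> * A n \<eta>)" for \<eta>
      by (simp add: power2_diff)
    then have "(\<integral>\<eta>. (A m \<eta> - A n \<eta>)\<^sup>2 \<partial>\<mu>) =
        (\<integral>\<eta>. (A m \<eta>)\<^sup>2 \<partial>\<mu>) + (\<integral>\<eta>. (A n \<eta>)\<^sup>2 \<partial>\<mu>) - 2 * (\<integral>\<eta>. A m \<eta> * A n \<eta> \<partial>\<mu>)"
      using I by simp
    also have "\<dots> \<le> B / real (Suc m) + B / real (Suc n) + 2 * (q / real (Suc m))"
      using upper[of m] upper[of n] lower[of m n] unfolding q_frac by linarith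
    also have "\<dots> \<le> b m + b n"
    proof -
      have b: "b k = 2 * (B / real (Suc k)) + 2 * (q / real (Suc k))" for k
        by (simp add: b_def add_divide_distrib del: of_nat_Suc)
      have pos: "0 \<le> B / real (Suc k)" "0 \<le> q / real (Suc k)" for k
        using B(1) q0 by simp_all
      show ?thesis unfolding b using pos[of m] pos[of n] by linarith
    qed
    finally show ?thesis .
  qed
  have "\<exists>N. \<forall>m\<ge>N. \<forall>n\<ge>N. (\<integral>\<eta>. (A m \<eta> - A n \<eta>)\<^sup>2 \<partial>\<mu>) < e" if e: "e > 0" for e
  proof -
    have "\<forall>\<^sub>F n in sequentially. b n < e / 2" using order_tendstoD(2)[OF b0, of "e / 2"] e by simp
    then obtain N where N: "\<And>n. n \<ge> N \<Longrightarrow> b n < e / 2" unfolding eventually_sequentially by blast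
    have "(\<integral>\<eta>. (A m \<eta> - A n \<eta>)\<^sup>2 \<partial>\<mu>) < e" if "m \<ge> N" "n \<ge> N" for m n
      using A_Cauchy[of m n] N[OF that(1)] N[OF that(2)] by linarith
    then show ?thesis by blast
  qed
  from L2_complete[OF AL2 this]
  obtain h where h: "h \<in> L2 \<mu>" and Ah: "(\<lambda>n. \<integral>\<eta>. (A n \<eta> - h \<eta>)\<^sup>2 \<partial>\<mu>) \<longlonglongrightarrow> 0" .
  let ?e = "\<lambda>n. \<integral>\<eta>. (A n \<eta> - h \<eta>)\<^sup>2 \<partial>\<mu>"
  have "AE z in ?W t. h (snd z) = h (fst z)" if t: "t \<ge> 0" for t
  proof -
    note [measurable] = L2_config[OF inv t h] L2_config[OF inv t AL2]
    \<comment> \<open>the dual particle started from \<open>x j\<close> sits at some site \<open>v\<close> at time \<open>t\<close>, and the lower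
      bound \<open>row_lower\<close> does not depend on that site\<close>
    have two: "real n / real (Suc n) * q \<le> (\<integral>z. A n (fst z) * A n (snd z) \<partial>?W t)" for n
    proof -
      have I: "integrable (?W t) (\<lambda>z. D (s i) (fst z) * D (s j) (snd z))" for i j
        by (intro integrable_mult_L2 L2_fst[OF inv t] L2_snd[OF inv t] tempered_L2[OF temp] s)
      have row: "real n * q \<le> (\<Sum>i<Suc n. \<integral>z. D (s i) (fst z) * D (s j) (snd z) \<partial>?W t)" for j
      proof -
        interpret Qj: prob_space "Q (s j)" by (rule prob_space_Q[OF s(1)])
        have "real n * q = (\<integral>\<omega>. real n * q \<partial>Q (s j))" by (simp add: Qj.prob_space)
        also have "\<dots> \<le> (\<integral>\<omega>. (\<Sum>i<Suc n. corr \<mu> (s i) (\<omega> t)) \<partial>Q (s j))"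
        proof (rule integral_mono_AE)
          show "integrable (Q (s j)) (\<lambda>\<omega>. \<Sum>i<Suc n. corr \<mu> (s i) (\<omega> t))"
            by (intro Bochner_Integration.integrable_sum integrable_corr_Q[OF inv temp s(1) s(1) t])
          show "AE \<omega> in Q (s j). real n * q \<le> (\<Sum>i<Suc n. corr \<mu> (s i) (\<omega> t))"
            using AE_Q_mass[OF t s(1), of j]
          proof eventually_elim
            fix \<omega> :: "real \<Rightarrow> 'g config"
            assume "\<omega> t \<in> fin_configs \<and> mass (\<omega> t) = mass (s j)"
            then have "\<omega> t \<in> fin_configs" "mass (\<omega> t) = 1" by (simp_all add: s)
            then obtain v where "\<omega> t = single v" by (rule mass_one_imp_single)
            then show "real n * q \<le> (\<Sum>i<Suc n. corr \<mu> (s i) (\<omega> t))" using row_lower[of n v] by simp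
          qed
        qed simp
        also have "\<dots> = (\<Sum>i<Suc n. \<integral>z. D (s i) (fst z) * D (s j) (snd z) \<partial>?W t)"
          unfolding integral_two_time_product[OF inv temp s(1) s(1) t]
          by (rule Bochner_Integration.integral_sum) (rule integrable_corr_Q[OF inv temp s(1) s(1) t])
        finally show ?thesis .
      qed
      have "A n (fst z) * A n (snd z) =
          (\<Sum>j<Suc n. \<Sum>i<Suc n. D (s i) (fst z) * D (s j) (snd z)) / (real (Suc n) * real (Suc n))" for z :: "'g config \<times> 'g config"
        unfolding A_def times_divide_times_eq
        by (subst sum_product, subst sum.swap) simp
      then have "(\<integral>z. A n (fst z) * A n (snd z) \<partial>?W t) =
         (\<Sum>j<Suc n. \<Sum>i<Suc n. \<integral>z. D (s i) (fst z) * D (s j) (snd z) \<partial>?W t) / (real (Suc n) * real (Suc n))"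
        using I by (simp add: Bochner_Integration.integral_sum del: sum.lessThan_Suc)
      moreover have "real (Suc n) * (real n * q) \<le>
          (\<Sum>j<Suc n. \<Sum>i<Suc n. \<integral>z. D (s i) (fst z) * D (s j) (snd z) \<partial>?W t)"
        using sum_bounded_below[of "{..<Suc n}" "real n * q"
            "\<lambda>j. \<Sum>i<Suc n. \<integral>z. D (s i) (fst z) * D (s j) (snd z) \<partial>?W t"] row
        by (simp del: sum.lessThan_Suc)
      ultimately have "real (Suc n) * (real n * q) / (real (Suc n) * real (Suc n)) \<le>
          (\<integral>z. A n (fst z) * A n (snd z) \<partial>?W t)"
        by (simp only: divide_right_mono of_nat_0_le_iff mult_nonneg_nonneg)
      then show ?thesis by simp
    qed
    let ?c = "\<integral>z. (h (snd z) - h (fst z))\<^sup>2 \<partial>?W t"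
    have hW: "(\<lambda>z. h (snd z) - h (fst z)) \<in> L2 (?W t)"
      by (intro L2_diff L2_fst[OF inv t] L2_snd[OF inv t] h)
    have bound: "?c \<le> 3 * b n + 6 * ?e n" for n
    proof -
      have dL2: "(\<lambda>\<eta>. A n \<eta> - h \<eta>) \<in> L2 \<mu>" by (rule L2_diff[OF AL2 h])
      have I: "integrable (?W t) (\<lambda>z. (h (snd z) - h (fst z))\<^sup>2)"
        "integrable (?W t) (\<lambda>z. (A n (fst z) - h (fst z))\<^sup>2)"
        "integrable (?W t) (\<lambda>z. (A n (snd z) - h (snd z))\<^sup>2)"
        "integrable (?W t) (\<lambda>z. (A n (snd z) - A n (fst z))\<^sup>2)"
        using hW L2_fst[OF inv t dL2] L2_snd[OF inv t dL2]
          L2_diff[OF L2_snd[OF inv t AL2] L2_fst[OF inv t AL2], of n n] unfolding L2_def by blast+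
      have "?c \<le> (\<integral>z. 3 * ((A n (snd z) - A n (fst z))\<^sup>2 + (A n (fst z) - h (fst z))\<^sup>2 + (A n (snd z) - h (snd z))\<^sup>2) \<partial>?W t)"
      proof (rule integral_mono)
        fix z :: "'g config \<times> 'g config"
        have "(u + v - w)\<^sup>2 \<le> 3 * (u\<^sup>2 + v\<^sup>2 + w\<^sup>2)" for u v w :: real
        proof -
          have "3 * (u\<^sup>2 + v\<^sup>2 + w\<^sup>2) - (u + v - w)\<^sup>2 = (u - v)\<^sup>2 + (u + w)\<^sup>2 + (v + w)\<^sup>2"
            by (simp add: power2_eq_square algebra_simps)
          also have "\<dots> \<ge> 0" by simp
          finally show ?thesis by simp
        qed
        from this[of "A n (snd z) - A n (fst z)" "A n (fst z) - h (fst z)" "A n (snd z) - h (snd z)"]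
        show "(h (snd z) - h (fst z))\<^sup>2 \<le>
            3 * ((A n (snd z) - A n (fst z))\<^sup>2 + (A n (fst z) - h (fst z))\<^sup>2 + (A n (snd z) - h (snd z))\<^sup>2)"
          by simp
      qed (use I in auto)
      also have "\<dots> = 3 * (\<integral>z. (A n (snd z) - A n (fst z))\<^sup>2 \<partial>?W t) + 6 * ?e n"
        using I integral_fst[OF inv t, of "\<lambda>\<eta>. (A n \<eta> - h \<eta>)\<^sup>2"] integral_snd[OF inv t, of "\<lambda>\<eta>. (A n \<eta> - h \<eta>)\<^sup>2"]
        by simp
      also have "(\<integral>z. (A n (snd z) - A n (fst z))\<^sup>2 \<partial>?W t) \<le> b n"
      proof -
        note two_time_increment[OF inv t AL2, of n]
        also have "2 * (\<integral>\<eta>. (A n \<eta>)\<^sup>2 \<partial>\<mu>) - 2 * (\<integral>z. A n (fst z) * A n (snd z) \<partial>?W t) \<le>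
            2 * (q + B / real (Suc n)) - 2 * (q - q / real (Suc n))"
          using upper[of n] two[of n] unfolding q_frac by (intro diff_mono mult_left_mono) simp_all
        also have "\<dots> = b n" by (simp add: b_def add_divide_distrib del: of_nat_Suc)
        finally show ?thesis .
      qed
      finally show ?thesis by simp
    qed
    have "(\<lambda>n. 3 * b n + 6 * ?e n) \<longlonglongrightarrow> 3 * 0 + 6 * 0"
      by (intro tendsto_intros b0 Ah)
    then have "?c \<le> 3 * 0 + 6 * 0" by (rule LIMSEQ_le_const) (use bound in blast)
    moreover have "0 \<le> ?c" by simp
    ultimately have "?c = 0" by linarith
    moreover have "integrable (?W t) (\<lambda>z. (h (snd z) - h (fst z))\<^sup>2)"
      using hW unfolding L2_def by blast
    ultimately have "AE z in ?W t. (h (snd z) - h (fst z))\<^sup>2 = 0"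
      using integral_nonneg_eq_0_iff_AE[of "?W t" "\<lambda>z. (h (snd z) - h (fst z))\<^sup>2"] by simp
    then show ?thesis by eventually_elim simp
  qed
  then have h_const: "AE \<eta> in \<mu>. h \<eta> = (\<integral>\<eta>'. h \<eta>' \<partial>\<mu>)"
    using erg[unfolded ergodic_iff_two_time, THEN conjunct2, rule_format, OF h] by blast
  have mean_close: "(p - (\<integral>\<eta>. h \<eta> \<partial>\<mu>))\<^sup>2 \<le> ?e n" for n
  proof -
    have dL2: "(\<lambda>\<eta>. A n \<eta> - h \<eta>) \<in> L2 \<mu>" by (rule L2_diff[OF AL2 h])
    have "(\<integral>\<eta>. A n \<eta> - h \<eta> \<partial>\<mu>) = p - (\<integral>\<eta>. h \<eta> \<partial>\<mu>)"
      using L2_integrable[OF AL2] L2_integrable[OF h] by (simp add: A_int)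
    moreover have "(\<integral>\<eta>. (A n \<eta> - h \<eta>) * 1 \<partial>\<mu>)\<^sup>2 \<le> ?e n * (\<integral>\<eta>. 1\<^sup>2 \<partial>\<mu>)"
      by (rule L2_Cauchy_Schwarz[OF dL2 L2_const])
    ultimately show ?thesis by (simp add: prob_space)
  qed
  have "(p - (\<integral>\<eta>. h \<eta> \<partial>\<mu>))\<^sup>2 \<le> 0"
    by (rule LIMSEQ_le_const[OF Ah]) (use mean_close in blast)
  then have "(\<integral>\<eta>. h \<eta> \<partial>\<mu>) = p" by simp
  with h_const have hp: "AE \<eta> in \<mu>. h \<eta> = p" by simp
  let ?r = "?T \<kappa> - p * ?T \<xi>"
  have Dxi: "D \<xi> \<in> L2 \<mu>" by (rule tempered_L2[OF temp \<xi>])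
  have r_bound: "?r\<^sup>2 \<le> ?e n * (\<integral>\<eta>. (D \<xi> \<eta>)\<^sup>2 \<partial>\<mu>)" for n
  proof -
    have dL2: "(\<lambda>\<eta>. A n \<eta> - h \<eta>) \<in> L2 \<mu>" by (rule L2_diff[OF AL2 h])
    have corr_s: "corr \<mu> (s i) \<xi> = ?T \<kappa>" for i
    proof -
      have "x i \<notin> supp \<xi>" using x by blast
      then have perp: "perp (s i) \<xi>" by (simp add: perp_def s_def)
      show ?thesis
        unfolding corr_perp[OF inv temp s(1) \<xi> perp]
        using \<kappa> fin_configs_add[OF s(1) \<xi> perp] mass_add_perp[OF s(1) \<xi> perp] by (intro const) (simp_all add: s)
    qed
    have "A n \<eta> * D \<xi> \<eta> = (\<Sum>i<Suc n. D (s i) \<eta> * D \<xi> \<eta>) / real (Suc n)" for \<eta>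
      unfolding A_def by (simp add: sum_distrib_right del: sum.lessThan_Suc)
    then have "(\<integral>\<eta>. A n \<eta> * D \<xi> \<eta> \<partial>\<mu>) = (\<Sum>i<Suc n. corr \<mu> (s i) \<xi>) / real (Suc n)"
      unfolding corr_def using corr_integrable[OF inv temp s(1) \<xi>]
      by (simp add: Bochner_Integration.integral_sum del: sum.lessThan_Suc)
    also have "\<dots> = ?T \<kappa>" by (simp add: corr_s del: sum.lessThan_Suc)
    finally have 1: "(\<integral>\<eta>. A n \<eta> * D \<xi> \<eta> \<partial>\<mu>) = ?T \<kappa>" .
    have "(\<integral>\<eta>. h \<eta> * D \<xi> \<eta> \<partial>\<mu>) = (\<integral>\<eta>. p * D \<xi> \<eta> \<partial>\<mu>)"
    proof (rule integral_cong_AE)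
      show "AE \<eta> in \<mu>. h \<eta> * D \<xi> \<eta> = p * D \<xi> \<eta>" using hp by eventually_elim simp
      show "(\<lambda>\<eta>. h \<eta> * D \<xi> \<eta>) \<in> borel_measurable \<mu>"
        by (rule borel_measurable_integrable[OF integrable_mult_L2[OF h Dxi]])
      show "(\<lambda>\<eta>. p * D \<xi> \<eta>) \<in> borel_measurable \<mu>"
        using borel_measurable_integrable[OF tempered_integrable[OF temp \<xi>]] by simp
    qed
    then have 2: "(\<integral>\<eta>. h \<eta> * D \<xi> \<eta> \<partial>\<mu>) = p * ?T \<xi>" by (simp add: D_transform_def)
    have "(\<integral>\<eta>. (A n \<eta> - h \<eta>) * D \<xi> \<eta> \<partial>\<mu>) = ?r"
      using integrable_mult_L2[OF AL2 Dxi, of n] integrable_mult_L2[OF h Dxi] 1 2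
      by (simp add: left_diff_distrib)
    then show ?thesis using L2_Cauchy_Schwarz[OF dL2 Dxi] by simp
  qed
  have "(\<lambda>n. ?e n * (\<integral>\<eta>. (D \<xi> \<eta>)\<^sup>2 \<partial>\<mu>)) \<longlonglongrightarrow> 0 * (\<integral>\<eta>. (D \<xi> \<eta>)\<^sup>2 \<partial>\<mu>)"
    by (intro tendsto_intros Ah)
  then have "?r\<^sup>2 \<le> 0 * (\<integral>\<eta>. (D \<xi> \<eta>)\<^sup>2 \<partial>\<mu>)"
    by (rule LIMSEQ_le_const) (use r_bound in blast)
  then show ?thesis by (simp add: p_def)
qed

definition pile :: "'g \<Rightarrow> nat \<Rightarrow> 'g config" where
  "pile x n = (\<lambda>y. if y = x then n else 0)"

lemma pile_fin [simp]: "pile x n \<in> fin_configs" and mass_pile [simp]: "mass (pile x n) = n"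
  and supp_pile: "supp (pile x n) \<subseteq> {x}" and pile_same [simp]: "pile x n x = n"
proof -
  show s: "supp (pile x n) \<subseteq> {x}" by (auto simp: supp_def pile_def)
  then show "pile x n \<in> fin_configs" by (auto simp: fin_configs_iff intro: finite_subset)
  show "pile x n x = n" by (simp add: pile_def)
  have "mass (pile x n) = (\<Sum>y\<in>{x}. pile x n y)"
    unfolding mass_def using s by (intro sum.mono_neutral_left) (auto simp: supp_def)
  then show "mass (pile x n) = n" by (simp add: pile_def)
qed

lemma ergodic_D_transform_power:
  assumes infinite: "infinite (UNIV :: 'g set)"
    and erg: "\<mu> \<in> ergodic_measures E P" and temp: "\<mu> \<in> tempered_measures D"
    and coup: "successful_coupling TYPE('w) Q"
    and \<kappa>: "\<kappa> \<in> fin_configs"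
  shows "D_transform D \<mu> \<kappa> = D_transform D \<mu> (single y) ^ mass \<kappa>"
  using \<kappa>
proof (induction "mass \<kappa>" arbitrary: \<kappa>)
  case 0
  have inv: "\<mu> \<in> invariant_measures E P" using erg unfolding ergodic_iff_two_time by (rule conjunct1)
  interpret prob_space \<mu> by (rule law_prob[OF invariant_imp_laws[OF inv]])
  have "\<kappa> = (\<lambda>_. 0)" using 0 by (simp add: mass_zero_iff)
  then show ?case using 0(1)[symmetric] by (simp add: D_transform_def prob_space)
next
  case (Suc n)
  have inv: "\<mu> \<in> invariant_measures E P" using erg unfolding ergodic_iff_two_time by (rule conjunct1)
  have "D_transform D \<mu> \<kappa> = D_transform D \<mu> (single y) * D_transform D \<mu> (pile y n)"
    by (rule ergodic_D_transform_step[OF infinite erg temp coupling_D_transform_eq[OF inv temp coup]])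
      (use Suc in simp_all)
  also have "D_transform D \<mu> (pile y n) = D_transform D \<mu> (single y) ^ n"
    using Suc(1)[of "pile y n"] by simp
  finally show ?case by (simp flip: Suc(2))
qed

text \<open>
  Both \<open>\<mu>\<close> and the product of its marginals have the transform \<open>\<theta> ^ mass \<xi>\<close>: the marginal at \<open>x\<close> is
  tested by the configurations that are concentrated on \<open>x\<close>.
\<close>

lemma power_transform_imp_product:
  assumes temp: "\<mu> \<in> tempered_measures D"
    and power: "\<And>\<kappa>. \<kappa> \<in> fin_configs \<Longrightarrow> D_transform D \<mu> \<kappa> = \<theta> ^ mass \<kappa>"
    and \<theta>: "\<theta> \<ge> 0"
  shows "\<mu> \<in> product_measures"
proof -
  have muP: "\<mu> \<in> prob_measures" using temp tempered_subset_prob by blast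
  then interpret prob_space \<mu> by (simp add: prob_measures_def)
  have sets: "sets \<mu> = sets config_space" using muP by (simp add: prob_measures_def)
  have comp: "(\<lambda>\<eta>. \<eta> x) \<in> \<mu> \<rightarrow>\<^sub>M count_space UNIV" for x
    unfolding measurable_cong_sets[OF sets refl] by (rule measurable_config_component)
  define m where "m x = distr \<mu> (count_space UNIV) (\<lambda>\<eta>. \<eta> x)" for x
  interpret site_product d D m
    by (simp add: site_product_def site_product_axioms_def duality_function m_def prob_space_distr comp)
  have pile: "(\<integral>\<^sup>+n. ennreal (d k n) \<partial>m x) = ennreal (\<theta> ^ k)" for k x
  proof -
    have "(\<integral>\<^sup>+n. ennreal (d k n) \<partial>m x) = (\<integral>\<^sup>+\<eta>. ennreal (d k (\<eta> x)) \<partial>\<mu>)"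
      unfolding m_def by (rule nn_integral_distr[OF comp]) simp
    also have "\<dots> = (\<integral>\<^sup>+\<eta>. ennreal (D (pile x k) \<eta>) \<partial>\<mu>)"
      by (simp add: D_eq_prod[of "{x}" "pile x k"] supp_pile)
    also have "\<dots> = ennreal (D_transform D \<mu> (pile x k))"
      unfolding D_transform_def
      by (rule nn_integral_eq_integral[OF tempered_integrable[OF temp]]) (simp_all add: D_nonneg)
    finally show ?thesis by (simp add: power)
  qed
  have nn: "(\<integral>\<^sup>+\<eta>. ennreal (D \<xi> \<eta>) \<partial>\<pi>) = ennreal (\<theta> ^ mass \<xi>)" if "\<xi> \<in> fin_configs" for \<xi>
    using that \<theta> by (simp add: nn_integral_D_product[OF _ order_refl] fin_configs_iff pile prod_ennreal mass_def power_sum)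
  have bi: "has_bochner_integral \<pi> (D \<xi>) (\<theta> ^ mass \<xi>)" if "\<xi> \<in> fin_configs" for \<xi>
    by (rule has_bochner_integral_nn_integral[OF _ _ _ nn[OF that]])
      (simp_all add: D_nonneg that \<theta> D_measurable measurable_cong_sets[OF sets_product refl])
  have "\<mu> = \<pi>"
  proof (rule tempered_determined[OF temp product_in_prob_measures])
    show "D_integrable D \<pi>" using bi by (auto simp: D_integrable_def has_bochner_integral_iff)
    show "D_transform D \<mu> \<xi> = D_transform D \<pi> \<xi>" if "\<xi> \<in> fin_configs" for \<xi>
      using bi[OF that] power[OF that] by (simp add: D_transform_def has_bochner_integral_iff)
  qed
  then show ?thesis
    unfolding product_measures_def mem_Collect_eq using prob_site sets_site by (intro exI[of _ m]) simp
qed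

end

theorem theorem3p2:
  fixes E :: "('g::countable) config set"
    and P Q :: "'g config \<Rightarrow> (real \<Rightarrow> 'g config) measure"
    and d :: "nat \<Rightarrow> nat \<Rightarrow> real"
    and D :: "'g config \<Rightarrow> 'g config \<Rightarrow> real"
  assumes "infinite (UNIV :: 'g set)"
    and "E \<in> sets config_space"
    and "markov_process (restrict_space config_space E) P"
    and "markov_process (count_space fin_configs) Q"
    and "\<And>\<xi> \<eta>. \<xi> \<in> fin_configs \<Longrightarrow> D \<xi> \<eta> \<ge> 0"
    and "dual_processes E P Q D"
    and "\<And>\<eta>. D (\<lambda>_. 0) \<eta> = 1"
    and "factorized_duality_function d D"
    and "conserves_particles E P"
    and "conserves_particles fin_configs Q"
    and "\<And>n. irreducible_on (n_configs n) Q"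
    and "\<And>\<xi> \<xi>'. \<xi> \<in> fin_configs \<Longrightarrow> \<xi>' \<in> fin_configs \<Longrightarrow>
           ((\<lambda>t. measure (Q \<xi>) {\<omega> \<in> space (Q \<xi>). perp (\<omega> t) \<xi>'}) \<longlongrightarrow> 1) at_top"
  shows
    "(\<forall>\<mu>. \<mu> \<in> invariant_measures E P \<inter> tempered_measures D \<inter> product_measures \<longrightarrow>
        \<mu> \<in> ergodic_measures E P)
     \<and>
     (successful_coupling TYPE('w) Q \<longrightarrow>
        (\<forall>\<theta>\<in>density_set E P D. \<exists>!\<mu>. is_mu D \<theta> \<mu>) \<and>
        tempered_measures D \<inter> invariant_measures E P \<inter> ergodic_measures E P
          = {\<mu>. \<exists>\<theta>\<in>density_set E P D. is_mu D \<theta> \<mu>})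
     \<and>
     (successful_coupling TYPE('w) Q \<longrightarrow>
        extreme_measures (tempered_measures D \<inter> invariant_measures E P)
          = tempered_measures D \<inter> extreme_measures (invariant_measures E P) \<and>
        tempered_measures D \<inter> extreme_measures (invariant_measures E P)
          = {\<mu>. \<exists>\<theta>\<in>density_set E P D. is_mu D \<theta> \<mu>})"
proof -
  have duality_fun: "duality_function d D" using assms(8) by (rule duality_function.intro)
  interpret dual_process_pair E P d D Q
    unfolding dual_process_pair_def dual_process_pair_axioms_def config_process_def
    using assms(2-4,6,10) duality_fun by blast
  let ?I = "invariant_measures E P" and ?T = "tempered_measures D" and ?Erg = "ergodic_measures E P"
  have product_ergodic: "\<mu> \<in> ?Erg" if "\<mu> \<in> ?I" "\<mu> \<in> ?T" "\<mu> \<in> product_measures" for \<mu>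
    using product_imp_ergodic[OF that assms(12)] .
  \<comment> \<open>an invariant tempered product measure is ergodic, so that its transform is a power of \<open>\<theta>\<close>;
    temperedness makes it the only such measure\<close>
  have density: "is_mu D \<theta> \<mu> \<and> \<mu> \<in> ?T \<inter> ?I \<and> \<mu> \<in> ?Erg \<and> (\<forall>\<nu>. is_mu D \<theta> \<nu> \<longrightarrow> \<nu> = \<mu>)"
    if coup: "successful_coupling TYPE('w) Q" and mu: "\<mu> \<in> ?I \<inter> ?T \<inter> product_measures"
      and \<theta>: "\<theta> = D_transform D \<mu> (single x)" for \<mu> \<theta> x
  proof -
    have inv: "\<mu> \<in> ?I" and temp: "\<mu> \<in> ?T" and prod: "\<mu> \<in> product_measures" using mu by blast+
    note erg = product_ergodic[OF inv temp prod]
    have power: "D_transform D \<mu> \<xi> = \<theta> ^ mass \<xi>" if "\<xi> \<in> fin_configs" for \<xi>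
      unfolding \<theta> by (rule ergodic_D_transform_power[OF assms(1) erg temp coup that])
    have "is_mu D \<theta> \<mu>"
      unfolding is_mu_def using prod tempered_D_integrable[OF temp] power by (simp add: n_configs_iff)
    moreover have "\<nu> = \<mu>" if nu: "is_mu D \<theta> \<nu>" for \<nu>
    proof (rule sym, rule tempered_determined[OF temp])
      show "\<nu> \<in> prob_measures" "D_integrable D \<nu>"
        using nu product_measures_subset_prob unfolding is_mu_def by blast+
      show "D_transform D \<mu> \<xi> = D_transform D \<nu> \<xi>" if "\<xi> \<in> fin_configs" for \<xi>
        using nu that power[OF that] unfolding is_mu_def by (simp add: n_configs_iff)
    qed
    ultimately show ?thesis using inv temp erg by blast
  qed
  have unique: "\<exists>!\<mu>. is_mu D \<theta> \<mu>"
    if coup: "successful_coupling TYPE('w) Q" and "\<theta> \<in> density_set E P D" for \<theta>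
  proof -
    from that(2) obtain x \<mu> where "\<theta> = D_transform D \<mu> (single x)" "\<mu> \<in> ?I \<inter> ?T \<inter> product_measures"
      unfolding density_set_def by blast
    from density[OF coup this(2,1)] show ?thesis by blast
  qed
  have tempered_ergodic: "?T \<inter> ?Erg = {\<mu>. \<exists>\<theta>\<in>density_set E P D. is_mu D \<theta> \<mu>}"
    if coup: "successful_coupling TYPE('w) Q"
  proof (intro set_eqI iffI)
    fix \<mu> assume "\<mu> \<in> ?T \<inter> ?Erg"
    then have temp: "\<mu> \<in> ?T" and erg: "\<mu> \<in> ?Erg" by blast+
    have inv: "\<mu> \<in> ?I" using erg unfolding ergodic_iff_two_time by (rule conjunct1)
    obtain y :: 'g where True by simp
    define \<theta> where "\<theta> = D_transform D \<mu> (single y)"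
    have power: "D_transform D \<mu> \<xi> = \<theta> ^ mass \<xi>" if "\<xi> \<in> fin_configs" for \<xi>
      unfolding \<theta>_def by (rule ergodic_D_transform_power[OF assms(1) erg temp coup that])
    have "\<theta> \<ge> 0" unfolding \<theta>_def by (rule D_transform_nonneg) simp
    from power_transform_imp_product[OF temp power this] have prod: "\<mu> \<in> product_measures" .
    have mem: "\<mu> \<in> ?I \<inter> ?T \<inter> product_measures" using inv temp prod by blast
    then have "\<theta> \<in> density_set E P D" unfolding density_set_def \<theta>_def by blast
    with density[OF coup mem \<theta>_def] show "\<mu> \<in> {\<mu>. \<exists>\<theta>\<in>density_set E P D. is_mu D \<theta> \<mu>}" by blast
  next
    fix \<mu> assume "\<mu> \<in> {\<mu>. \<exists>\<theta>\<in>density_set E P D. is_mu D \<theta> \<mu>}"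
    then obtain x \<nu> \<theta> where \<theta>: "\<theta> = D_transform D \<nu> (single x)" and nu: "\<nu> \<in> ?I \<inter> ?T \<inter> product_measures"
      and mu: "is_mu D \<theta> \<mu>" unfolding density_set_def by blast
    from density[OF coup nu \<theta>] mu show "\<mu> \<in> ?T \<inter> ?Erg" by blast
  qed
  have "?T \<inter> ?I \<inter> ?Erg = ?T \<inter> ?Erg"
    unfolding extreme_invariant_eq_ergodic[symmetric] extreme_measures_def by blast
  moreover have "extreme_measures (?T \<inter> ?I) = ?T \<inter> extreme_measures ?I"
    by (rule extreme_tempered_Int[OF duality_fun invariant_subset_prob])
  ultimately show ?thesis
    using product_ergodic unique tempered_ergodic unfolding extreme_invariant_eq_ergodic by simp
qed

end
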